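(* Let $\lambda\in K$. For finite nonempty sets $A,B$, $v\in A$, a weighted planar rooted tree $S$ labelled by $A$ and a weighted planar rooted tree $T$ labelled by $B$, set $$S\diamond_{v,\lambda}T=\begin{cases}\displaystyle\sum_{f:E(S,v)\to Ang(T)}\lambda^{\,d(S\diamond_v^fT)-d(S\diamond_v^{f_0}T)}\;S\diamond_v^fT&\text{if }|T|=|v|,\\[2mm]0&\text{otherwise,}\end{cases}$$ where $f$ runs over the increasing maps and $f_0$ is any increasing map from $E(S,v)$ to $Ang^0(T)$. These partial compositions define a structure of $\mathbb{N}^*$-current-preserving operad on the species $A\mapsto\mathcal{B}_A$. (This operad is denoted $\mathcal{B}^\lambda$.)
   Context: $K$ is a field of characteristic zero; $\mathbb{N}^*=\{1,2,3,\dots\}$ with addition; $0^0=1$. Operads in species form. An operad is a collection of vector spaces $\mathcal{O}_A$, one for each finite nonempty set $A$, functorial in bijections (relabelling), with bilinear partial compositions $\circ_v:\mathcal{O}_A\times\mathcal{O}_B\to\mathcal{O}_{(A\setminus\{v\})\amalg B}$ for $v\in A$, and a unit in $\mathcal{O}_{\{*\}}$ for each one-element set, such that: (nested associativity) $(a\circ_v b)\circ_w c=a\circ_v(b\circ_w c)$ for $v\in A$, $w\in B$; (disjoint associativity) $(a\circ_v b)\circ_w c=(a\circ_w c)\circ_v b$ for distinct $v,w\in A$; (unit) composing on either side with the unit acts as the identity, up to relabelling; (equivariance) compositions are compatible with relabelling. Current-preserving operads. Let $G$ be a commutative semigroup written additively. A $G$-current-preserving operad is an operad with $\mathcal{O}_A=\prod_{W:A\to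 G}\mathcal{O}_{A,W}$ such that $\mathcal{O}_{A,W}.\sigma=\mathcal{O}_{A,W\circ\sigma}$ for all $\sigma\in \mathrm{Aut}A$, and such that for $v\in A$ the composition $\circ_v$ restricts to $\mathcal{O}_{A,W}\otimes\mathcal{O}_{B,X}\to\mathcal{O}_{(A\setminus\{v\})\amalg B,\,W\amalg X}$ with image zero if $\sum_{b\in B}X(b)\ne W(v)$. Here $W\amalg X$ equals $W$ on $A\setminus\{v\}$ and $X$ on $B$. Partial compositions extend to the products in the evident way: each component of the result involves only one pair $(W,X)$. Trees. A planar rooted tree is a rooted tree in which the children of every vertex are totally ordered from left to right; $B_+(r,T_1\cdots T_k)$ is the tree with root $r$ and branches $T_1,\dots,T_k$ from left to right. A tree is labelled by $A$ if it comes with a bijection from its vertex set onto $A$. A weighted tree carries a weight function $W$ from its vertices to $\mathbb{N}^*$; $|v|=W(v)$ and $|T|=\sum_{v}W(v)$. $\mathcal{B}_{A,W}$ is the vector space spanned by planar rooted trees with $|A|$ vertices labelled by $A$ with weight function $W$, and $\mathcal{B}_A=\prod_{W:A\to\mathbb{N}^*}\mathcal{B}_{A,W}$. The symmetric groups act by permutation of labels. The unit is $e=\sum_{n\ge1}\bullet_n$, where $\bullet_n$ is the one-vertex tree of weight $n$ (infinite sum in the direct product). The potential energy is $d(T)=\sum_v W(v)h(v)$, where $h(v)$ is the number of edges from $v$ to the root. $E(S,v)$ is the set of edges joining $v$ to its children, ordered from left to right. Angles. An angle of $T$ is a pair consisting of a vertex $s$ and one of the sectors around $s$ cut out by $T$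 in a small disk centred at $s$; a vertex with $k$ children has exactly $k+1$ angles $(s,0),\dots,(s,k)$ from left to right (before the first child, between consecutive children, after the last). $Ang(T)$ is totally ordered from left to right: for $T=B_+(r,T_1\cdots T_k)$ the order is $(r,0)<Ang(T_1)<(r,1)<\cdots<Ang(T_k)<(r,k)$, recursively. $Ang^0(T)$ is the subset of angles at the root. "Increasing" means weakly increasing. Substitution. For an increasing map $f:E(S,v)\to Ang(T)$, $S\diamond_v^fT$ is the weighted planar rooted tree labelled by $(A\setminus\{v\})\amalg B$ obtained by replacing $v$ by $T$ and plugging each edge $a\in E(S,v)$ (with the branch above it) into the angle $f(a)$ of $T$; edges plugged into the same angle keep their left-to-right order. If $v$ is not the root of $S$, the edge going down from $v$ becomes the edge going down from the root of $T$, at the same position; otherwise the new root is that of $T$. Weights of vertices are inherited. When $|T|=|v|$, the energy $d(S\diamond_v^{f_0}T)$ does not depend on the choice of increasing $f_0:E(S,v)\to Ang^0(T)$, and it is the smallest among all $d(S\diamond_v^fT)$. *)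

theory Defs
  imports Complex_Main "HOL-Library.Poly_Mapping" "HOL-Library.FuncSet" "HOL-Library.Function_Algebras"
begin

section \<open>Operads in species form\<close>

text \<open>
  Finite sets are finite subsets of an arbitrary label type \<open>'a\<close>. The disjoint union
  \<open>(A \ {v}) \<amalg> B\<close> is modelled as an internal one: partial compositions are considered whenever
  \<open>A - {v}\<close> and \<open>B\<close> are disjoint; \<open>v \<in> B\<close> is allowed. For infinite \<open>'a\<close> the finite
  subsets of \<open>'a\<close> with bijections form a category equivalent to all finite sets with bijections,
  and every disjoint union can be realised up to relabelling.
\<close>

definition composable :: "'a set \<Rightarrow> 'a \<Rightarrow> 'a set \<Rightarrow> bool" where
  "composable A v B \<longleftrightarrow>
     finite A \<and> finite B \<and> v \<in> A \<and> B \<noteq> {} \<and> (A - {v}) \<inter> B = {}"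

definition subst_set :: "'a set \<Rightarrow> 'a \<Rightarrow> 'a set \<Rightarrow> 'a set" where
  "subst_set A v B = (A - {v}) \<union> B"

text \<open>
  The vector spaces \<open>Ob A\<close> are subspaces of one ambient vector space. Any bijection from \<open>A\<close> onto
  \<open>A'\<close> is an injection \<open>\<sigma>\<close> on \<open>A\<close> with \<open>\<sigma> ` A = A'\<close>, and \<open>relabel A \<sigma>\<close> is the induced map
  from \<open>Ob A\<close> to \<open>Ob (\<sigma> ` A)\<close>; only the values of \<open>\<sigma>\<close> on \<open>A\<close> matter (\<open>relabel_cong\<close>).
\<close>

locale operad = vector_space scale
  for scale :: "'k::field \<Rightarrow> 'm::ab_group_add \<Rightarrow> 'm" +
  fixes Ob :: "'a set \<Rightarrow> 'm set"
    and relabel :: "'a set \<Rightarrow> ('a \<Rightarrow> 'a) \<Rightarrow> 'm \<Rightarrow> 'm"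
    and pcomp :: "'a set \<Rightarrow> 'a \<Rightarrow> 'a set \<Rightarrow> 'm \<Rightarrow> 'm \<Rightarrow> 'm"
    and unit :: "'a \<Rightarrow> 'm"
  assumes Ob_subspace:
      "\<lbrakk>finite A; A \<noteq> {}\<rbrakk> \<Longrightarrow> module.subspace scale (Ob A)"
    and relabel_closed:
      "\<lbrakk>finite A; A \<noteq> {}; inj_on \<sigma> A; x \<in> Ob A\<rbrakk> \<Longrightarrow> relabel A \<sigma> x \<in> Ob (\<sigma> ` A)"
    and relabel_add:
      "\<lbrakk>finite A; A \<noteq> {}; inj_on \<sigma> A; x \<in> Ob A; y \<in> Ob A\<rbrakk>
        \<Longrightarrow> relabel A \<sigma> (x + y) = relabel A \<sigma> x + relabel A \<sigma> y"
    and relabel_scale: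
      "\<lbrakk>finite A; A \<noteq> {}; inj_on \<sigma> A; x \<in> Ob A\<rbrakk>
        \<Longrightarrow> relabel A \<sigma> (scale k x) = scale k (relabel A \<sigma> x)"
    and relabel_cong:
      "\<lbrakk>finite A; A \<noteq> {}; inj_on \<sigma> A; \<And>a. a \<in> A \<Longrightarrow> \<sigma> a = \<tau> a; x \<in> Ob A\<rbrakk>
        \<Longrightarrow> relabel A \<sigma> x = relabel A \<tau> x"
    and relabel_id:
      "\<lbrakk>finite A; A \<noteq> {}; x \<in> Ob A\<rbrakk> \<Longrightarrow> relabel A id x = x"
    and relabel_comp:
      "\<lbrakk>finite A; A \<noteq> {}; inj_on \<sigma> A; inj_on \<tau> (\<sigma> ` A); x \<in> Ob A\<rbrakk>
        \<Longrightarrow> relabel (\<sigma> ` A) \<tau> (relabel A \<sigma> x) = relabel A (\<tau> \<circ> \<sigma>) x"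
    and pcomp_closed:
      "\<lbrakk>composable A v B; x \<in> Ob A; y \<in> Ob B\<rbrakk> \<Longrightarrow> pcomp A v B x y \<in> Ob (subst_set A v B)"
    and pcomp_add_left:
      "\<lbrakk>composable A v B; x \<in> Ob A; x' \<in> Ob A; y \<in> Ob B\<rbrakk>
        \<Longrightarrow> pcomp A v B (x + x') y = pcomp A v B x y + pcomp A v B x' y"
    and pcomp_add_right:
      "\<lbrakk>composable A v B; x \<in> Ob A; y \<in> Ob B; y' \<in> Ob B\<rbrakk>
        \<Longrightarrow> pcomp A v B x (y + y') = pcomp A v B x y + pcomp A v B x y'"
    and pcomp_scale_left:
      "\<lbrakk>composable A v B; x \<in> Ob A; y \<in> Ob B\<rbrakk>
        \<Longrightarrow> pcomp A v B (scale k x) y = scale k (pcomp A v B x y)"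
    and pcomp_scale_right:
      "\<lbrakk>composable A v B; x \<in> Ob A; y \<in> Ob B\<rbrakk>
        \<Longrightarrow> pcomp A v B x (scale k y) = scale k (pcomp A v B x y)"
    and unit_closed: "unit u \<in> Ob {u}"
    and nested_assoc:
      "\<lbrakk>composable A v B; w \<in> B; composable (subst_set A v B) w C;
        a \<in> Ob A; b \<in> Ob B; c \<in> Ob C\<rbrakk>
        \<Longrightarrow> pcomp (subst_set A v B) w C (pcomp A v B a b) c
          = pcomp A v (subst_set B w C) a (pcomp B w C b c)"
    and disjoint_assoc:
      "\<lbrakk>composable A v B; composable A w C; v \<noteq> w; B \<inter> C = {};
        a \<in> Ob A; b \<in> Ob B; c \<in> Ob C\<rbrakk>
        \<Longrightarrow> pcomp (subst_set A v B) w C (pcomp A v B a b) c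
          = pcomp (subst_set A w C) v B (pcomp A w C a c) b"
    and unit_left:
      "\<lbrakk>finite B; B \<noteq> {}; b \<in> Ob B\<rbrakk> \<Longrightarrow> pcomp {u} u B (unit u) b = b"
    and unit_right:
      "\<lbrakk>composable A v {u}; a \<in> Ob A\<rbrakk>
        \<Longrightarrow> pcomp A v {u} a (unit u) = relabel A (id(v := u)) a"
    and equivariance:
      "\<lbrakk>composable A v B; inj_on \<sigma> A; inj_on \<tau> B; composable (\<sigma> ` A) (\<sigma> v) (\<tau> ` B);
        a \<in> Ob A; b \<in> Ob B\<rbrakk>
        \<Longrightarrow> pcomp (\<sigma> ` A) (\<sigma> v) (\<tau> ` B) (relabel A \<sigma> a) (relabel B \<tau> b)
          = relabel (subst_set A v B) (\<lambda>z. if z \<in> B then \<tau> z else \<sigma> z) (pcomp A v B a b)"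


section \<open>Current-preserving operads\<close>

text \<open>
  A commutative semigroup is given as a subset \<open>G\<close>, closed under addition, of a commutative monoid
  (adjoining a zero, every commutative semigroup arises this way), so that \<open>sum\<close> can be used. A
  map \<open>W : A \<rightarrow> G\<close> is an element of \<open>A \<rightarrow>\<^sub>E G\<close>.
\<close>

text \<open>The direct product of the spaces \<open>piece A W\<close> over all \<open>W : A \<rightarrow> G\<close>.\<close>

definition total_space ::
    "'g set \<Rightarrow> ('a set \<Rightarrow> ('a \<Rightarrow> 'g) \<Rightarrow> 'm::zero set) \<Rightarrow> 'a set \<Rightarrow> (('a \<Rightarrow> 'g) \<Rightarrow> 'm) set" where
  "total_space G piece A =
     {x. (\<forall>W \<in> A \<rightarrow>\<^sub>E G. x W \<in> piece A W) \<and> (\<forall>W. W \<notin> A \<rightarrow>\<^sub>E G \<longrightarrow> x W = 0)}"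

text \<open>The inclusion of the factor of index \<open>W\<close> into the product.\<close>

definition homog :: "('a \<Rightarrow> 'g) \<Rightarrow> 'm::zero \<Rightarrow> ('a \<Rightarrow> 'g) \<Rightarrow> 'm" where
  "homog W p = (\<lambda>W'. if W' = W then p else 0)"

definition glue :: "'a set \<Rightarrow> 'a \<Rightarrow> 'a set \<Rightarrow> ('a \<Rightarrow> 'g) \<Rightarrow> ('a \<Rightarrow> 'g) \<Rightarrow> 'a \<Rightarrow> 'g" where
  "glue A v B W X = restrict (\<lambda>z. if z \<in> B then X z else W z) (subst_set A v B)"

text \<open>
  The right action of \<open>\<sigma> \<in> Aut A\<close> is \<open>x.\<sigma> = relabel A \<sigma>\<inverse> x\<close>, so that
  \<open>O\<^bsub>A,W\<^esub>.\<sigma> = O\<^bsub>A,W \<circ> \<sigma>\<^esub>\<close> is the case \<open>\<sigma> ` A = A\<close> of \<open>relabel_homog\<close>. The axioms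
  \<open>relabel_component\<close> and \<open>pcomp_component\<close> express that relabellings and compositions of arbitrary
  elements of the products are determined componentwise: every map \<open>subst_set A v B \<rightarrow> G\<close> equals
  \<open>glue A v B W X\<close> for exactly one pair with \<open>sum X B = W v\<close>.
\<close>

locale current_preserving_operad =
  piece: vector_space scale +
  operad "\<lambda>c x W. scale c (x W)" "total_space G piece" relabel pcomp unit
  for scale :: "'k::field \<Rightarrow> 'm::ab_group_add \<Rightarrow> 'm"
    and G :: "'g::comm_monoid_add set"
    and piece :: "'a set \<Rightarrow> ('a \<Rightarrow> 'g) \<Rightarrow> 'm set"
    and relabel :: "'a set \<Rightarrow> ('a \<Rightarrow> 'a) \<Rightarrow> (('a \<Rightarrow> 'g) \<Rightarrow> 'm) \<Rightarrow> (('a \<Rightarrow> 'g) \<Rightarrow> 'm)"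
    and pcomp :: "'a set \<Rightarrow> 'a \<Rightarrow> 'a set \<Rightarrow> (('a \<Rightarrow> 'g) \<Rightarrow> 'm) \<Rightarrow> (('a \<Rightarrow> 'g) \<Rightarrow> 'm)
                    \<Rightarrow> (('a \<Rightarrow> 'g) \<Rightarrow> 'm)"
    and unit :: "'a \<Rightarrow> ('a \<Rightarrow> 'g) \<Rightarrow> 'm" +
  assumes G_add: "\<lbrakk>g \<in> G; h \<in> G\<rbrakk> \<Longrightarrow> g + h \<in> G"
    and piece_subspace:
      "\<lbrakk>finite A; A \<noteq> {}; W \<in> A \<rightarrow>\<^sub>E G\<rbrakk> \<Longrightarrow> module.subspace scale (piece A W)"
    and relabel_homog:
      "\<lbrakk>finite A; A \<noteq> {}; inj_on \<sigma> A; W \<in> \<sigma> ` A \<rightarrow>\<^sub>E G\<rbrakk>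
        \<Longrightarrow> relabel A \<sigma> ` homog (restrict (W \<circ> \<sigma>) A) ` piece A (restrict (W \<circ> \<sigma>) A)
          = homog W ` piece (\<sigma> ` A) W"
    and relabel_component:
      "\<lbrakk>finite A; A \<noteq> {}; inj_on \<sigma> A; W \<in> \<sigma> ` A \<rightarrow>\<^sub>E G; x \<in> total_space G piece A\<rbrakk>
        \<Longrightarrow> relabel A \<sigma> x W
          = relabel A \<sigma> (homog (restrict (W \<circ> \<sigma>) A) (x (restrict (W \<circ> \<sigma>) A))) W"
    and pcomp_homog:
      "\<lbrakk>composable A v B; W \<in> A \<rightarrow>\<^sub>E G; X \<in> B \<rightarrow>\<^sub>E G; p \<in> piece A W; q \<in> piece B X\<rbrakk>
        \<Longrightarrow> pcomp A v B (homog W p) (homog X q)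
          \<in> homog (glue A v B W X) ` piece (subst_set A v B) (glue A v B W X)"
    and pcomp_current:
      "\<lbrakk>composable A v B; W \<in> A \<rightarrow>\<^sub>E G; X \<in> B \<rightarrow>\<^sub>E G; p \<in> piece A W; q \<in> piece B X;
        sum X B \<noteq> W v\<rbrakk>
        \<Longrightarrow> pcomp A v B (homog W p) (homog X q) = 0"
    and pcomp_component:
      "\<lbrakk>composable A v B; W \<in> A \<rightarrow>\<^sub>E G; X \<in> B \<rightarrow>\<^sub>E G; sum X B = W v;
        x \<in> total_space G piece A; y \<in> total_space G piece B\<rbrakk>
        \<Longrightarrow> pcomp A v B x y (glue A v B W X)
          = pcomp A v B (homog W (x W)) (homog X (y X)) (glue A v B W X)"


section \<open>Labelled planar rooted trees\<close>

text \<open>\<open>Node r [T1, \<dots>, Tk]\<close> is \<open>B_+(r, T1 \<cdots> Tk)\<close>.\<close>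

datatype 'a ptree = Node (root: 'a) (branches: "'a ptree list")

fun vertices :: "'a ptree \<Rightarrow> 'a list" where
  "vertices (Node r ts) = r # concat (map vertices ts)"

text \<open>
  In a tree labelled by a set, vertices are identified with their labels. Accordingly, a weighted
  tree labelled by \<open>A\<close> is a tree \<open>T\<close> with \<open>labelled_by A T\<close> and a map \<open>W \<in> A \<rightarrow>\<^sub>E {1..}\<close>.
\<close>

definition labelled_by :: "'a set \<Rightarrow> 'a ptree \<Rightarrow> bool" where
  "labelled_by A T \<longleftrightarrow> distinct (vertices T) \<and> set (vertices T) = A"

definition weight :: "('a \<Rightarrow> nat) \<Rightarrow> 'a ptree \<Rightarrow> nat" where
  "weight W T = (\<Sum>v \<in> set (vertices T). W v)"

text \<open>In \<open>height\<close> and \<open>children\<close>, at most one branch contains \<open>v\<close>, as labels are distinct.\<close>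

fun height :: "'a ptree \<Rightarrow> 'a \<Rightarrow> nat" where
  "height (Node r ts) v =
     (if v = r then 0
      else Suc (sum_list (map (\<lambda>t. if v \<in> set (vertices t) then height t v else 0) ts)))"

definition energy :: "('a \<Rightarrow> nat) \<Rightarrow> 'a ptree \<Rightarrow> nat" where
  "energy W T = (\<Sum>v \<in> set (vertices T). W v * height T v)"

fun children :: "'a ptree \<Rightarrow> 'a \<Rightarrow> 'a ptree list" where
  "children (Node r ts) v = (if v = r then ts else concat (map (\<lambda>t. children t v) ts))"


section \<open>Angles and substitution\<close>

text \<open>\<open>angles T\<close> lists the angles of \<open>T\<close> from left to right.\<close>

fun angles :: "'a ptree \<Rightarrow> ('a \<times> nat) list"
  and angles_from :: "'a \<Rightarrow> nat \<Rightarrow> 'a ptree list \<Rightarrow> ('a \<times> nat) list" where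
  "angles (Node r ts) = (r, 0) # angles_from r 0 ts"
| "angles_from r i [] = []"
| "angles_from r i (t # ts) = angles t @ (r, Suc i) # angles_from r (Suc i) ts"

definition angle_le :: "'a ptree \<Rightarrow> 'a \<times> nat \<Rightarrow> 'a \<times> nat \<Rightarrow> bool" where
  "angle_le T \<alpha> \<beta> \<longleftrightarrow>
     (\<exists>i j. i \<le> j \<and> j < length (angles T) \<and> angles T ! i = \<alpha> \<and> angles T ! j = \<beta>)"

definition root_angles :: "'a ptree \<Rightarrow> ('a \<times> nat) set" where
  "root_angles T = {\<alpha> \<in> set (angles T). fst \<alpha> = root T}"

text \<open>The edges in \<open>E(S,v)\<close> are numbered \<open>0, 1, \<dots>\<close> from left to right.\<close>

definition edges :: "'a ptree \<Rightarrow> 'a \<Rightarrow> nat set" where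
  "edges S v = {..<length (children S v)}"

definition increasing_maps ::
    "'a ptree \<Rightarrow> 'a \<Rightarrow> 'a ptree \<Rightarrow> ('a \<times> nat) set \<Rightarrow> (nat \<Rightarrow> 'a \<times> nat) set" where
  "increasing_maps S v T D =
     {f \<in> edges S v \<rightarrow>\<^sub>E D. \<forall>i \<in> edges S v. \<forall>j \<in> edges S v. i \<le> j \<longrightarrow> angle_le T (f i) (f j)}"

text \<open>\<open>graft g T\<close> plugs the list of trees \<open>g \<alpha>\<close> into every angle \<open>\<alpha>\<close> of \<open>T\<close>.\<close>

fun graft :: "('a \<times> nat \<Rightarrow> 'a ptree list) \<Rightarrow> 'a ptree \<Rightarrow> 'a ptree"
  and graft_from :: "('a \<times> nat \<Rightarrow> 'a ptree list) \<Rightarrow> 'a \<Rightarrow> nat \<Rightarrow> 'a ptree list \<Rightarrow> 'a ptree list" where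
  "graft g (Node r ts) = Node r (g (r, 0) @ graft_from g r 0 ts)"
| "graft_from g r i [] = []"
| "graft_from g r i (t # ts) = graft g t # g (r, Suc i) @ graft_from g r (Suc i) ts"

fun substitute :: "'a ptree \<Rightarrow> 'a \<Rightarrow> (nat \<Rightarrow> 'a \<times> nat) \<Rightarrow> 'a ptree \<Rightarrow> 'a ptree" where
  "substitute (Node r us) v f T =
     (if r = v
      then graft (\<lambda>\<alpha>. map (\<lambda>i. us ! i) (filter (\<lambda>i. f i = \<alpha>) [0..<length us])) T
      else Node r (map (\<lambda>u. substitute u v f T) us))"


section \<open>The spaces of trees and their partial compositions\<close>

definition scale_pm :: "'k::field \<Rightarrow> ('b \<Rightarrow>\<^sub>0 'k) \<Rightarrow> ('b \<Rightarrow>\<^sub>0 'k)" where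
  "scale_pm c p = Poly_Mapping.map ((*) c) p"

text \<open>The basis of \<open>tree_piece A W\<close> is the set of trees labelled by \<open>A\<close>, each with weights \<open>W\<close>.\<close>

definition tree_piece :: "'a set \<Rightarrow> ('a \<Rightarrow> nat) \<Rightarrow> ('a ptree \<Rightarrow>\<^sub>0 'k::field) set" where
  "tree_piece A W = {p. \<forall>T \<in> Poly_Mapping.keys p. labelled_by A T}"

definition substitution_energy ::
    "('a \<Rightarrow> nat) \<Rightarrow> 'a ptree \<Rightarrow> 'a \<Rightarrow> (nat \<Rightarrow> 'a \<times> nat) \<Rightarrow> ('a \<Rightarrow> nat) \<Rightarrow> 'a ptree \<Rightarrow> nat" where
  "substitution_energy W S v f X T =
     energy (glue (set (vertices S)) v (set (vertices T)) W X) (substitute S v f T)"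

text \<open>
  For weighted trees \<open>(S, W)\<close> and \<open>(T, X)\<close>; the result lies in the factor of index
  \<open>glue A v B W X\<close>. The energy at \<open>f0\<close> is minimal, so the subtraction does not truncate.
\<close>

definition diamond ::
    "'k::field \<Rightarrow> ('a \<Rightarrow> nat) \<Rightarrow> 'a ptree \<Rightarrow> 'a \<Rightarrow> ('a \<Rightarrow> nat) \<Rightarrow> 'a ptree \<Rightarrow> ('a ptree \<Rightarrow>\<^sub>0 'k)" where
  "diamond l W S v X T =
     (if weight X T = W v then
        (let f0 = (SOME f0. f0 \<in> increasing_maps S v T (root_angles T)) in
         \<Sum>f \<in> increasing_maps S v T (set (angles T)).
           Poly_Mapping.single (substitute S v f T)
             (l ^ (substitution_energy W S v f X T - substitution_energy W S v f0 X T)))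
      else 0)"

definition tree_pcomp_piece ::
    "'k::field \<Rightarrow> 'a \<Rightarrow> ('a \<Rightarrow> nat) \<Rightarrow> ('a \<Rightarrow> nat)
      \<Rightarrow> ('a ptree \<Rightarrow>\<^sub>0 'k) \<Rightarrow> ('a ptree \<Rightarrow>\<^sub>0 'k) \<Rightarrow> ('a ptree \<Rightarrow>\<^sub>0 'k)" where
  "tree_pcomp_piece l v W X p q =
     (\<Sum>S \<in> Poly_Mapping.keys p. \<Sum>T \<in> Poly_Mapping.keys q.
        scale_pm (Poly_Mapping.lookup p S * Poly_Mapping.lookup q T) (diamond l W S v X T))"

text \<open>
  The component of index \<open>Z\<close> only involves the pair \<open>(W, X)\<close> with \<open>Z = glue A v B W X\<close> and
  \<open>W v = sum X B\<close>, since for all other pairs \<open>diamond\<close> vanishes.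
\<close>

definition tree_pcomp ::
    "'k::field \<Rightarrow> 'a set \<Rightarrow> 'a \<Rightarrow> 'a set \<Rightarrow> (('a \<Rightarrow> nat) \<Rightarrow> 'a ptree \<Rightarrow>\<^sub>0 'k)
      \<Rightarrow> (('a \<Rightarrow> nat) \<Rightarrow> 'a ptree \<Rightarrow>\<^sub>0 'k) \<Rightarrow> (('a \<Rightarrow> nat) \<Rightarrow> 'a ptree \<Rightarrow>\<^sub>0 'k)" where
  "tree_pcomp l A v B x y =
     (\<lambda>Z. if Z \<in> subst_set A v B \<rightarrow>\<^sub>E {1..} then
            (let X = restrict Z B; W = restrict (Z(v := sum X B)) A
             in tree_pcomp_piece l v W X (x W) (y X))
          else 0)"

text \<open>On basis elements, \<open>tree_pcomp\<close> is given by \<open>diamond\<close>.\<close>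

lemma tree_pcomp_basis:
  assumes AB: "composable A v B" and W: "W \<in> A \<rightarrow>\<^sub>E {1..}" and X: "X \<in> B \<rightarrow>\<^sub>E {1..}"
    and T: "labelled_by B T"
  shows "tree_pcomp l A v B (homog W (Poly_Mapping.single S 1)) (homog X (Poly_Mapping.single T 1))
           = homog (glue A v B W X) (diamond l W S v X T)"
proof (rule ext)
  fix Z
  have v: "v \<in> A" and disj: "(A - {v}) \<inter> B = {}" using AB by (auto simp: composable_def)
  have dom: "glue A v B W X \<in> subst_set A v B \<rightarrow>\<^sub>E {1..}"
    using W X by (auto simp: glue_def subst_set_def PiE_iff)
  have wt: "weight X T = sum X B" using T by (simp add: weight_def labelled_by_def)
  have scale_one: "scale_pm 1 p = p" for p :: "'a ptree \<Rightarrow>\<^sub>0 'b"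
    by (rule poly_mapping_eqI) (simp add: scale_pm_def Poly_Mapping.map.rep_eq when_def)
  show "tree_pcomp l A v B (homog W (Poly_Mapping.single S 1)) (homog X (Poly_Mapping.single T 1)) Z
      = homog (glue A v B W X) (diamond l W S v X T) Z"
  proof (cases "Z \<in> subst_set A v B \<rightarrow>\<^sub>E {1..}")
    case False
    then have "Z \<noteq> glue A v B W X" using dom by auto
    then show ?thesis using False by (simp add: tree_pcomp_def homog_def)
  next
    case Z: True
    define X' where "X' = restrict Z B"
    define W' where "W' = restrict (Z(v := sum X' B)) A"
    have sumX': "sum X' B = sum Z B" by (simp add: X'_def)
    have Zeq: "glue A v B W' X' = Z"
    proof (rule ext)
      fix z show "glue A v B W' X' z = Z z"
        using Z v disj by (auto simp: glue_def subst_set_def W'_def X'_def PiE_iff extensional_def)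
    qed
    have W'v: "W' v = sum X' B" using v by (simp add: W'_def)
    have lhs: "tree_pcomp l A v B (homog W (Poly_Mapping.single S 1))
          (homog X (Poly_Mapping.single T 1)) Z
        = (if W' = W \<and> X' = X then diamond l W S v X T else 0)"
      using Z by (auto simp: tree_pcomp_def Let_def homog_def X'_def[symmetric] sumX'[symmetric]
          W'_def[symmetric] tree_pcomp_piece_def scale_one)
    show ?thesis
    proof (cases "Z = glue A v B W X")
      case False
      then have "\<not> (W' = W \<and> X' = X)" using Zeq by auto
      then show ?thesis unfolding lhs using False by (auto simp: homog_def)
    next
      case True
      have X'X: "X' = X"
      proof (rule ext)
        fix z show "X' z = X z"
          using X by (auto simp: X'_def True glue_def subst_set_def PiE_iff extensional_def)
      qed
      have "W' = W" if "W v = sum X B"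
      proof (rule ext)
        fix z show "W' z = W z"
          using W disj that X'X
          by (auto simp: W'_def True glue_def subst_set_def PiE_iff extensional_def)
      qed
      moreover have "diamond l W S v X T = 0" if "W v \<noteq> sum X B"
        using that wt by (simp add: diamond_def)
      ultimately show ?thesis unfolding lhs using True X'X by (auto simp: homog_def)
    qed
  qed
qed

definition tree_relabel ::
    "'a set \<Rightarrow> ('a \<Rightarrow> 'a) \<Rightarrow> (('a \<Rightarrow> nat) \<Rightarrow> 'a ptree \<Rightarrow>\<^sub>0 'k::field)
      \<Rightarrow> (('a \<Rightarrow> nat) \<Rightarrow> 'a ptree \<Rightarrow>\<^sub>0 'k)" where
  "tree_relabel A \<sigma> x =
     (\<lambda>W. if W \<in> \<sigma> ` A \<rightarrow>\<^sub>E {1..} then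
            (let p = x (restrict (W \<circ> \<sigma>) A)
             in \<Sum>T \<in> Poly_Mapping.keys p.
                  Poly_Mapping.single (map_ptree \<sigma> T) (Poly_Mapping.lookup p T))
          else 0)"

text \<open>The infinite sum of all one-vertex trees labelled by \<open>u\<close>.\<close>

definition tree_unit :: "'a \<Rightarrow> ('a \<Rightarrow> nat) \<Rightarrow> ('a ptree \<Rightarrow>\<^sub>0 'k::field)" where
  "tree_unit u = (\<lambda>W. if W \<in> {u} \<rightarrow>\<^sub>E {1..} then Poly_Mapping.single (Node u []) 1 else 0)"

end

(* A tree R occurs in the composition of S and T at v exactly when deleting all vertices outside T
   from R leaves T, deleting all vertices of T other than its root r leaves S with v renamed to r,
   and every ancestor outside T of a vertex of T is an ancestor of r. The increasing map is determined
   by R, so each such R occurs exactly once, and since the weight of T is that of v, the least energy is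
   d(S) + d(T); the exponent of lambda at R is therefore d(R) - d(S) - d(T). In a double composition
   the exponents telescope to d(R) - d(S) - d(T) - d(U), so both associativity axioms reduce to
   equalities of sets of trees R. These follow because deletions compose: both sides say which
   trees are left when R is restricted to the vertices of each factor. *)

theory Submission
  imports Defs "HOL-Library.Multiset"
begin


section \<open>Deleting vertices of a tree\<close>

text \<open>Comparing double compositions through their increasing maps would mean tracking how the
  angles of one tree are rearranged when another is grafted into it; the intrinsic description
  avoids this. Its condition on ancestors is essential, because the two deletions alone allow a
  vertex of S to slip in between two vertices of T. The energy is the sum of W(y) over all pairs of
  a vertex y and a proper ancestor x of y, and a deletion preserves exactly the pairs whose two
  vertices it keeps. So in R the pairs inside T give d(T), and the pairs coming from S give d(S): a
  vertex of S above v is above all of T, and |T| replaces |v|. What is left are the pairs in which a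
  non-root vertex of T is above a vertex of S; their weights add up to the exponent of lambda. They
  are absent when only root angles are used, which explains both the minimum and its independence of
  f0. In the disjoint case one more fact about trees enters: the ancestors of a vertex form a
  chain.\<close>

lemma set_vertices [simp]: "set (vertices t) = set_ptree t"
  by (induction t) auto

lemma root_in_set_ptree [simp]: "root t \<in> set_ptree t"
  by (cases t) auto

lemma vertices_map_ptree: "vertices (map_ptree \<rho> t) = map \<rho> (vertices t)"
  by (induction t) (auto simp: map_concat intro!: arg_cong[where f=concat])

lemma distinct_root [simp]:
  "distinct (vertices (Node r ts)) \<longleftrightarrow>
     r \<notin> (\<Union>t\<in>set ts. set_ptree t) \<and> distinct (concat (map vertices ts))"
  by auto

lemma distinct_concat_vertices_memD:
  "distinct (concat (map vertices ts)) \<Longrightarrow> t \<in> set ts \<Longrightarrow> distinct (vertices t)"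
  by (induction ts) auto

lemma distinct_concat_vertices_inter:
  "distinct (concat (map vertices ts)) \<Longrightarrow> t \<in> set ts \<Longrightarrow> u \<in> set ts \<Longrightarrow>
     x \<in> set_ptree t \<Longrightarrow> x \<in> set_ptree u \<Longrightarrow> t = u"
proof (induction ts)
  case (Cons a ts)
  have "False" if "v \<in> set ts" "x \<in> set_ptree v" "x \<in> set_ptree a" for v
    using Cons.prems(1) that by auto
  with Cons show ?case
    by auto
qed simp

lemma distinct_concat_vertices_distinct:
  "distinct (concat (map vertices ts)) \<Longrightarrow> distinct ts"
proof (induction ts)
  case (Cons t ts)
  have "t \<notin> set ts"
  proof
    assume "t \<in> set ts"
    then have "root t \<in> set (concat (map vertices ts))"
      by (auto intro: bexI[of _ t])
    moreover have "root t \<in> set (vertices t)"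
      by simp
    ultimately show False
      using Cons.prems by (auto simp del: set_vertices)
  qed
  with Cons show ?case
    by auto
qed simp

text \<open>Proper ancestors, as pairs (upper, lower). Next to \<open>keep\<close>, this relation is
  all that the description of substitutions uses of a tree, and energies are counted in it.\<close>

fun anc :: "'a ptree \<Rightarrow> ('a \<times> 'a) set" where
  "anc (Node r ts) = {r} \<times> (\<Union>t\<in>set ts. set_ptree t) \<union> (\<Union>t\<in>set ts. anc t)"

text \<open>The result is a list because deleting the root leaves a forest: the branches of a
  deleted vertex take its place among its siblings, in their order. That a single tree
  \<open>u\<close> is left is thus written \<open>keep X t = [u]\<close>.\<close>

fun keep :: "'a set \<Rightarrow> 'a ptree \<Rightarrow> 'a ptree list" where
  "keep X (Node r ts) =
     (if r \<in> X then [Node r (concat (map (keep X) ts))] else concat (map (keep X) ts))"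

text \<open>Kept folded, so that inductions on trees can run an inner induction on the list of
  branches with \<open>keepf_simps\<close>; \<open>keep_Node\<close> then replaces the defining
  equation of \<open>keep\<close>.\<close>

definition keepf :: "'a set \<Rightarrow> 'a ptree list \<Rightarrow> 'a ptree list" where
  "keepf X ts = concat (map (keep X) ts)"

lemma keepf_simps [simp]:
  "keepf X [] = []" "keepf X (t # ts) = keep X t @ keepf X ts"
  "keepf X (ts @ us) = keepf X ts @ keepf X us"
  by (auto simp: keepf_def)

lemma keep_Node:
  "keep X (Node r ts) = (if r \<in> X then [Node r (keepf X ts)] else keepf X ts)"
  by (simp add: keepf_def)

declare keep.simps [simp del]

lemma keepf_cong_trees:
  "(\<And>t. t \<in> set ts \<Longrightarrow> keep X t = keep Y t) \<Longrightarrow> keepf X ts = keepf Y ts"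
  by (auto simp: keepf_def intro!: arg_cong[where f=concat])

lemma keep_cong: "X \<inter> set_ptree t = Y \<inter> set_ptree t \<Longrightarrow> keep X t = keep Y t"
proof (induction t)
  case (Node r ts)
  have "keepf X ts = keepf Y ts"
    using Node by (intro keepf_cong_trees) fastforce
  moreover have "r \<in> X \<longleftrightarrow> r \<in> Y"
    using Node.prems by auto
  ultimately show ?case
    by (simp add: keep_Node)
qed

lemma keep_all: "set_ptree t \<subseteq> X \<Longrightarrow> keep X t = [t]"
proof (induction t)
  case (Node r ts)
  have "keep X t = [t]" if "t \<in> set ts" for t
    using Node that by auto
  then have "keepf X ts = ts"
    by (induction ts) auto
  then show ?case
    using Node.prems by (simp add: keep_Node)
qed

lemma keepf_all: "(\<And>t. t \<in> set ts \<Longrightarrow> set_ptree t \<subseteq> X) \<Longrightarrow> keepf X ts = ts"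
  by (induction ts) (auto simp: keep_all)

text \<open>Branches move up into the place of their deleted parent, so the preorder list of
  vertices is only thinned out. Vertex sets and distinctness of the remaining forest are both read
  off from this.\<close>

lemma vertices_keep:
  "concat (map vertices (keep X t)) = filter (\<lambda>x. x \<in> X) (vertices t)"
proof (induction t)
  case (Node r ts)
  have "concat (map vertices (keepf X ts)) = filter (\<lambda>x. x \<in> X) (concat (map vertices ts))"
    using Node by (induction ts) auto
  then show ?case
    by (simp add: keep_Node)
qed

lemma set_keep: "(\<Union>u\<in>set (keep X t). set_ptree u) = X \<inter> set_ptree t"
  using arg_cong[OF vertices_keep[of X t], of set] by auto

lemma set_keepf: "(\<Union>u\<in>set (keepf X ts). set_ptree u) = X \<inter> (\<Union>t\<in>set ts. set_ptree t)"
  by (induction ts) (auto simp: set_keep)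

lemma keep_eq_Nil_iff: "keep X t = [] \<longleftrightarrow> X \<inter> set_ptree t = {}"
proof
  assume "X \<inter> set_ptree t = {}"
  then have *: "(\<Union>u\<in>set (keep X t). set_ptree u) = {}"
    using set_keep[of X t] by simp
  show "keep X t = []"
  proof (rule ccontr)
    assume "keep X t \<noteq> []"
    then have "root (hd (keep X t)) \<in> (\<Union>u\<in>set (keep X t). set_ptree u)"
      by (intro UN_I[of "hd (keep X t)"]) auto
    with * show False
      by simp
  qed
next
  assume "keep X t = []"
  then show "X \<inter> set_ptree t = {}"
    using set_keep[of X t] by simp
qed

lemma keepf_eq_Nil_iff: "keepf X ts = [] \<longleftrightarrow> (\<forall>t\<in>set ts. X \<inter> set_ptree t = {})"
  by (induction ts) (auto simp: keep_eq_Nil_iff)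

text \<open>Each vertex is kept or deleted independently of the others, so two deletions amount to
  one.\<close>

lemma keepf_keep: "keepf X (keep Y t) = keep (X \<inter> Y) t"
proof (induction t)
  case (Node r ts)
  have "keepf X (keepf Y ts) = keepf (X \<inter> Y) ts"
    using Node by (induction ts) auto
  then show ?case
    by (auto simp: keep_Node)
qed

lemma keep_keep:
  assumes "keep Y t = [u]"
  shows "keep X u = keep (X \<inter> Y) t"
  using keepf_keep[of X Y t] assms by simp

lemma keep_map_ptree:
  "keep X (map_ptree \<rho> t) = map (map_ptree \<rho>) (keep (\<rho> -` X) t)"
proof (induction t)
  case (Node r ts)
  have "keepf X (map (map_ptree \<rho>) ts) = map (map_ptree \<rho>) (keepf (\<rho> -` X) ts)"
    using Node by (induction ts) auto
  then show ?case
    by (auto simp: keep_Node)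
qed

section \<open>Ancestors, and their behaviour under deletion\<close>

lemma anc_subset: "anc t \<subseteq> set_ptree t \<times> set_ptree t"
  by (induction t) fastforce

lemma ancD: "(x, y) \<in> anc t \<Longrightarrow> x \<in> set_ptree t \<and> y \<in> set_ptree t"
  using anc_subset[of t] by auto

lemma anc_map_ptree: "anc (map_ptree \<rho> t) = map_prod \<rho> \<rho> ` anc t"
proof (induction t)
  case (Node r ts)
  then show ?case
    by (auto simp: ptree.set_map image_UN image_Un map_prod_def)
qed

text \<open>Deleting vertices between x and y leaves x above y, and no new pair arises, since a
  vertex only moves up into the place of one of its ancestors.\<close>

lemma anc_keep: "(\<Union>u\<in>set (keep X t). anc u) = anc t \<inter> X \<times> X"
proof (induction t)
  case (Node r ts)
  have "(\<Union>u\<in>set (keepf X ts). anc u) = (\<Union>t\<in>set ts. anc t) \<inter> X \<times> X"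
    using Node by (induction ts) (auto simp: Int_Un_distrib2)
  moreover have "(\<Union>u\<in>set (keepf X ts). set_ptree u) = X \<inter> (\<Union>t\<in>set ts. set_ptree t)"
    by (rule set_keepf)
  moreover have "anc t \<subseteq> set_ptree t \<times> set_ptree t" for t :: "'a ptree"
    by (rule anc_subset)
  ultimately show ?case
    by (auto simp: keep_Node)
qed

lemma anc_keep_single: "keep X t = [u] \<Longrightarrow> anc u = anc t \<inter> X \<times> X"
  using anc_keep[of X t] by simp

lemma set_keep_single: "keep X t = [u] \<Longrightarrow> set_ptree u = X \<inter> set_ptree t"
  using set_keep[of X t] by simp

lemma root_keep_single: "keep X t = [u] \<Longrightarrow> root t \<in> X \<Longrightarrow> root u = root t"
  by (cases t) (auto simp: keep_Node)

lemma distinct_keep_single: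
  "keep X t = [u] \<Longrightarrow> distinct (vertices t) \<Longrightarrow> distinct (vertices u)"
  using vertices_keep[of X t] by simp

lemma anc_root: "x \<in> set_ptree t \<Longrightarrow> x \<noteq> root t \<Longrightarrow> (root t, x) \<in> anc t"
  by (cases t) auto

lemma anc_trans: "distinct (vertices t) \<Longrightarrow> (x, y) \<in> anc t \<Longrightarrow> (y, z) \<in> anc t \<Longrightarrow> (x, z) \<in> anc t"
proof (induction t)
  case (Node r ts)
  show ?case
  proof (cases "x = r")
    case True
    then show ?thesis
      using Node.prems(3) by (auto dest: ancD)
  next
    case False
    then obtain t where t: "t \<in> set ts" "(x, y) \<in> anc t"
      using Node.prems by auto
    have "y \<noteq> r"
      using t Node.prems(1) by (auto dest: ancD)
    then obtain u where u: "u \<in> set ts" "(y, z) \<in> anc u"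
      using Node.prems(3) by auto
    have "t = u"
      using t u Node.prems(1) by (intro distinct_concat_vertices_inter[of ts t u y]) (auto dest: ancD)
    then have "(x, z) \<in> anc t"
      using Node.IH t u Node.prems(1) by (auto dest: distinct_concat_vertices_memD)
    then show ?thesis
      using t by auto
  qed
qed

lemma anc_irrefl: "distinct (vertices t) \<Longrightarrow> (x, x) \<notin> anc t"
proof (induction t)
  case (Node r ts)
  then show ?case
    by (auto dest: distinct_concat_vertices_memD)
qed

text \<open>The ancestors of z lie on one path to the root. In the disjoint case this compares a
  vertex of one inserted tree with the root of the other.\<close>

lemma anc_chain:
  "distinct (vertices t) \<Longrightarrow> (x, z) \<in> anc t \<Longrightarrow> (y, z) \<in> anc t \<Longrightarrow>
     x = y \<or> (x, y) \<in> anc t \<or> (y, x) \<in> anc t"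
proof (induction t)
  case (Node r ts)
  show ?case
  proof (cases "x = r \<or> y = r")
    case True
    then show ?thesis
      using ancD[OF Node.prems(2)] ancD[OF Node.prems(3)] by auto
  next
    case False
    then obtain t u where t: "t \<in> set ts" "(x, z) \<in> anc t" and u: "u \<in> set ts" "(y, z) \<in> anc u"
      using Node.prems by auto
    have "t = u"
      using t u Node.prems(1) by (intro distinct_concat_vertices_inter[of ts t u z]) (auto dest: ancD)
    then have "x = y \<or> (x, y) \<in> anc t \<or> (y, x) \<in> anc t"
      using Node.IH t u Node.prems(1) by (auto dest: distinct_concat_vertices_memD)
    then show ?thesis
      using t by auto
  qed
qed

text \<open>Produces a tree where none is given in advance: as long as the root is deleted, all kept
  vertices lie in the branch that contains \<open>r\<close>, and the descent ends at
  \<open>r\<close> itself.\<close>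

lemma keep_single:
  assumes "distinct (vertices t)" and "r \<in> X \<inter> set_ptree t"
    and "\<And>x. x \<in> X \<inter> set_ptree t \<Longrightarrow> x \<noteq> r \<Longrightarrow> (r, x) \<in> anc t"
  shows "\<exists>u. keep X t = [u] \<and> root u = r"
  using assms
proof (induction t)
  case (Node q ts)
  show ?case
  proof (cases "q \<in> X")
    case True
    have "q = r"
    proof (rule ccontr)
      assume "q \<noteq> r"
      then have "(r, q) \<in> anc (Node q ts)"
        using Node.prems(3)[of q] True by simp
      moreover have "(q, r) \<in> anc (Node q ts)"
        using Node.prems(2) \<open>q \<noteq> r\<close> by auto
      ultimately have "(r, r) \<in> anc (Node q ts)"
        by (rule anc_trans[OF Node.prems(1)])
      then show False
        using anc_irrefl[OF Node.prems(1)] by blast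
    qed
    then show ?thesis
      using True by (simp add: keep_Node)
  next
    case False
    then have "r \<noteq> q"
      using Node.prems(2) by auto
    then obtain t where t: "t \<in> set ts" "r \<in> set_ptree t"
      using Node.prems(2) by auto
    have dt: "distinct (vertices t)"
      using Node.prems(1) t by (auto dest: distinct_concat_vertices_memD)
    \<comment> \<open>A kept vertex is below \<open>r\<close> or equal to it, hence in the branch
      \<open>t\<close> of \<open>r\<close>; all other branches disappear.\<close>
    have *: "x \<in> set_ptree t \<and> (x \<noteq> r \<longrightarrow> (r, x) \<in> anc t)" if "x \<in> X" "u \<in> set ts" "x \<in> set_ptree u" for u x
    proof (cases "x = r")
      case False
      then have "(r, x) \<in> anc (Node q ts)"
        using Node.prems(3)[of x] that by auto
      then obtain t' where "t' \<in> set ts" "(r, x) \<in> anc t'"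
        using \<open>r \<noteq> q\<close> by auto
      moreover from this have "t' = t"
        using t Node.prems(1) by (intro distinct_concat_vertices_inter[of ts t' t r]) (auto dest: ancD)
      ultimately show ?thesis
        by (auto dest: ancD)
    qed (use t in auto)
    have ex: "\<exists>u. keep X t = [u] \<and> root u = r"
      using Node.IH[OF t(1) dt] * t Node.prems(2) by auto
    have disj: "X \<inter> set_ptree u = {}" if "u \<in> set ts" "u \<noteq> t" for u
      using *[of _ u] that t(1) Node.prems(1)
      by (auto dest: distinct_concat_vertices_inter[of ts t u])
    obtain us vs where ts: "ts = us @ t # vs"
      using t(1) by (meson split_list)
    have "distinct ts"
      using Node.prems(1) distinct_concat_vertices_distinct by auto
    then have "keepf X us = []" "keepf X vs = []"
      using disj ts by (auto simp: keepf_eq_Nil_iff)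
    then have "keepf X ts = keep X t"
      by (simp add: ts)
    then show ?thesis
      using ex False by (simp add: keep_Node)
  qed
qed


section \<open>Grafting forests into the angles of a tree\<close>

text \<open>Replaces the whole subtree at \<open>v\<close>, its branches included; in a substitution
  these branches return inside \<open>R\<close>. This separates the place of a substitution from
  what happens there.\<close>

fun plug :: "'a \<Rightarrow> 'a ptree \<Rightarrow> 'a ptree \<Rightarrow> 'a ptree" where
  "plug v R (Node r us) = (if r = v then R else Node r (map (plug v R) us))"

lemma plug_notin: "v \<notin> set_ptree S \<Longrightarrow> plug v R S = S"
  by (induction S) (auto intro!: map_idI)

lemma substitute_notin: "v \<notin> set_ptree S \<Longrightarrow> substitute S v f T = S"
  by (induction S) (auto intro!: map_idI)

lemma children_notin: "v \<notin> set_ptree S \<Longrightarrow> children S v = []"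
  by (induction S) auto

text \<open>The argument that \<open>substitute\<close> passes to \<open>graft\<close>. Increasing
  maps are translated into such lists of trees at the angles, and back.\<close>

definition fiber :: "'b list \<Rightarrow> (nat \<Rightarrow> 'c) \<Rightarrow> 'c \<Rightarrow> 'b list" where
  "fiber us f \<alpha> = map (\<lambda>i. us ! i) (filter (\<lambda>i. f i = \<alpha>) [0..<length us])"

lemma distinct_branches_split:
  assumes "distinct (concat (map vertices ts))" and "t \<in> set ts" "v \<in> set_ptree t"
  obtains us ws where "ts = us @ t # ws" "v \<notin> (\<Union>u\<in>set us. set_ptree u)"
    "v \<notin> (\<Union>u\<in>set ws. set_ptree u)"
proof -
  obtain us ws where ts: "ts = us @ t # ws"
    using assms(2) by (meson split_list)
  moreover have "v \<notin> (\<Union>u\<in>set us. set_ptree u)" "v \<notin> (\<Union>u\<in>set ws. set_ptree u)"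
    using assms(1,3) unfolding ts by auto
  ultimately show thesis
    using that by blast
qed

lemma children_split:
  assumes "v \<noteq> x" "v \<notin> (\<Union>u\<in>set us. set_ptree u)" "v \<notin> (\<Union>u\<in>set ws. set_ptree u)"
  shows "children (Node x (us @ t # ws)) v = children t v"
proof -
  have "concat (map (\<lambda>t. children t v) us) = []" "concat (map (\<lambda>t. children t v) ws) = []"
    using assms by (auto simp: children_notin)
  then show ?thesis
    using assms(1) by (simp del: concat_eq_Nil_conv)
qed

text \<open>Labels are distinct, so only one branch contains \<open>v\<close>; the recursion changes
  nothing off the path to \<open>v\<close>, where it meets the branches
  \<open>children S v\<close>.\<close>

lemma substitute_eq_plug:
  "distinct (vertices S) \<Longrightarrow> v \<in> set_ptree S \<Longrightarrow>
     substitute S v f T = plug v (graft (fiber (children S v) f) T) S"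
proof (induction S)
  case (Node x ts)
  show ?case
  proof (cases "x = v")
    case True
    have "fiber ts f = (\<lambda>\<alpha>. map (\<lambda>i. ts ! i) (filter (\<lambda>i. f i = \<alpha>) [0..<length ts]))"
      by (auto simp: fiber_def)
    then show ?thesis
      using True by simp
  next
    case False
    then obtain t where t: "t \<in> set ts" "v \<in> set_ptree t"
      using Node.prems by auto
    then obtain us ws where ts: "ts = us @ t # ws" and nin: "v \<notin> (\<Union>u\<in>set us. set_ptree u)"
      "v \<notin> (\<Union>u\<in>set ws. set_ptree u)"
      using Node.prems(1) by (auto elim: distinct_branches_split)
    have "substitute t v f T = plug v (graft (fiber (children t v) f) T) t"
      using Node t by (auto dest: distinct_concat_vertices_memD)
    then show ?thesis
      using False nin children_split[of v x us ws t] unfolding ts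
      by (auto simp: plug_notin substitute_notin)
  qed
qed

text \<open>The bound on the second component records that \<open>angles_from r i\<close> starts
  after the angle \<open>(r, i)\<close>; it separates the angles of one vertex in
  \<open>distinct_angles\<close>.\<close>

lemma fst_angles:
  "\<alpha> \<in> set (angles t) \<Longrightarrow> fst \<alpha> \<in> set_ptree t"
  "\<alpha> \<in> set (angles_from r i ts) \<Longrightarrow> fst \<alpha> \<in> (\<Union>t\<in>set ts. set_ptree t) \<or> fst \<alpha> = r \<and> i < snd \<alpha>"
  by (induction t and r i ts rule: angles_angles_from.induct) auto

lemma root_angle [simp]: "(root t, 0) \<in> set (angles t)"
  by (cases t) auto

lemma distinct_angles:
  fixes t :: "'a ptree" and r :: 'a
  shows "distinct (vertices t) \<Longrightarrow> distinct (angles t)"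
  "r \<notin> (\<Union>t\<in>set ts. set_ptree t) \<Longrightarrow> distinct (concat (map vertices ts)) \<Longrightarrow>
     distinct (angles_from r i ts)"
proof (induction t and r i ts rule: angles_angles_from.induct)
  case (1 r ts)
  then show ?case
    by (auto dest: fst_angles(2))
next
  case (3 r i t ts)
  have "x \<notin> set (angles_from r (Suc i) ts)" if "x \<in> set (angles t)" for x
    using fst_angles(1)[OF that] 3(3,4) by (auto dest: fst_angles(2))
  moreover have "(r, Suc i) \<notin> set (angles t)"
    using 3(3) by (auto dest: fst_angles(1))
  moreover have "(r, Suc i) \<notin> set (angles_from r (Suc i) ts)"
    using 3(3) by (auto dest: fst_angles(2))
  ultimately show ?case
    using 3 by auto
qed simp

lemma graft_cong:
  "(\<And>\<alpha>. \<alpha> \<in> set (angles t) \<Longrightarrow> g \<alpha> = h \<alpha>) \<Longrightarrow> graft g t = graft h t"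
  "(\<And>\<alpha>. \<alpha> \<in> set (angles_from r i ts) \<Longrightarrow> g \<alpha> = h \<alpha>) \<Longrightarrow> graft_from g r i ts = graft_from h r i ts"
  by (induction t and r i ts rule: angles_angles_from.induct) auto

lemma root_graft [simp]: "root (graft g t) = root t"
  by (cases t) auto

text \<open>Grafting interleaves old and new vertices, so no simple equation of lists holds.
  Multisets still give both the vertex set and distinctness.\<close>

lemma mset_vertices_graft:
  "mset (vertices (graft g t)) =
     mset (vertices t) + mset (concat (map vertices (concat (map g (angles t)))))"
  "mset (concat (map vertices (graft_from g r i ts))) =
     mset (concat (map vertices ts)) + mset (concat (map vertices (concat (map g (angles_from r i ts)))))"
  by (induction t and r i ts rule: angles_angles_from.induct) auto

lemma set_graft:
  "set_ptree (graft g t) = set_ptree t \<union> (\<Union>u\<in>set (concat (map g (angles t))). set_ptree u)"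
  using arg_cong[OF mset_vertices_graft(1)[of g t], of set_mset] by auto

lemma distinct_graft:
  "distinct (vertices (graft g t)) \<longleftrightarrow>
     distinct (vertices t @ concat (map vertices (concat (map g (angles t)))))"
  by (intro mset_eq_imp_distinct_iff) (simp add: mset_vertices_graft)

lemma keep_graft_base:
  "\<lbrakk>\<And>\<alpha> u. \<alpha> \<in> set (angles t) \<Longrightarrow> u \<in> set (g \<alpha>) \<Longrightarrow> X \<inter> set_ptree u = {}; set_ptree t \<subseteq> X\<rbrakk> \<Longrightarrow>
     keep X (graft g t) = [t]"
  "\<lbrakk>\<And>\<alpha> u. \<alpha> \<in> set (angles_from r i ts) \<Longrightarrow> u \<in> set (g \<alpha>) \<Longrightarrow> X \<inter> set_ptree u = {};
    \<And>t. t \<in> set ts \<Longrightarrow> set_ptree t \<subseteq> X\<rbrakk> \<Longrightarrow>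
     keepf X (graft_from g r i ts) = ts"
proof (induction t and r i ts rule: angles_angles_from.induct)
  case (1 r ts)
  have "keepf X (g (r, 0)) = []"
    using 1(2)[of "(r, 0)"] by (auto simp: keepf_eq_Nil_iff)
  moreover have "keepf X (graft_from g r 0 ts) = ts"
    using 1(2,3) by (intro 1(1)) auto
  ultimately show ?case
    using 1(3) by (auto simp: keep_Node)
next
  case (3 r i t ts)
  have "keepf X (g (r, Suc i)) = []"
    using 3(3)[of "(r, Suc i)"] by (auto simp: keepf_eq_Nil_iff)
  moreover have "keep X (graft g t) = [t]"
    using 3(3,4) by (intro 3(1)) auto
  moreover have "keepf X (graft_from g r (Suc i) ts) = ts"
    using 3(3,4) by (intro 3(2)) auto
  ultimately show ?case
    by auto
qed simp

text \<open>The plugged trees come out in the order of \<open>angles t\<close>, because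
  \<open>graft\<close> meets the angles from left to right.\<close>

lemma keep_graft_new:
  "\<lbrakk>\<And>\<alpha> u. \<alpha> \<in> set (angles t) \<Longrightarrow> u \<in> set (g \<alpha>) \<Longrightarrow> set_ptree u \<subseteq> X; X \<inter> set_ptree t = {}\<rbrakk> \<Longrightarrow>
     keep X (graft g t) = concat (map g (angles t))"
  "\<lbrakk>\<And>\<alpha> u. \<alpha> \<in> set (angles_from r i ts) \<Longrightarrow> u \<in> set (g \<alpha>) \<Longrightarrow> set_ptree u \<subseteq> X;
    \<And>t. t \<in> set ts \<Longrightarrow> X \<inter> set_ptree t = {}\<rbrakk> \<Longrightarrow>
     keepf X (graft_from g r i ts) = concat (map g (angles_from r i ts))"
proof (induction t and r i ts rule: angles_angles_from.induct)
  case (1 r ts)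
  have "keepf X (g (r, 0)) = g (r, 0)"
    using 1(2)[of "(r, 0)"] by (auto intro!: keepf_all)
  moreover have "keepf X (graft_from g r 0 ts) = concat (map g (angles_from r 0 ts))"
    using 1(2,3) by (intro 1(1)) auto
  ultimately show ?case
    using 1(3) by (auto simp: keep_Node)
next
  case (3 r i t ts)
  have "keepf X (g (r, Suc i)) = g (r, Suc i)"
    using 3(3)[of "(r, Suc i)"] by (auto intro!: keepf_all)
  moreover have "keep X (graft g t) = concat (map g (angles t))"
    using 3(3,4) by (intro 3(1)) auto
  moreover have "keepf X (graft_from g r (Suc i) ts) = concat (map g (angles_from r (Suc i) ts))"
    using 3(3,4) by (intro 3(2)) auto
  ultimately show ?case
    by auto
qed simp

text \<open>Contracting \<open>t\<close> to its root: the plugged trees become the branches of the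
  root. If they are the children of \<open>v\<close>, the vertex \<open>v\<close> with its branches
  reappears, under the name \<open>root t\<close>.\<close>

lemma keep_graft_contract:
  assumes "\<And>\<alpha> u. \<alpha> \<in> set (angles t) \<Longrightarrow> u \<in> set (g \<alpha>) \<Longrightarrow> set_ptree u \<subseteq> X"
    and "\<And>\<alpha> u. \<alpha> \<in> set (angles t) \<Longrightarrow> u \<in> set (g \<alpha>) \<Longrightarrow> root t \<notin> set_ptree u"
    and "X \<inter> set_ptree t = {root t}" and "distinct (vertices t)"
  shows "keep X (graft g t) = [Node (root t) (concat (map g (angles t)))]"
proof (cases t)
  case (Node r ts)
  \<comment> \<open>Inside the branches nothing of \<open>t\<close> survives and \<open>r\<close>
    does not recur, so there \<open>X\<close> may be replaced by \<open>Y\<close>, to which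
    \<open>keep_graft_new\<close> applies.\<close>
  define Y where "Y = X - {r}"
  have "keepf Y (graft_from g r 0 ts) = concat (map g (angles_from r 0 ts))"
  proof (rule keep_graft_new(2))
    fix \<alpha> u assume "\<alpha> \<in> set (angles_from r 0 ts)" "u \<in> set (g \<alpha>)"
    then show "set_ptree u \<subseteq> Y"
      using assms(1,2)[of \<alpha> u] by (auto simp: Y_def Node)
  qed (use assms(3) in \<open>auto simp: Y_def Node\<close>)
  moreover have "keepf X (graft_from g r 0 ts) = keepf Y (graft_from g r 0 ts)"
  proof (intro keepf_cong_trees keep_cong)
    fix u assume "u \<in> set (graft_from g r 0 ts)"
    then have "set_ptree u \<subseteq> (\<Union>t\<in>set ts. set_ptree t) \<union> (\<Union>u\<in>set (concat (map g (angles_from r 0 ts))). set_ptree u)"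
      using arg_cong[OF mset_vertices_graft(2)[of g r 0 ts], of set_mset] by auto
    moreover have "r \<notin> (\<Union>t\<in>set ts. set_ptree t)"
      using assms(4) Node by simp
    moreover have "r \<notin> set_ptree u'" if "\<alpha> \<in> set (angles_from r 0 ts)" "u' \<in> set (g \<alpha>)" for \<alpha> u'
      using assms(2)[of \<alpha> u'] that by (simp add: Node)
    ultimately have "r \<notin> set_ptree u"
      by auto
    then show "X \<inter> set_ptree u = Y \<inter> set_ptree u"
      by (auto simp: Y_def)
  qed
  moreover have "keepf X (g (r, 0)) = g (r, 0)"
    using assms(1)[of "(r, 0)"] by (intro keepf_all) (auto simp: Node)
  moreover have "r \<in> X"
    using assms(3) Node by auto
  ultimately show ?thesis
    by (simp add: Node keep_Node)
qed

text \<open>Below a vertex of a plugged tree there are only vertices of that plugged tree, hence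
  none of \<open>V\<close>. This yields the condition on ancestors in
  \<open>is_subst\<close>.\<close>

lemma anc_graft_closed:
  "\<lbrakk>\<And>\<alpha> u. \<alpha> \<in> set (angles t) \<Longrightarrow> u \<in> set (g \<alpha>) \<Longrightarrow> V \<inter> set_ptree u = {}; set_ptree t \<subseteq> V;
    (a, b) \<in> anc (graft g t); b \<in> V\<rbrakk> \<Longrightarrow> a \<in> V"
  "\<lbrakk>\<And>\<alpha> u. \<alpha> \<in> set (angles_from r i ts) \<Longrightarrow> u \<in> set (g \<alpha>) \<Longrightarrow> V \<inter> set_ptree u = {};
    \<And>t. t \<in> set ts \<Longrightarrow> set_ptree t \<subseteq> V; (a, b) \<in> (\<Union>t\<in>set (graft_from g r i ts). anc t); b \<in> V\<rbrakk> \<Longrightarrow> a \<in> V"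
proof (induction t and r i ts rule: angles_angles_from.induct)
  case (1 r ts)
  have "(a, b) \<notin> anc u" if "u \<in> set (g (r, 0))" for u
    using 1(2)[of "(r, 0)" u] that 1(5) by (auto dest: ancD)
  moreover have "a \<in> V" if "(a, b) \<in> (\<Union>t\<in>set (graft_from g r 0 ts). anc t)"
    using 1(2,3,5) that by (intro 1(1)) auto
  ultimately show ?case
    using 1(3,4) by auto
next
  case (3 r i t ts)
  have "(a, b) \<notin> anc u" if "u \<in> set (g (r, Suc i))" for u
    using 3(3)[of "(r, Suc i)" u] that 3(6) by (auto dest: ancD)
  moreover have "a \<in> V" if "(a, b) \<in> anc (graft g t)"
    using 3(3,4,6) that by (intro 3(1)) auto
  moreover have "a \<in> V" if "(a, b) \<in> (\<Union>t\<in>set (graft_from g r (Suc i) ts). anc t)"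
    using 3(3,4,6) that by (intro 3(2)) auto
  ultimately show ?case
    using 3(5) by auto
qed simp

lemma graft_Nil:
  "(\<And>\<alpha>. \<alpha> \<in> set (angles t) \<Longrightarrow> g \<alpha> = []) \<Longrightarrow> graft g t = t"
  "(\<And>\<alpha>. \<alpha> \<in> set (angles_from r i ts) \<Longrightarrow> g \<alpha> = []) \<Longrightarrow> graft_from g r i ts = ts"
  by (induction t and r i ts rule: angles_angles_from.induct) auto

text \<open>If nothing is plugged away from the root, the branches of \<open>t\<close> stay intact,
  and below a non-root vertex of \<open>t\<close> there is only \<open>t\<close>. This is the shape
  of the minimal energy.\<close>

lemma anc_graft_root_angles:
  assumes "\<And>\<alpha>. \<alpha> \<in> set (angles t) \<Longrightarrow> fst \<alpha> \<noteq> root t \<Longrightarrow> g \<alpha> = []"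
    and "\<And>u. u \<in> set (concat (map g (angles t))) \<Longrightarrow> set_ptree u \<inter> set_ptree t = {}"
    and "(a, b) \<in> anc (graft g t)" "a \<in> set_ptree t" "a \<noteq> root t" "distinct (vertices t)"
  shows "b \<in> set_ptree t"
proof (cases t)
  case (Node r ts)
  have "set (graft_from g r i us) \<subseteq> set us \<union> set (concat (map g (angles_from r i us)))"
    if "set us \<subseteq> set ts" "\<And>\<alpha>. \<alpha> \<in> set (angles_from r i us) \<Longrightarrow> fst \<alpha> \<noteq> r \<Longrightarrow> g \<alpha> = []" for i us
    using that
  proof (induction us arbitrary: i)
    case (Cons u us)
    have "g \<alpha> = []" if "\<alpha> \<in> set (angles u)" for \<alpha>
    proof (rule Cons.prems(2))
      show "fst \<alpha> \<noteq> r"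
        using Cons.prems(1) fst_angles(1)[OF that] assms(6) Node by auto
    qed (use that in auto)
    then have "graft g u = u"
      by (rule graft_Nil)
    then show ?case
      using Cons.IH[of "Suc i"] Cons.prems by auto
  qed simp
  from this[of ts 0] have *: "set (graft_from g r 0 ts) \<subseteq> set ts \<union> set (concat (map g (angles t)))"
    using assms(1) by (auto simp: Node)
  obtain u where u: "u \<in> set (branches (graft g t))" "(a, b) \<in> anc u"
    using assms(3,5) by (auto simp: Node)
  then have "u \<in> set ts \<or> u \<in> set (concat (map g (angles t)))"
    using * by (auto simp: Node)
  then show ?thesis
  proof
    assume "u \<in> set ts"
    then show ?thesis
      using u(2) by (auto simp: Node dest: ancD)
  next
    assume "u \<in> set (concat (map g (angles t)))"
    then show ?thesis
      using assms(2)[of u] assms(4) u(2) by (auto dest: ancD)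
  qed
qed

text \<open>The first element with property \<open>P\<close> marks the cut in both lists.\<close>

lemma append_Cons_eq_iff_first:
  assumes "\<And>x. x \<in> set xs \<Longrightarrow> \<not> P x" "\<And>x. x \<in> set xs' \<Longrightarrow> \<not> P x" "P y" "P y'"
  shows "xs @ y # ys = xs' @ y' # ys' \<longleftrightarrow> xs = xs' \<and> y = y' \<and> ys = ys'"
proof
  assume eq: "xs @ y # ys = xs' @ y' # ys'"
  have "takeWhile (\<lambda>x. \<not> P x) (xs @ y # ys) = xs" "takeWhile (\<lambda>x. \<not> P x) (xs' @ y' # ys') = xs'"
    using assms by (auto simp: takeWhile_append)
  then show "xs = xs' \<and> y = y' \<and> ys = ys'"
    using eq by auto
qed auto

text \<open>Plugged trees have their roots outside \<open>V\<close>, branches inherited from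
  \<open>t\<close> have theirs in \<open>V\<close>. Cutting a list of branches at its first root in
  \<open>V\<close> gives the list at the current angle; part (2) carries that list in front so that
  the rest after a cut is an equation of the same form for the next angle.\<close>

lemma graft_inject:
  "\<lbrakk>graft g t = graft h t; set_ptree t \<subseteq> V;
    \<And>\<alpha> u. \<alpha> \<in> set (angles t) \<Longrightarrow> u \<in> set (g \<alpha>) \<union> set (h \<alpha>) \<Longrightarrow> root u \<notin> V; \<alpha> \<in> set (angles t)\<rbrakk> \<Longrightarrow>
     g \<alpha> = h \<alpha>"
  "\<lbrakk>g (r, i) @ graft_from g r i ts = h (r, i) @ graft_from h r i ts;
    \<And>t. t \<in> set ts \<Longrightarrow> set_ptree t \<subseteq> V;
    \<And>\<alpha> u. \<alpha> \<in> set ((r, i) # angles_from r i ts) \<Longrightarrow> u \<in> set (g \<alpha>) \<union> set (h \<alpha>) \<Longrightarrow> root u \<notin> V;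
    \<alpha> \<in> set ((r, i) # angles_from r i ts)\<rbrakk> \<Longrightarrow> g \<alpha> = h \<alpha>"
proof (induction t and r i ts rule: angles_angles_from.induct)
  case (1 r ts)
  show ?case
    using 1(2-) by (intro 1(1)) auto
next
  case (3 r i t ts)
  have rt: "root t \<in> V"
    using 3(4)[of t] by auto
  have "g (r, i) @ graft g t # g (r, Suc i) @ graft_from g r (Suc i) ts =
        h (r, i) @ graft h t # h (r, Suc i) @ graft_from h r (Suc i) ts"
    using 3(3) by simp
  then have eqs: "g (r, i) = h (r, i)" "graft g t = graft h t"
    "g (r, Suc i) @ graft_from g r (Suc i) ts = h (r, Suc i) @ graft_from h r (Suc i) ts"
    using append_Cons_eq_iff_first[of "g (r, i)" "\<lambda>u. root u \<in> V" "h (r, i)" "graft g t" "graft h t"]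
      3(5)[of "(r, i)"] rt by auto
  have 1: "\<alpha> \<in> set (angles t) \<Longrightarrow> g \<alpha> = h \<alpha>"
  proof (rule 3(1)[OF eqs(2)])
    fix \<alpha> u assume "\<alpha> \<in> set (angles t)" "u \<in> set (g \<alpha>) \<union> set (h \<alpha>)"
    then show "root u \<notin> V"
      using 3(5)[of \<alpha> u] by simp
  qed (use 3(4) in auto)
  have 2: "\<alpha> \<in> set ((r, Suc i) # angles_from r (Suc i) ts) \<Longrightarrow> g \<alpha> = h \<alpha>"
  proof (rule 3(2)[OF eqs(3)])
    fix \<alpha> u assume "\<alpha> \<in> set ((r, Suc i) # angles_from r (Suc i) ts)" "u \<in> set (g \<alpha>) \<union> set (h \<alpha>)"
    then show "root u \<notin> V"
      using 3(5)[of \<alpha> u] by auto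
  qed (use 3(4) in auto)
  show ?case
    using 3(6) eqs(1) 1 2 by auto
qed auto

text \<open>Since \<open>V\<close> is closed under ancestors, a branch of \<open>R\<close> has its
  root in \<open>V\<close> or misses \<open>V\<close>. A branch missing \<open>V\<close> is plugged
  into the current angle; a branch with root in \<open>V\<close> contains a branch of
  \<open>T\<close>, is handled by recursion, and moves on to the next angle.\<close>

lemma graft_exists:
  "\<lbrakk>keep V R = [T]; distinct (vertices R); root R \<in> V;
    \<And>a b. (a, b) \<in> anc R \<Longrightarrow> b \<in> V \<Longrightarrow> a \<in> V\<rbrakk> \<Longrightarrow>
    \<exists>g. R = graft g T \<and> (\<forall>\<alpha>. \<forall>u\<in>set (g \<alpha>). V \<inter> set_ptree u = {})"
proof (induction R arbitrary: T)
  case (Node r rs)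
  have "\<exists>g. qs = g (r, i) @ graft_from g r i ts \<and> (\<forall>\<alpha>. \<forall>u\<in>set (g \<alpha>). V \<inter> set_ptree u = {})"
    if "keepf V qs = ts" "set qs \<subseteq> set rs" "distinct (concat (map vertices qs))" for qs ts i
    using that
  proof (induction qs arbitrary: ts i)
    case Nil
    then show ?case
      by (auto intro!: exI[of _ "\<lambda>_. []"])
  next
    case (Cons q qs)
    have closed: "a \<in> V" if "(a, b) \<in> anc q" "b \<in> V" for a b
      using that Node.prems(4)[of a b] Cons.prems(2) by auto
    show ?case
    proof (cases "root q \<in> V")
      case True
      then obtain t where t: "keep V q = [t]"
        by (cases q) (auto simp: keep_Node)
      then obtain ts' where ts: "ts = t # ts'" "keepf V qs = ts'"
        using Cons.prems by auto
      obtain g1 where g1: "q = graft g1 t" "\<forall>\<alpha>. \<forall>u\<in>set (g1 \<alpha>). V \<inter> set_ptree u = {}"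
        using Node.IH[of q t] Cons.prems t True closed by auto
      obtain g2 where g2: "qs = g2 (r, Suc i) @ graft_from g2 r (Suc i) ts'"
        "\<forall>\<alpha>. \<forall>u\<in>set (g2 \<alpha>). V \<inter> set_ptree u = {}"
        using Cons.IH[OF ts(2), of "Suc i"] Cons.prems by auto
      \<comment> \<open>\<open>g1\<close> is meaningful only on the angles of \<open>t\<close> and
        \<open>g2\<close> only from \<open>(r, Suc i)\<close> on, so the two are merged according to
        the vertex. The angle \<open>(r, i)\<close> stays empty because \<open>q\<close> already is
        a branch of \<open>T\<close>.\<close>
      define g where "g \<alpha> = (if fst \<alpha> \<in> set_ptree t then g1 \<alpha> else if \<alpha> = (r, i) then [] else g2 \<alpha>)" for \<alpha>
      have r: "r \<notin> (\<Union>q\<in>set rs. set_ptree q)"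
        using Node.prems(2) by simp
      have st: "set_ptree t = V \<inter> set_ptree q"
        using t by (rule set_keep_single)
      have sts: "(\<Union>t\<in>set ts'. set_ptree t) = V \<inter> (\<Union>q\<in>set qs. set_ptree q)"
        using set_keepf[of V qs] ts(2) by simp
      have "graft g t = graft g1 t"
        by (intro graft_cong) (auto simp: g_def dest: fst_angles)
      moreover have "graft_from g r (Suc i) ts' = graft_from g2 r (Suc i) ts'"
      proof (rule graft_cong)
        fix \<alpha> assume "\<alpha> \<in> set (angles_from r (Suc i) ts')"
        then have "fst \<alpha> \<in> (\<Union>t\<in>set ts'. set_ptree t) \<or> fst \<alpha> = r \<and> Suc i < snd \<alpha>"
          by (rule fst_angles)
        then show "g \<alpha> = g2 \<alpha>"
          using r Cons.prems(2,3) unfolding sts by (cases \<alpha>) (auto simp: g_def st)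
      qed
      moreover have "g (r, i) = []" "g (r, Suc i) = g2 (r, Suc i)"
        using r Cons.prems(2) by (auto simp: g_def st)
      ultimately have "q # qs = g (r, i) @ graft_from g r i ts"
        using g1(1) g2(1) by (simp add: ts)
      moreover have "\<forall>\<alpha>. \<forall>u\<in>set (g \<alpha>). V \<inter> set_ptree u = {}"
        using g1(2) g2(2) by (auto simp: g_def)
      ultimately show ?thesis
        by blast
    next
      case False
      have disj: "V \<inter> set_ptree q = {}"
        using anc_root[of _ q] closed[of "root q"] False by auto
      then have "keepf V qs = ts"
        using Cons.prems(1) keep_eq_Nil_iff[of V q] by auto
      then obtain g where g: "qs = g (r, i) @ graft_from g r i ts"
        "\<forall>\<alpha>. \<forall>u\<in>set (g \<alpha>). V \<inter> set_ptree u = {}"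
        using Cons.IH[of ts i] Cons.prems by auto
      \<comment> \<open>\<open>q\<close> is leftmost, so it goes to the front of the list at the
        current angle.\<close>
      define g' where "g' = g((r, i) := q # g (r, i))"
      have "(r, i) \<notin> set (angles_from r i ts)"
      proof
        assume "(r, i) \<in> set (angles_from r i ts)"
        then have "r \<in> (\<Union>t\<in>set ts. set_ptree t)"
          using fst_angles(2)[of "(r, i)" r i ts] by auto
        then show False
          using set_keepf[of V qs] \<open>keepf V qs = ts\<close> Node.prems(2) Cons.prems(2) by auto
      qed
      then have "graft_from g' r i ts = graft_from g r i ts"
        by (intro graft_cong) (auto simp: g'_def)
      then have "q # qs = g' (r, i) @ graft_from g' r i ts"
        using g(1) by (simp add: g'_def)
      moreover have "\<forall>\<alpha>. \<forall>u\<in>set (g' \<alpha>). V \<inter> set_ptree u = {}"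
        using g(2) disj by (auto simp: g'_def)
      ultimately show ?thesis
        by blast
    qed
  qed
  from this[of rs "keepf V rs" 0] obtain g where g: "rs = g (r, 0) @ graft_from g r 0 (keepf V rs)"
      "\<forall>\<alpha>. \<forall>u\<in>set (g \<alpha>). V \<inter> set_ptree u = {}"
    using Node.prems(2) by auto
  have "T = Node r (keepf V rs)"
    using Node.prems(1,3) by (simp add: keep_Node)
  then show ?case
    using g by (intro exI[of _ g]) auto
qed


section \<open>Intrinsic description of substitutions\<close>

lemma sorted_concat_filter:
  assumes "sorted xs"
    and "\<And>p q i j. \<lbrakk>p < q; q < length L; i \<in> set xs; j \<in> set xs; f i = L ! p; f j = L ! q\<rbrakk> \<Longrightarrow> i \<le> j"
  shows "sorted (concat (map (\<lambda>\<alpha>. filter (\<lambda>i. f i = \<alpha>) xs) L))"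
  using assms(2)
proof (induction L)
  case (Cons \<alpha> L)
  have "sorted (concat (map (\<lambda>\<alpha>. filter (\<lambda>i. f i = \<alpha>) xs) L))"
    using Cons.prems[of "Suc _" "Suc _"] by (intro Cons.IH) auto
  moreover have "i \<le> j" if ij: "i \<in> set xs" "f i = \<alpha>" "j \<in> set xs" "f j \<in> set L" for i j
  proof -
    obtain q where "q < length L" "f j = L ! q"
      using ij(4) by (metis in_set_conv_nth)
    then show ?thesis
      using Cons.prems[of 0 "Suc q" i j] ij by auto
  qed
  ultimately show ?case
    using assms(1) by (auto simp: sorted_append sorted_wrt_filter)
qed simp

text \<open>Grouping the edge indices by angle does not move them: the grouped list is sorted
  because \<open>f\<close> is increasing, has no repetitions because an index has one angle, and
  contains all indices. The last assumption is \<open>angle_le\<close> written out for the list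
  \<open>L\<close>.\<close>

lemma concat_fiber:
  assumes "distinct L" and "\<And>i. i < length us \<Longrightarrow> f i \<in> set L"
    and "\<And>i j. i \<le> j \<Longrightarrow> j < length us \<Longrightarrow>
           \<exists>p q. p \<le> q \<and> q < length L \<and> L ! p = f i \<and> L ! q = f j"
  shows "concat (map (fiber us f) L) = us"
proof -
  let ?ks = "concat (map (\<lambda>\<alpha>. filter (\<lambda>i. f i = \<alpha>) [0..<length us]) L)"
  have "sorted ?ks"
  proof (rule sorted_concat_filter)
    fix p q i j
    assume *: "p < q" "q < length L" "i \<in> set [0..<length us]" "j \<in> set [0..<length us]"
      "f i = L ! p" "f j = L ! q"
    show "i \<le> j"
    proof (rule ccontr)
      assume "\<not> i \<le> j"
      then obtain p' q' where "p' \<le> q'" "q' < length L" "L ! p' = f j" "L ! q' = f i"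
        using assms(3)[of j i] * by auto
      then have "p' = q" "q' = p"
        using * assms(1) by (auto simp: nth_eq_iff_index_eq)
      then show False
        using * \<open>p' \<le> q'\<close> by simp
    qed
  qed simp
  moreover have "distinct ?ks"
    using assms(1) by (induction L) auto
  moreover have "set ?ks = set [0..<length us]"
    using assms(2) by auto
  ultimately have ks: "?ks = [0..<length us]"
    by (intro sorted_distinct_set_unique) auto
  have "concat (map (fiber us f) L) = map ((!) us) ?ks"
    by (simp add: map_concat fiber_def[abs_def] o_def)
  also have "\<dots> = us"
    unfolding ks by (rule map_nth)
  finally show ?thesis .
qed

lemma fiber_nth_eq_zip:
  assumes "length fl = length us"
  shows "fiber us (\<lambda>i. fl ! i) \<alpha> = map snd (filter (\<lambda>p. fst p = \<alpha>) (zip fl us))"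
proof -
  have "zip fl us = map (\<lambda>i. (fl ! i, us ! i)) [0..<length us]"
    using assms by (intro nth_equalityI) auto
  then show ?thesis
    by (simp add: fiber_def filter_map o_def)
qed

lemma filter_zip_replicate:
  "filter (\<lambda>p. fst p = \<alpha>) (zip (replicate (length us) \<beta>) us) = (if \<alpha> = \<beta> then zip (replicate (length us) \<beta>) us else [])"
  by (induction us) auto

lemma filter_zip_concat_replicate:
  "distinct L \<Longrightarrow> map snd (filter (\<lambda>p. fst p = \<alpha>)
      (zip (concat (map (\<lambda>\<beta>. replicate (length (g \<beta>)) \<beta>) L)) (concat (map g L)))) =
    (if \<alpha> \<in> set L then g \<alpha> else [])"
  by (induction L) (auto simp: filter_zip_replicate)

lemma sorted_concat_replicate: "sorted (concat (map (\<lambda>p. replicate (m p) p) [0..<n]))"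
  for n :: nat
  by (induction n) (auto simp: sorted_append)

text \<open>The converse of \<open>concat_fiber\<close>: cutting the edges into consecutive blocks
  along the angles comes from an increasing map.\<close>

lemma exists_increasing_fiber:
  assumes "distinct L" and "concat (map g L) = us"
  obtains f where "\<And>\<alpha>. \<alpha> \<in> set L \<Longrightarrow> fiber us f \<alpha> = g \<alpha>"
    "\<And>i. i < length us \<Longrightarrow> f i \<in> set L"
    "\<And>i j. i \<le> j \<Longrightarrow> j < length us \<Longrightarrow>
           \<exists>p q. p \<le> q \<and> q < length L \<and> L ! p = f i \<and> L ! q = f j"
proof -
  \<comment> \<open>Each angle is repeated once for every tree plugged there, so entry i is the
    angle of edge i. \<open>ks\<close> holds the positions of these angles in \<open>L\<close>; that
    it is sorted gives monotonicity.\<close>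
  define fl where "fl = concat (map (\<lambda>\<beta>. replicate (length (g \<beta>)) \<beta>) L)"
  define ks where "ks = concat (map (\<lambda>p. replicate (length (g (L ! p))) p) [0..<length L])"
  have "map (\<lambda>\<beta>. replicate (length (g \<beta>)) \<beta>) L =
        map (\<lambda>p. replicate (length (g (L ! p))) (L ! p)) [0..<length L]"
    by (intro nth_equalityI) auto
  then have fl: "fl = map ((!) L) ks"
    by (simp add: fl_def ks_def map_concat o_def)
  have "length fl = length (concat (map g L))"
    unfolding fl_def by (induction L) auto
  then have len: "length fl = length us" "length ks = length us"
    using assms(2) fl by simp_all
  have ks: "sorted ks" "set ks \<subseteq> {..<length L}"
    unfolding ks_def by (rule sorted_concat_replicate) auto
  have "fiber us (\<lambda>i. fl ! i) \<alpha> = g \<alpha>" if "\<alpha> \<in> set L" for \<alpha>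
    using that filter_zip_concat_replicate[OF assms(1), of \<alpha> g] len(1)
    by (simp add: fiber_nth_eq_zip assms(2) flip: fl_def)
  moreover have "\<exists>p q. p \<le> q \<and> q < length L \<and> L ! p = fl ! i \<and> L ! q = fl ! j"
    if "i \<le> j" "j < length us" for i j
  proof (intro exI conjI)
    show "ks ! i \<le> ks ! j"
      using ks(1) that len by (intro sorted_nth_mono) auto
    show "ks ! j < length L"
      using ks(2) nth_mem[of j ks] that len by (metis lessThan_iff subsetD)
  qed (use that len in \<open>auto simp: fl\<close>)
  moreover from this have "fl ! i \<in> set L" if "i < length us" for i
    using that by (metis nth_mem order_refl order.strict_trans1)
  ultimately show thesis
    using that by blast
qed

lemma fiber_inject:
  assumes "distinct us" and "\<And>\<alpha>. \<alpha> \<in> D \<Longrightarrow> fiber us f \<alpha> = fiber us f' \<alpha>"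
    and "f i \<in> D" and "i < length us"
  shows "f i = f' i"
proof -
  have "us ! i \<in> set (fiber us f (f i))"
    using assms(4) by (auto simp: fiber_def)
  then have "us ! i \<in> set (fiber us f' (f i))"
    using assms(2,3) by simp
  then obtain j where "j < length us" "f' j = f i" "us ! j = us ! i"
    by (auto simp: fiber_def)
  moreover from this have "j = i"
    using assms(1,4) by (simp add: nth_eq_iff_index_eq)
  ultimately show ?thesis
    by simp
qed

text \<open>The last condition does not follow from the two deletions: if S is v with child a and T
  is r with child b, the path r, a, b passes both of them, but is no substitution. The vertex
  \<open>v\<close> is renamed to \<open>root T\<close> because it need not occur in
  \<open>R\<close>.\<close>

definition is_subst :: "'a \<Rightarrow> 'a ptree \<Rightarrow> 'a ptree \<Rightarrow> 'a ptree \<Rightarrow> bool" where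
  "is_subst v S T R \<longleftrightarrow>
     distinct (vertices R) \<and> set_ptree R = subst_set (set_ptree S) v (set_ptree T) \<and>
     keep (insert (root T) (set_ptree S - {v})) R = [map_ptree (id(v := root T)) S] \<and>
     keep (set_ptree T) R = [T] \<and>
     (\<forall>a b. (a, b) \<in> anc R \<longrightarrow> b \<in> set_ptree T \<longrightarrow> a \<notin> set_ptree T \<longrightarrow> (a, root T) \<in> anc R)"

lemma map_ptree_upd_notin: "v \<notin> set_ptree t \<Longrightarrow> map_ptree (id(v := r)) t = t"
  by (subst (2) ptree.map_id0[symmetric, THEN fun_cong, unfolded id_apply])
    (auto intro!: ptree.map_cong)

lemma is_subst_graft:
  assumes "distinct (vertices (Node v us))" "distinct (vertices T)"
    and disj: "(\<Union>u\<in>set us. set_ptree u) \<inter> set_ptree T = {}"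
    and us: "concat (map g (angles T)) = us"
  shows "is_subst v (Node v us) T (graft g T)"
  unfolding is_subst_def
proof (intro conjI allI impI)
  let ?U = "\<Union>u\<in>set us. set_ptree u"
  have v: "v \<notin> ?U"
    using assms(1) by simp
  have g: "u \<in> set us" if "\<alpha> \<in> set (angles T)" "u \<in> set (g \<alpha>)" for \<alpha> u
    using that us by auto
  show "distinct (vertices (graft g T))"
    using assms by (auto simp: distinct_graft)
  show "set_ptree (graft g T) = subst_set (set_ptree (Node v us)) v (set_ptree T)"
    using v us by (auto simp: set_graft subst_set_def)
  have "map_ptree (id(v := root T)) (Node v us) = Node (root T) us"
    using v by (auto intro!: map_idI map_ptree_upd_notin)
  moreover have "insert (root T) (set_ptree (Node v us) - {v}) = insert (root T) ?U"
    using v by auto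
  moreover have "keep (insert (root T) ?U) (graft g T) = [Node (root T) (concat (map g (angles T)))]"
  proof (rule keep_graft_contract)
    show "insert (root T) ?U \<inter> set_ptree T = {root T}"
      using disj by auto
    fix \<alpha> u assume *: "\<alpha> \<in> set (angles T)" "u \<in> set (g \<alpha>)"
    show "set_ptree u \<subseteq> insert (root T) ?U"
      using g[OF *] by auto
    show "root T \<notin> set_ptree u"
      using g[OF *] disj root_in_set_ptree[of T] by blast
  qed fact
  ultimately show "keep (insert (root T) (set_ptree (Node v us) - {v})) (graft g T) =
      [map_ptree (id(v := root T)) (Node v us)]"
    by (simp add: us)
  have disj': "set_ptree T \<inter> set_ptree u = {}" if "\<alpha> \<in> set (angles T)" "u \<in> set (g \<alpha>)" for \<alpha> u
    using g[OF that] disj by blast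
  then show "keep (set_ptree T) (graft g T) = [T]"
    by (intro keep_graft_base) auto
  fix a b assume "(a, b) \<in> anc (graft g T)" "b \<in> set_ptree T" "a \<notin> set_ptree T"
  then show "(a, root T) \<in> anc (graft g T)"
    using anc_graft_closed(1)[of T g "set_ptree T" a b] disj' by blast
qed

text \<open>If \<open>v\<close> is the root of S, the vertices of \<open>T\<close> form an upper
  part of \<open>R\<close>, so \<open>graft_exists\<close> applies; contracting \<open>T\<close>
  then tells which trees were plugged in.\<close>

lemma is_subst_imp_graft:
  assumes "is_subst v (Node v us) T R" and "distinct (vertices (Node v us))" "distinct (vertices T)"
    and disj: "(\<Union>u\<in>set us. set_ptree u) \<inter> set_ptree T = {}"
  obtains g where "R = graft g T" "concat (map g (angles T)) = us"
proof -
  let ?U = "\<Union>u\<in>set us. set_ptree u"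
  have v: "v \<notin> ?U"
    using assms(2) by simp
  have "map_ptree (id(v := root T)) (Node v us) = Node (root T) us"
    using v by (auto intro!: map_idI map_ptree_upd_notin)
  moreover have "insert (root T) (set_ptree (Node v us) - {v}) = insert (root T) ?U"
    using v by auto
  ultimately have R: "distinct (vertices R)" "set_ptree R = ?U \<union> set_ptree T"
    "keep (insert (root T) ?U) R = [Node (root T) us]" "keep (set_ptree T) R = [T]"
    "\<And>a b. \<lbrakk>(a, b) \<in> anc R; b \<in> set_ptree T; a \<notin> set_ptree T\<rbrakk> \<Longrightarrow> (a, root T) \<in> anc R"
    using assms(1) v by (auto simp: is_subst_def subst_set_def)
  \<comment> \<open>A root outside \<open>T\<close> would survive the contraction of
    \<open>T\<close> and be its root, which is \<open>root T\<close>.\<close>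
  have rT: "root R \<in> set_ptree T"
  proof (rule ccontr)
    assume "root R \<notin> set_ptree T"
    moreover from this have "root R \<in> ?U"
      using root_in_set_ptree[of R] R(2) by blast
    ultimately have "root R = root T"
      using R(3) by (cases R) (auto simp: keep_Node)
    then show False
      using \<open>root R \<notin> set_ptree T\<close> by simp
  qed
  then have root: "root R = root T"
    using root_keep_single[OF R(4)] by simp
  \<comment> \<open>Such a vertex outside \<open>T\<close> would be above \<open>root T\<close>,
    which is the root of \<open>R\<close>.\<close>
  have "a \<in> set_ptree T" if "(a, b) \<in> anc R" "b \<in> set_ptree T" for a b
  proof (rule ccontr)
    assume "a \<notin> set_ptree T"
    moreover from this have "(root R, a) \<in> anc R"
      using rT ancD[OF that(1)] by (intro anc_root) auto
    ultimately show False
      using R(5)[OF that] anc_trans[OF R(1)] anc_irrefl[OF R(1)] root by metis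
  qed
  then obtain g where g: "R = graft g T" "\<forall>\<alpha>. \<forall>u\<in>set (g \<alpha>). set_ptree T \<inter> set_ptree u = {}"
    using graft_exists[OF R(4,1) rT] by blast
  have sub: "set_ptree u \<subseteq> ?U" if "\<alpha> \<in> set (angles T)" "u \<in> set (g \<alpha>)" for \<alpha> u
  proof -
    have "set_ptree u \<subseteq> set_ptree R"
      using that by (auto simp: g(1) set_graft)
    then show ?thesis
      using g(2) that R(2) by blast
  qed
  have "keep (insert (root T) ?U) (graft g T) = [Node (root T) (concat (map g (angles T)))]"
  proof (rule keep_graft_contract)
    show "insert (root T) ?U \<inter> set_ptree T = {root T}"
      using disj by auto
    fix \<alpha> u assume *: "\<alpha> \<in> set (angles T)" "u \<in> set (g \<alpha>)"
    show "set_ptree u \<subseteq> insert (root T) ?U"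
      using sub[OF *] by auto
    show "root T \<notin> set_ptree u"
      using sub[OF *] disj root_in_set_ptree[of T] by blast
  qed fact
  then have "concat (map g (angles T)) = us"
    using R(3) g(1) by simp
  then show thesis
    using that g(1) by blast
qed

section \<open>Reduction to a substitution at the root\<close>

lemma concat_eq_singleton:
  assumes "concat (map f xs) = [y]"
  obtains us x ws where "xs = us @ x # ws" "f x = [y]" "\<And>u. u \<in> set us \<union> set ws \<Longrightarrow> f u = []"
  using assms
proof (induction xs arbitrary: thesis)
  case (Cons x xs)
  show ?case
  proof (cases "f x")
    case Nil
    then obtain us x' ws where "xs = us @ x' # ws" "f x' = [y]" "\<And>u. u \<in> set us \<union> set ws \<Longrightarrow> f u = []"
      using Cons by auto
    then show ?thesis
      using Cons.prems(1)[of "x # us" x' ws] Nil by auto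
  next
    case (Cons z zs)
    then show ?thesis
      using Cons.prems(1)[of "[]" x xs] Cons.prems(2) by auto
  qed
qed simp

text \<open>A vertex x above \<open>v\<close> stays the root of \<open>R\<close>, and exactly one
  branch of \<open>R\<close> contains \<open>T\<close>. Contracting \<open>T\<close> identifies the
  other branches with the siblings of \<open>u\<close>.\<close>

lemma is_subst_Node_iff:
  assumes "distinct (vertices (Node x (us @ u # ws)))" and "distinct (vertices T)"
    and "composable (set_ptree (Node x (us @ u # ws))) v (set_ptree T)" and "v \<in> set_ptree u"
  shows "is_subst v (Node x (us @ u # ws)) T R \<longleftrightarrow> (\<exists>u'. is_subst v u T u' \<and> R = Node x (us @ u' # ws))"
proof -
  let ?S = "Node x (us @ u # ws)"
  let ?r = "root T"
  let ?X = "insert ?r (set_ptree ?S - {v})"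
  define U where "U = (\<Union>u\<in>set us. set_ptree u)"
  define W where "W = (\<Union>u\<in>set ws. set_ptree u)"
  have x: "x \<notin> set_ptree u" "x \<notin> U" "x \<notin> W"
    and dist: "distinct (vertices u)" "distinct (concat (map vertices us))" "distinct (concat (map vertices ws))"
    and disj: "U \<inter> W = {}" "set_ptree u \<inter> U = {}" "set_ptree u \<inter> W = {}"
    using assms(1) by (auto simp: U_def W_def)
  have v: "v \<noteq> x" "v \<notin> U" "v \<notin> W"
    using assms(4) x(1) disj by auto
  have disjT: "x \<notin> set_ptree T" "U \<inter> set_ptree T = {}" "W \<inter> set_ptree T = {}"
    "(set_ptree u - {v}) \<inter> set_ptree T = {}"
    using assms(3) v by (auto simp: composable_def U_def W_def)
  have map: "map_ptree (id(v := ?r)) ?S = Node x (us @ map_ptree (id(v := ?r)) u # ws)"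
    using v by (auto simp: U_def W_def intro!: map_idI map_ptree_upd_notin)
  have S: "set_ptree ?S = insert x (U \<union> set_ptree u \<union> W)"
    by (auto simp: U_def W_def)
  show ?thesis
  proof
    assume "\<exists>u'. is_subst v u T u' \<and> R = Node x (us @ u' # ws)"
    then obtain u' where R: "R = Node x (us @ u' # ws)" and u': "distinct (vertices u')"
      "set_ptree u' = (set_ptree u - {v}) \<union> set_ptree T"
      "keep (insert ?r (set_ptree u - {v})) u' = [map_ptree (id(v := ?r)) u]"
      "keep (set_ptree T) u' = [T]"
      "\<And>a b. \<lbrakk>(a, b) \<in> anc u'; b \<in> set_ptree T; a \<notin> set_ptree T\<rbrakk> \<Longrightarrow> (a, ?r) \<in> anc u'"
      by (auto simp: is_subst_def subst_set_def)
    show "is_subst v ?S T R"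
      unfolding is_subst_def
    proof (intro conjI allI impI)
      show "distinct (vertices R)"
        using u'(1) dist x disj disjT unfolding R by (auto simp: u'(2) U_def W_def)
      show "set_ptree R = subst_set (set_ptree ?S) v (set_ptree T)"
        unfolding subst_set_def R using v u'(2) by (auto simp: U_def W_def)
      have "keep ?X u' = keep (insert ?r (set_ptree u - {v})) u'"
        using disjT disj x unfolding S by (intro keep_cong) (auto simp: u'(2))
      moreover have "keepf ?X us = us" "keepf ?X ws = ws"
        using v by (auto intro!: keepf_all simp: U_def W_def)
      ultimately show "keep ?X R = [map_ptree (id(v := ?r)) ?S]"
        using v(1) unfolding map by (simp add: R keep_Node u'(3))
      have "keepf (set_ptree T) us = []" "keepf (set_ptree T) ws = []"
        using disjT by (auto simp: keepf_eq_Nil_iff U_def W_def)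
      then show "keep (set_ptree T) R = [T]"
        using disjT by (simp add: R keep_Node u'(4))
      fix a b assume ab: "(a, b) \<in> anc R" "b \<in> set_ptree T" "a \<notin> set_ptree T"
      have "b \<notin> U" "b \<notin> W"
        using disjT ab(2) by auto
      then have "\<not> (\<exists>t\<in>set us. (a, b) \<in> anc t)" "\<not> (\<exists>t\<in>set ws. (a, b) \<in> anc t)"
        by (auto simp: U_def W_def dest: ancD)
      then have "a = x \<or> (a, b) \<in> anc u'"
        using ab(1) by (auto simp: R)
      then show "(a, ?r) \<in> anc R"
        using u'(2) u'(5)[OF _ ab(2,3)] by (auto simp: R)
    qed
  next
    assume "is_subst v ?S T R"
    then have R: "distinct (vertices R)" "set_ptree R = insert x (U \<union> (set_ptree u - {v}) \<union> W \<union> set_ptree T)"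
      "keep ?X R = [Node x (us @ map_ptree (id(v := ?r)) u # ws)]" "keep (set_ptree T) R = [T]"
      "\<And>a b. \<lbrakk>(a, b) \<in> anc R; b \<in> set_ptree T; a \<notin> set_ptree T\<rbrakk> \<Longrightarrow> (a, ?r) \<in> anc R"
      using v unfolding map is_subst_def subst_set_def S by auto
    obtain y rs where Ry: "R = Node y rs"
      by (cases R)
    \<comment> \<open>If the root of \<open>R\<close> were in \<open>T\<close>, it would be
      \<open>root T\<close>, survive the contraction, and so equal x, which is outside
      \<open>T\<close>. Hence it survives as a vertex of S.\<close>
    have "y = x \<and> y \<notin> set_ptree T"
    proof (cases "y \<in> set_ptree T")
      case True
      then have "y = ?r"
        using root_keep_single[OF R(4)] unfolding Ry by simp
      then have "y = x"
        using R(3) unfolding Ry by (simp add: keep_Node)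
      then show ?thesis
        using True disjT by simp
    next
      case False
      then have "y \<in> ?X"
        using R(2) v unfolding Ry S by auto
      then show ?thesis
        using R(3) False unfolding Ry by (simp add: keep_Node)
    qed
    then have y: "y = x" by simp
    have rs: "keepf ?X rs = us @ map_ptree (id(v := ?r)) u # ws" "keepf (set_ptree T) rs = [T]"
      using R(3,4) v(1) disjT(1) unfolding Ry y by (auto simp: keep_Node)
    obtain rs1 t rs2 where t: "rs = rs1 @ t # rs2" "keep (set_ptree T) t = [T]"
      and others: "\<And>t'. t' \<in> set rs1 \<union> set rs2 \<Longrightarrow> keep (set_ptree T) t' = []"
      using rs(2) unfolding keepf_def by (rule concat_eq_singleton) blast
    have drs: "distinct (concat (map vertices rs))" "x \<notin> (\<Union>t\<in>set rs. set_ptree t)"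
      using R(1) unfolding Ry y by simp_all
    have T_t: "set_ptree T \<subseteq> set_ptree t"
      using set_keep_single[OF t(2)] by auto
    have sub: "set_ptree t' \<subseteq> U \<union> (set_ptree u - {v}) \<union> W" if "t' \<in> set rs1 \<union> set rs2" for t'
    proof -
      have "set_ptree t' \<subseteq> set_ptree R - {x}"
        using that drs(2) unfolding Ry y t(1) by auto
      then show ?thesis
        using others[OF that] unfolding keep_eq_Nil_iff R(2) by auto
    qed
    then have keep_rs: "keepf ?X rs1 = rs1" "keepf ?X rs2 = rs2"
      using v unfolding S by (fastforce intro!: keepf_all)+
    \<comment> \<open>The contraction of \<open>t\<close> is a single tree because its root
      survives: if that root lies in \<open>T\<close>, it is \<open>root T\<close>.\<close>
    obtain t' where t': "keep ?X t = [t']"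
    proof (cases "root t \<in> ?X")
      case True
      then show ?thesis
        using that by (cases t) (auto simp: keep_Node)
    next
      case False
      have "root t \<in> set_ptree R"
        unfolding Ry t(1) by auto
      then have "root t \<in> set_ptree T"
        using False v unfolding R(2) S by auto
      then have "root t = ?r"
        using root_keep_single[OF t(2)] by simp
      then show ?thesis
        using False by simp
    qed
    have eq: "rs1 @ t' # rs2 = us @ map_ptree (id(v := ?r)) u # ws"
      using rs(1) unfolding t(1) keepf_simps keep_rs t' by simp
    have r': "?r \<in> set_ptree t'"
      using set_keep_single[OF t'] T_t by auto
    have "?r \<in> set_ptree (map_ptree (id(v := ?r)) u)"
      using assms(4) by (auto simp: ptree.set_map)
    moreover have "?r \<notin> set_ptree t''" if "t'' \<in> set rs1 \<union> set rs2 \<union> (set us \<union> set ws)" for t''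
    proof -
      have "t'' \<in> set rs1 \<union> set rs2 \<Longrightarrow> ?thesis"
        using others[of t''] root_in_set_ptree[of T] unfolding keep_eq_Nil_iff by blast
      moreover have "t'' \<in> set us \<union> set ws \<Longrightarrow> ?thesis"
        using disjT root_in_set_ptree[of T] by (auto simp: U_def W_def)
      ultimately show ?thesis
        using that by blast
    qed
    \<comment> \<open>Only \<open>t'\<close> and the renamed \<open>u\<close> contain
      \<open>root T\<close>, so both lists are cut at the same place.\<close>
    ultimately have "rs1 = us \<and> t' = map_ptree (id(v := ?r)) u \<and> rs2 = ws"
      using eq r' by (intro append_Cons_eq_iff_first[where P = "\<lambda>t. ?r \<in> set_ptree t", THEN iffD1]) simp_all
    then have eqs: "rs1 = us" "t' = map_ptree (id(v := ?r)) u" "rs2 = ws"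
      by simp_all
    have t_disj: "set_ptree t \<inter> U = {}" "set_ptree t \<inter> W = {}" "x \<notin> set_ptree t"
    proof -
      have *: "rs = us @ t # ws"
        using t(1) eqs by simp
      show "set_ptree t \<inter> U = {}" "set_ptree t \<inter> W = {}" "x \<notin> set_ptree t"
        using drs unfolding * by (auto simp: U_def W_def)
    qed
    have set_t: "set_ptree t = (set_ptree u - {v}) \<union> set_ptree T"
    proof -
      have "set_ptree R = insert x (U \<union> set_ptree t \<union> W)"
        unfolding Ry y t(1) eqs U_def W_def by auto
      then have "set_ptree t = set_ptree R - insert x (U \<union> W)"
        using t_disj by auto
      also have "\<dots> = (set_ptree u - {v}) \<union> set_ptree T"
        unfolding R(2) using x disj disjT by auto
      finally show ?thesis .
    qed
    have "is_subst v u T t"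
      unfolding is_subst_def
    proof (intro conjI allI impI)
      show "distinct (vertices t)"
        using drs(1) by (simp add: t(1))
      show "set_ptree t = subst_set (set_ptree u) v (set_ptree T)"
        using set_t by (simp add: subst_set_def)
      have "keep ?X t = keep (insert ?r (set_ptree u - {v})) t"
        using disjT disj x unfolding S by (intro keep_cong) (auto simp: set_t)
      then show "keep (insert ?r (set_ptree u - {v})) t = [map_ptree (id(v := ?r)) u]"
        using t' eqs by simp
      show "keep (set_ptree T) t = [T]"
        by fact
      fix a b assume ab: "(a, b) \<in> anc t" "b \<in> set_ptree T" "a \<notin> set_ptree T"
      have "(a, ?r) \<in> anc R"
        using ab by (intro R(5)) (auto simp: Ry t(1))
      moreover have "a \<noteq> x"
        using ab(1) t_disj(3) by (auto dest: ancD)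
      moreover have "\<not> (\<exists>t\<in>set us. (a, ?r) \<in> anc t)" "\<not> (\<exists>t\<in>set ws. (a, ?r) \<in> anc t)"
        using disjT root_in_set_ptree[of T] by (auto simp: U_def W_def dest!: ancD)
      ultimately show "(a, ?r) \<in> anc t"
        unfolding Ry y t(1) eqs by auto
    qed
    then show "\<exists>u'. is_subst v u T u' \<and> R = Node x (us @ u' # ws)"
      using Ry y t(1) eqs by auto
  qed
qed

text \<open>Follows the path from the root down to \<open>v\<close>, with one use of
  \<open>is_subst_Node_iff\<close> for each vertex passed.\<close>

lemma is_subst_iff_plug:
  assumes "distinct (vertices S)" "distinct (vertices T)" "composable (set_ptree S) v (set_ptree T)"
  shows "is_subst v S T R \<longleftrightarrow> (\<exists>R'. is_subst v (Node v (children S v)) T R' \<and> R = plug v R' S)"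
  using assms
proof (induction S arbitrary: R)
  case (Node x ts)
  show ?case
  proof (cases "x = v")
    case False
    have "v \<in> set_ptree (Node x ts)"
      using Node.prems(3) by (simp add: composable_def)
    then obtain u where u: "u \<in> set ts" "v \<in> set_ptree u"
      using False by auto
    then obtain us ws where ts: "ts = us @ u # ws" and nin: "v \<notin> (\<Union>u\<in>set us. set_ptree u)"
      "v \<notin> (\<Union>u\<in>set ws. set_ptree u)"
      using Node.prems(1) by (auto elim: distinct_branches_split)
    have du: "distinct (vertices u)"
      using Node.prems(1) u(1) by (auto dest: distinct_concat_vertices_memD)
    have cu: "composable (set_ptree u) v (set_ptree T)"
      using Node.prems(3) u by (auto simp: composable_def)
    have "plug v R' (Node x ts) = Node x (us @ plug v R' u # ws)" for R'
      using False nin by (auto simp: ts plug_notin intro!: map_idI)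
    moreover have "children (Node x ts) v = children u v"
      using children_split[of v x us ws u] False nin by (simp add: ts)
    ultimately show ?thesis
      using is_subst_Node_iff[of x us u ws T v R] Node.prems u(2)
        Node.IH[OF u(1) du Node.prems(2) cu] by (auto simp: ts)
  qed simp
qed

lemma plug_inject:
  "v \<in> set_ptree S \<Longrightarrow> plug v R S = plug v R' S \<Longrightarrow> R = R'"
  by (induction S) (auto split: if_splits)

lemma set_children_subset: "(\<Union>u\<in>set (children S v). set_ptree u) \<subseteq> set_ptree S"
proof (induction S)
  case (Node x ts)
  have "x' \<in> set_ptree t" if "t \<in> set ts" "u \<in> set (children t v)" "x' \<in> set_ptree u" for t u x'
    using Node.IH[OF that(1)] that(2,3) by auto
  then show ?case
    by (cases "v = x") auto
qed

lemma distinct_children: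
  "distinct (vertices S) \<Longrightarrow> distinct (vertices (Node v (children S v)))"
proof (induction S)
  case (Node x ts)
  show ?case
  proof (cases "v \<in> (\<Union>u\<in>set ts. set_ptree u) \<and> v \<noteq> x")
    case True
    then obtain u where u: "u \<in> set ts" "v \<in> set_ptree u"
      by auto
    then obtain us ws where ts: "ts = us @ u # ws" and nin: "v \<notin> (\<Union>u\<in>set us. set_ptree u)"
      "v \<notin> (\<Union>u\<in>set ws. set_ptree u)"
      using Node.prems(1) by (auto elim: distinct_branches_split)
    have "children (Node x ts) v = children u v"
      using children_split[of v x us ws u] True nin by (simp add: ts)
    moreover have "distinct (vertices u)"
      using Node.prems(1) u(1) by (auto dest: distinct_concat_vertices_memD)
    ultimately show ?thesis
      using Node.IH[OF u(1)] by simp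
  next
    case False
    then show ?thesis
      using Node.prems children_notin[of v "Node x ts"] by (cases "v = x") (auto simp del: children.simps, auto)
  qed
qed

lemma children_branches_disjoint:
  "composable (set_ptree S) v (set_ptree T) \<Longrightarrow> distinct (vertices S) \<Longrightarrow>
     (\<Union>u\<in>set (children S v). set_ptree u) \<inter> set_ptree T = {}"
  using set_children_subset[of S v] distinct_children[of S v] by (auto simp: composable_def)

text \<open>\<open>plug\<close> reduces everything to the graft at \<open>v\<close>. There
  \<open>graft_inject\<close> recovers the list at each angle, and as the children of
  \<open>v\<close> are distinct trees these lists determine the map. Conversely, the lists of a
  given \<open>R\<close> concatenate to the children of \<open>v\<close>, so
  \<open>exists_increasing_fiber\<close> supplies a map.\<close>

lemma bij_betw_substitute:
  assumes "distinct (vertices S)" "distinct (vertices T)" "composable (set_ptree S) v (set_ptree T)"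
  shows "bij_betw (\<lambda>f. substitute S v f T) (increasing_maps S v T (set (angles T))) {R. is_subst v S T R}"
proof -
  define us where "us = children S v"
  have v: "v \<in> set_ptree S"
    using assms(3) by (simp add: composable_def)
  have dus: "distinct (vertices (Node v us))"
    unfolding us_def by (rule distinct_children) fact
  then have "distinct us"
    using distinct_concat_vertices_distinct by auto
  have disj: "(\<Union>u\<in>set us. set_ptree u) \<inter> set_ptree T = {}"
    unfolding us_def using assms by (intro children_branches_disjoint)
  have dL: "distinct (angles T)"
    using assms(2) by (rule distinct_angles)
  have sub: "substitute S v f T = plug v (graft (fiber us f) T) S" for f
    unfolding us_def using assms(1) v by (rule substitute_eq_plug)
  have inc: "f i \<in> set (angles T)"
    "\<And>j. i \<le> j \<Longrightarrow> j < length us \<Longrightarrow> \<exists>p q. p \<le> q \<and> q < length (angles T) \<and> angles T ! p = f i \<and> angles T ! q = f j"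
    if "f \<in> increasing_maps S v T (set (angles T))" "i < length us" for f i
    using that by (auto simp: increasing_maps_def edges_def us_def angle_le_def PiE_iff)
  have cf: "concat (map (fiber us f) (angles T)) = us"
    if "f \<in> increasing_maps S v T (set (angles T))" for f
    using dL inc[OF that] by (intro concat_fiber) auto
  show ?thesis
    unfolding bij_betw_def
  proof (intro conjI set_eqI iffI inj_onI)
    fix f f' assume f: "f \<in> increasing_maps S v T (set (angles T))"
      and f': "f' \<in> increasing_maps S v T (set (angles T))"
      and eq: "substitute S v f T = substitute S v f' T"
    have geq: "graft (fiber us f) T = graft (fiber us f') T"
      using eq v unfolding sub by (auto dest: plug_inject)
    have "fiber us f \<alpha> = fiber us f' \<alpha>" if "\<alpha> \<in> set (angles T)" for \<alpha>
    proof (rule graft_inject(1)[OF geq order_refl _ that])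
      fix \<alpha> u assume "\<alpha> \<in> set (angles T)" "u \<in> set (fiber us f \<alpha>) \<union> set (fiber us f' \<alpha>)"
      then have "u \<in> set us"
        by (auto simp: fiber_def)
      then show "root u \<notin> set_ptree T"
        using disj root_in_set_ptree[of u] by blast
    qed
    then have "f i = f' i" if "i < length us" for i
      using fiber_inject[OF \<open>distinct us\<close>, of "set (angles T)" f f' i] inc(1)[OF f that] that by auto
    then show "f = f'"
      using f f' by (intro PiE_ext[of f "edges S v" "\<lambda>_. set (angles T)" f'])
        (auto simp: increasing_maps_def edges_def us_def)
  next
    fix R assume "R \<in> (\<lambda>f. substitute S v f T) ` increasing_maps S v T (set (angles T))"
    then obtain f where f: "f \<in> increasing_maps S v T (set (angles T))" "R = substitute S v f T"
      by blast
    have "is_subst v (Node v us) T (graft (fiber us f) T)"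
      using dus assms(2) disj cf[OF f(1)] by (rule is_subst_graft)
    then show "R \<in> {R. is_subst v S T R}"
      using is_subst_iff_plug[OF assms, of R] f(2) by (auto simp: sub us_def)
  next
    fix R assume "R \<in> {R. is_subst v S T R}"
    then obtain R' where R': "is_subst v (Node v us) T R'" "R = plug v R' S"
      using is_subst_iff_plug[OF assms, of R] by (auto simp: us_def)
    obtain g where g: "R' = graft g T" "concat (map g (angles T)) = us"
      using is_subst_imp_graft[OF R'(1) dus assms(2) disj] by blast
    obtain f where f: "\<And>\<alpha>. \<alpha> \<in> set (angles T) \<Longrightarrow> fiber us f \<alpha> = g \<alpha>"
      "\<And>i. i < length us \<Longrightarrow> f i \<in> set (angles T)"
      "\<And>i j. i \<le> j \<Longrightarrow> j < length us \<Longrightarrow>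
           \<exists>p q. p \<le> q \<and> q < length (angles T) \<and> angles T ! p = f i \<and> angles T ! q = f j"
      using exists_increasing_fiber[OF dL g(2)] by blast
    define f' where "f' = restrict f (edges S v)"
    have "f' \<in> increasing_maps S v T (set (angles T))"
      using f(2,3) by (auto simp: f'_def increasing_maps_def edges_def us_def angle_le_def)
    moreover have "fiber us f' \<alpha> = fiber us f \<alpha>" for \<alpha>
      by (auto simp: fiber_def f'_def edges_def us_def intro!: arg_cong[where f = "map _"] filter_cong)
    then have "graft (fiber us f') T = R'"
      unfolding g(1) using f(1) by (intro graft_cong) auto
    then have "substitute S v f' T = R"
      by (simp add: sub R'(2))
    ultimately show "R \<in> (\<lambda>f. substitute S v f T) ` increasing_maps S v T (set (angles T))"
      by blast
  qed
qed

section \<open>Maps into the root angles\<close>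

lemma finite_increasing_maps [simp]:
  "finite D \<Longrightarrow> finite (increasing_maps S v T D)"
  by (auto simp: increasing_maps_def edges_def intro: finite_subset[OF _ finite_PiE[of "{..<length (children S v)}"]])

lemma const_in_increasing_maps:
  "restrict (\<lambda>_. (root T, 0)) (edges S v) \<in> increasing_maps S v T (root_angles T)"
proof -
  have "angle_le T (root T, 0) (root T, 0)"
    by (cases T) (auto simp: angle_le_def intro!: exI[of _ 0])
  then show ?thesis
    by (auto simp: increasing_maps_def root_angles_def)
qed

lemma root_angles_subset: "root_angles T \<subseteq> set (angles T)"
  by (auto simp: root_angles_def)

lemma increasing_maps_mono:
  "D \<subseteq> D' \<Longrightarrow> increasing_maps S v T D \<subseteq> increasing_maps S v T D'"
  by (auto simp: increasing_maps_def)

lemma anc_substitute_root_angles: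
  assumes "distinct (vertices S)" "distinct (vertices T)" "composable (set_ptree S) v (set_ptree T)"
    and f: "f \<in> increasing_maps S v T (root_angles T)"
    and ab: "(a, b) \<in> anc (substitute S v f T)" "a \<in> set_ptree T" "a \<noteq> root T"
  shows "b \<in> set_ptree T"
proof -
  define us where "us = children S v"
  have v: "v \<in> set_ptree S"
    using assms(3) by (simp add: composable_def)
  have sub: "substitute S v f T = plug v (graft (fiber us f) T) S"
    unfolding us_def using assms(1) v by (rule substitute_eq_plug)
  have disj: "(\<Union>u\<in>set us. set_ptree u) \<inter> set_ptree T = {}"
    unfolding us_def using assms by (intro children_branches_disjoint)
  \<comment> \<open>Vertices of S outside the graft are not in \<open>T\<close>, so a pair whose
    upper vertex is in \<open>T\<close> already lies in the graft.\<close>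
  have "(a, b) \<in> anc (plug v R S) \<Longrightarrow> (set_ptree S - {v}) \<inter> set_ptree T = {} \<Longrightarrow> (a, b) \<in> anc R" for R
  proof (induction S)
    case (Node x ts)
    have IH: "(a, b) \<in> anc R" if "t \<in> set ts" "(a, b) \<in> anc (plug v R t)" for t
      using Node.IH[OF that] Node.prems(2) that(1) by auto
    show ?case
      using Node.prems IH ab(2) by (auto split: if_splits)
  qed
  then have *: "(a, b) \<in> anc (graft (fiber us f) T)"
    using ab(1) assms(3) by (auto simp: sub composable_def)
  show ?thesis
  proof (rule anc_graft_root_angles[OF _ _ * ab(2,3) assms(2)])
    fix \<alpha> :: "'a \<times> nat" assume "fst \<alpha> \<noteq> root T"
    then have "f i \<noteq> \<alpha>" if "i < length us" for i
      using that f by (auto simp: increasing_maps_def root_angles_def edges_def us_def PiE_iff)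
    then show "fiber us f \<alpha> = []"
      by (auto simp: fiber_def filter_empty_conv)
  next
    fix u assume "u \<in> set (concat (map (fiber us f) (angles T)))"
    then have "u \<in> set us"
      by (auto simp: fiber_def)
    then show "set_ptree u \<inter> set_ptree T = {}"
      using disj by blast
  qed
qed


section \<open>Energy and iterated substitutions\<close>

lemma finite_anc [simp]: "finite (anc t)"
  by (rule finite_subset[OF anc_subset]) (auto intro: finite_set[of "vertices t", simplified])

lemma height_eq_card_anc:
  "distinct (vertices t) \<Longrightarrow> v \<in> set_ptree t \<Longrightarrow> height t v = card {x. (x, v) \<in> anc t}"
proof (induction t)
  case (Node r ts)
  show ?case
  proof (cases "v = r")
    case True
    then have "{x. (x, v) \<in> anc (Node r ts)} = {}"
      using Node.prems(1) by (auto dest: ancD)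
    then show ?thesis
      using True by simp
  next
    case False
    then obtain u where u: "u \<in> set ts" "v \<in> set_ptree u"
      using Node.prems by auto
    then obtain us ws where ts: "ts = us @ u # ws" and nin: "v \<notin> (\<Union>u\<in>set us. set_ptree u)"
      "v \<notin> (\<Union>u\<in>set ws. set_ptree u)"
      using Node.prems(1) by (auto elim: distinct_branches_split)
    have "map (\<lambda>t. if v \<in> set_ptree t then height t v else 0) us = map (\<lambda>_. 0) us"
      "map (\<lambda>t. if v \<in> set_ptree t then height t v else 0) ws = map (\<lambda>_. 0) ws"
      using nin by auto
    then have "height (Node r ts) v = Suc (height u v)"
      using False u(2) by (simp add: ts del: map_eq_conv)
    also have "height u v = card {x. (x, v) \<in> anc u}"
      using Node.prems(1) u by (intro Node.IH) (auto dest: distinct_concat_vertices_memD)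
    also have "Suc \<dots> = card (insert r {x. (x, v) \<in> anc u})"
    proof (subst card_insert_disjoint)
      show "finite {x. (x, v) \<in> anc u}"
        by (rule finite_subset[of _ "fst ` anc u"]) force+
      show "r \<notin> {x. (x, v) \<in> anc u}"
        using Node.prems(1) u(1) by (auto dest: ancD)
    qed simp
    also have "insert r {x. (x, v) \<in> anc u} = {x. (x, v) \<in> anc (Node r ts)}"
      using nin u False by (auto simp: ts dest: ancD)
    finally show ?thesis .
  qed
qed

text \<open>The height of a vertex is the number of its proper ancestors. In this form the energy
  splits along any partition of the ancestor relation.\<close>

lemma energy_eq_sum_anc:
  assumes "distinct (vertices t)"
  shows "energy W t = (\<Sum>(x, y)\<in>anc t. W y)"
proof -
  have fin: "finite {x. (x, v) \<in> anc t}" for v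
    by (rule finite_subset[of _ "fst ` anc t"]) force+
  have "energy W t = (\<Sum>v\<in>set_ptree t. \<Sum>x\<in>{x. (x, v) \<in> anc t}. W v)"
    using assms by (auto simp: energy_def height_eq_card_anc mult.commute intro!: sum.cong)
  also have "\<dots> = (\<Sum>(v, x)\<in>Sigma (set_ptree t) (\<lambda>v. {x. (x, v) \<in> anc t}). W v)"
    using fin finite_set[of "vertices t"] by (intro sum.Sigma) auto
  also have "\<dots> = (\<Sum>(x, y)\<in>anc t. W y)"
    by (rule sum.reindex_bij_witness[of _ prod.swap prod.swap]) (auto dest: ancD)
  finally show ?thesis .
qed

text \<open>The ancestor relation of \<open>R\<close> is cut into blocks according to which of its
  two vertices come from S or T. All blocks but one are accounted for by S and T; the last sum is
  the exponent of lambda.\<close>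

lemma energy_is_subst:
  assumes R: "is_subst v S T R" and dS: "distinct (vertices S)" and dT: "distinct (vertices T)"
    and comp: "composable (set_ptree S) v (set_ptree T)" and wt: "sum X (set_ptree T) = W v"
    and Z: "Z = glue (set_ptree S) v (set_ptree T) W X"
  shows "energy Z R = energy W S + energy X T +
    (\<Sum>(x, y)\<in>anc R \<inter> (set_ptree T - {root T}) \<times> (set_ptree S - {v}). Z y)"
proof -
  define A where "A = set_ptree S - {v}"
  define B where "B = set_ptree T"
  define r where "r = root T"
  define \<rho> where "\<rho> = id(v := r)"
  define E where "E = anc R"
  have finA: "finite A" and finB: "finite B"
    using comp by (auto simp: composable_def A_def B_def)
  have disj: "A \<inter> B = {}"
    using comp by (auto simp: composable_def A_def B_def)
  have r: "r \<in> B"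
    by (simp add: r_def B_def)
  have dR: "distinct (vertices R)" and setR: "set_ptree R = A \<union> B"
    using R by (auto simp: is_subst_def subst_set_def A_def B_def)
  have finE: "finite E"
    by (simp add: E_def)
  have anc_S: "map_prod \<rho> \<rho> ` anc S = E \<inter> insert r A \<times> insert r A"
    using R anc_keep_single[of "insert r A" R "map_ptree \<rho> S"]
    by (simp add: is_subst_def r_def A_def \<rho>_def E_def anc_map_ptree)
  have anc_T: "anc T = E \<inter> B \<times> B"
    using R anc_keep_single[of B R T] by (simp add: is_subst_def B_def E_def)
  have E_sub: "E \<subseteq> (A \<union> B) \<times> (A \<union> B)"
    using anc_subset[of R] by (simp add: E_def setR)
  have irr: "(r, r) \<notin> E"
    using anc_irrefl[OF dR] by (simp add: E_def)
  \<comment> \<open>The ancestors of \<open>v\<close> in S. By the condition on ancestors every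
    vertex of \<open>T\<close> has exactly these ancestors in \<open>A\<close>, so the block
    \<open>A\<close> times \<open>B\<close> weighs \<open>card N\<close> times |T|; in S the pairs
    ending in \<open>v\<close> weigh \<open>card N * W v\<close>, which is the same.\<close>
  define N where "N = {x\<in>A. (x, r) \<in> E}"
  have AB: "E \<inter> A \<times> B = N \<times> B"
  proof (intro set_eqI iffI)
    fix p assume "p \<in> E \<inter> A \<times> B"
    then show "p \<in> N \<times> B"
      using R disj unfolding is_subst_def N_def E_def r_def B_def by auto
  next
    fix p assume "p \<in> N \<times> B"
    then obtain x y where p: "p = (x, y)" "x \<in> A" "(x, r) \<in> E" "y \<in> B"
      by (auto simp: N_def)
    have "y = r \<or> (r, y) \<in> E"
      using anc_root[of y T] p(4) anc_T by (auto simp: r_def B_def)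
    then show "p \<in> E \<inter> A \<times> B"
      using p anc_trans[OF dR] by (auto simp: E_def)
  qed
  have ZA: "Z y = W y" if "y \<in> A" for y
    using that disj by (auto simp: Z glue_def subst_set_def A_def B_def)
  have ZB: "Z y = X y" if "y \<in> B" for y
    using that by (auto simp: Z glue_def subst_set_def B_def)
  have "energy W S = (\<Sum>(x, y)\<in>anc S. W y)"
    by (rule energy_eq_sum_anc) fact
  \<comment> \<open>After the transport to \<open>R\<close> the vertex \<open>v\<close> is called
    \<open>r\<close>, but it must still be counted with \<open>W v\<close> and not with the weight
    of \<open>r\<close> in T.\<close>
  also have "\<dots> = (\<Sum>(x, y)\<in>map_prod \<rho> \<rho> ` anc S. if y = r then W v else Z y)"
  proof (subst sum.reindex)
    have "inj_on \<rho> (set_ptree S)"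
      using disj r by (auto simp: \<rho>_def inj_on_def A_def)
    then show "inj_on (map_prod \<rho> \<rho>) (anc S)"
      using anc_subset[of S] by (blast intro: inj_on_subset map_prod_inj_on)
    show "(\<Sum>(x, y)\<in>anc S. W y) = sum ((\<lambda>(x, y). if y = r then W v else Z y) \<circ> map_prod \<rho> \<rho>) (anc S)"
    proof (intro sum.cong refl)
      fix p assume "p \<in> anc S"
      then have "snd p \<in> set_ptree S"
        by (cases p) (auto dest: ancD)
      then have "snd p = v \<or> snd p \<in> A \<and> snd p \<noteq> r"
        using disj r by (auto simp: A_def)
      then show "(case p of (x, y) \<Rightarrow> W y) = ((\<lambda>(x, y). if y = r then W v else Z y) \<circ> map_prod \<rho> \<rho>) p"
        by (cases p) (auto simp: \<rho>_def ZA)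
    qed
  qed
  also have "map_prod \<rho> \<rho> ` anc S = (E \<inter> A \<times> A \<union> E \<inter> {r} \<times> A) \<union> N \<times> {r}"
    unfolding anc_S using irr by (auto simp: N_def)
  also have "(\<Sum>(x, y)\<in>\<dots>. if y = r then W v else Z y) =
      (\<Sum>(x, y)\<in>E \<inter> A \<times> A \<union> E \<inter> {r} \<times> A. if y = r then W v else Z y) +
      (\<Sum>(x, y)\<in>N \<times> {r}. if y = r then W v else Z y)"
    using finE finA disj r by (intro sum.union_disjoint) (auto simp: N_def)
  also have "(\<Sum>(x, y)\<in>E \<inter> A \<times> A \<union> E \<inter> {r} \<times> A. if y = r then W v else Z y) =
      (\<Sum>(x, y)\<in>E \<inter> A \<times> A \<union> E \<inter> {r} \<times> A. Z y)"
    using disj r by (intro sum.cong) auto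
  also have "\<dots> = (\<Sum>(x, y)\<in>E \<inter> A \<times> A. Z y) + (\<Sum>(x, y)\<in>E \<inter> {r} \<times> A. Z y)"
    using finE disj r by (intro sum.union_disjoint) auto
  also have "(\<Sum>(x, y)\<in>N \<times> {r}. if y = r then W v else Z y) = card N * W v"
    by (simp add: sum.cartesian_product[symmetric])
  finally have S: "energy W S = (\<Sum>(x, y)\<in>E \<inter> A \<times> A. Z y) + (\<Sum>(x, y)\<in>E \<inter> {r} \<times> A. Z y) + card N * W v" .
  have T: "energy X T = (\<Sum>(x, y)\<in>E \<inter> B \<times> B. Z y)"
    unfolding energy_eq_sum_anc[OF dT] anc_T by (intro sum.cong) (auto simp: ZB)
  have NB: "(\<Sum>(x, y)\<in>E \<inter> A \<times> B. Z y) = card N * W v"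
    using wt unfolding AB by (simp add: sum.cartesian_product[symmetric] ZB flip: B_def)
  have "E = E \<inter> A \<times> A \<union> E \<inter> {r} \<times> A \<union> E \<inter> (B - {r}) \<times> A \<union> E \<inter> B \<times> B \<union> E \<inter> A \<times> B"
    using E_sub r by auto
  then have "energy Z R = (\<Sum>(x, y)\<in>E \<inter> A \<times> A \<union> E \<inter> {r} \<times> A \<union> E \<inter> (B - {r}) \<times> A \<union> E \<inter> B \<times> B \<union> E \<inter> A \<times> B. Z y)"
    using energy_eq_sum_anc[OF dR, of Z] by (simp flip: E_def)
  also have "\<dots> = (\<Sum>(x, y)\<in>E \<inter> A \<times> A. Z y) + (\<Sum>(x, y)\<in>E \<inter> {r} \<times> A. Z y) +
      (\<Sum>(x, y)\<in>E \<inter> (B - {r}) \<times> A. Z y) + (\<Sum>(x, y)\<in>E \<inter> B \<times> B. Z y) + (\<Sum>(x, y)\<in>E \<inter> A \<times> B. Z y)"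
    using finE disj r by (subst sum.union_disjoint, simp, simp, blast)+ simp
  finally show ?thesis
    unfolding S T NB by (simp add: E_def A_def B_def r_def)
qed

lemma is_subst_labelled:
  assumes "labelled_by A S" "labelled_by B T" "is_subst v S T R"
  shows "labelled_by (subst_set A v B) R"
  using assms by (auto simp: labelled_by_def is_subst_def)

lemma finite_is_subst:
  assumes "labelled_by A S" "labelled_by B T" "composable A v B"
  shows "finite {R. is_subst v S T R}"
  using bij_betw_finite[OF bij_betw_substitute[of S T v]] assms by (auto simp: labelled_by_def)

text \<open>Makes the truncated subtractions in the exponents genuine differences, without which
  they would not telescope.\<close>

lemma energy_is_subst_ge:
  assumes "labelled_by A S" "labelled_by B T" "composable A v B" "sum X B = W v" "is_subst v S T R"
  shows "energy W S + energy X T \<le> energy (glue A v B W X) R"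
  using energy_is_subst[OF assms(5) _ _ _ _ refl, of X W] assms by (auto simp: labelled_by_def)

text \<open>A map into the root angles leaves no vertex of S below a non-root vertex of T, so by
  \<open>energy_is_subst\<close> its energy is \<open>energy W S + energy X T\<close>, whichever
  such map the choice operator picks.\<close>

lemma diamond_eq_sum_is_subst:
  assumes S: "labelled_by A S" and T: "labelled_by B T" and comp: "composable A v B"
    and wt: "sum X B = W v"
  shows "diamond l W S v X T = (\<Sum>R | is_subst v S T R.
    Poly_Mapping.single R (l ^ (energy (glue A v B W X) R - (energy W S + energy X T))))"
proof -
  let ?I = "increasing_maps S v T"
  define f0 where "f0 = (SOME f0. f0 \<in> ?I (root_angles T))"
  have A: "A = set_ptree S" and B: "B = set_ptree T" and dS: "distinct (vertices S)" and dT: "distinct (vertices T)"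
    using S T by (auto simp: labelled_by_def)
  have bij: "bij_betw (\<lambda>f. substitute S v f T) (?I (set (angles T))) {R. is_subst v S T R}"
    using bij_betw_substitute[OF dS dT] comp by (simp add: A B)
  have f0: "f0 \<in> ?I (root_angles T)"
    unfolding f0_def
    by (rule someI[of "\<lambda>f. f \<in> ?I (root_angles T)"], rule const_in_increasing_maps)
  then have "f0 \<in> ?I (set (angles T))"
    using increasing_maps_mono[OF root_angles_subset[of T], of S v T] by blast
  then have "is_subst v S T (substitute S v f0 T)"
    using bij by (auto simp: bij_betw_def)
  note e0 = energy_is_subst[where W = W and X = X, OF this dS dT comp[unfolded A B] wt[unfolded B] refl]
  have "anc (substitute S v f0 T) \<inter> (set_ptree T - {root T}) \<times> (set_ptree S - {v}) = {}"
    using anc_substitute_root_angles[OF dS dT comp[unfolded A B] f0] comp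
    by (auto simp: A B composable_def)
  with e0 have "energy (glue A v B W X) (substitute S v f0 T) = energy W S + energy X T"
    by (simp add: A B)
  moreover have "weight X T = W v"
    using wt by (simp add: weight_def B)
  ultimately have "diamond l W S v X T = (\<Sum>f\<in>?I (set (angles T)). Poly_Mapping.single (substitute S v f T)
      (l ^ (energy (glue A v B W X) (substitute S v f T) - (energy W S + energy X T))))"
    by (simp add: diamond_def Let_def substitution_energy_def A B flip: f0_def)
  also have "\<dots> = (\<Sum>R | is_subst v S T R.
    Poly_Mapping.single R (l ^ (energy (glue A v B W X) R - (energy W S + energy X T))))"
    using sum.reindex_bij_betw[OF bij] .
  finally show ?thesis .
qed

lemma map_ptree_inject_on:
  "map_ptree \<rho> t = map_ptree \<rho> u \<Longrightarrow> inj_on \<rho> (set_ptree t \<union> set_ptree u) \<Longrightarrow> t = u"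
  by (rule ptree.inj_map_strong[of t u \<rho> \<rho>]) (auto dest: inj_onD)

lemma keep_image_map_ptree:
  assumes "inj_on \<rho> (set_ptree t)" "X \<subseteq> set_ptree t"
  shows "keep (\<rho> ` X) (map_ptree \<rho> t) = map (map_ptree \<rho>) (keep X t)"
proof -
  have "keep (\<rho> -` \<rho> ` X) t = keep X t"
    using assms by (intro keep_cong) (auto dest: inj_onD)
  then show ?thesis
    by (simp add: keep_map_ptree)
qed

lemma root_map_ptree [simp]: "root (map_ptree \<rho> t) = \<rho> (root t)"
  by (cases t) auto

lemma root_is_subst:
  assumes "is_subst v S T R" "composable (set_ptree S) v (set_ptree T)"
  shows "root R = (id(v := root T)) (root S)"
proof -
  have R: "set_ptree R = (set_ptree S - {v}) \<union> set_ptree T"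
    "keep (insert (root T) (set_ptree S - {v})) R = [map_ptree (id(v := root T)) S]" "keep (set_ptree T) R = [T]"
    using assms(1) by (auto simp: is_subst_def subst_set_def)
  have "root R \<in> insert (root T) (set_ptree S - {v})"
    using root_keep_single[OF R(3)] root_in_set_ptree[of R] unfolding R(1) by auto
  then show ?thesis
    using root_keep_single[OF R(2)] by simp
qed

text \<open>Contracting \<open>T\<close> to its root in \<open>R\<close> gives back \<open>S\<close>.\<close>

context
  fixes S T R :: "'a ptree" and v :: 'a and \<rho> :: "'a \<Rightarrow> 'a"
  assumes R: "is_subst v S T R" and comp: "composable (set_ptree S) v (set_ptree T)"
  defines "\<rho> \<equiv> id(v := root T)"
begin

lemma is_subst_inj: "inj_on \<rho> (set_ptree S)"
  using comp root_in_set_ptree[of T] by (auto simp: \<rho>_def inj_on_def composable_def)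

lemma is_subst_image: "\<rho> ` set_ptree S = insert (root T) (set_ptree S - {v})"
  using comp by (auto simp: \<rho>_def composable_def)

lemma is_subst_keep:
  assumes "X \<subseteq> set_ptree S"
  shows "keep (\<rho> ` X) R = map (map_ptree \<rho>) (keep X S)"
proof -
  have "keep (\<rho> ` X) (map_ptree \<rho> S) = keep (\<rho> ` X \<inter> \<rho> ` set_ptree S) R"
    using R by (intro keep_keep) (simp add: is_subst_def is_subst_image, simp add: \<rho>_def)
  moreover have "\<rho> ` X \<inter> \<rho> ` set_ptree S = \<rho> ` X"
    using assms by auto
  ultimately show ?thesis
    using keep_image_map_ptree[OF is_subst_inj assms] by simp
qed

text \<open>Applied with the intermediate tree of a double composition in the role of
  \<open>S\<close>: its deletions become deletions in the final tree.
  \<open>is_subst_anc_iff\<close> does the same for ancestors.\<close>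

lemma is_subst_keep_single_iff:
  assumes "X \<subseteq> set_ptree S" "set_ptree u \<subseteq> set_ptree S"
  shows "keep X S = [u] \<longleftrightarrow> keep (\<rho> ` X) R = [map_ptree \<rho> u]"
proof
  assume "keep (\<rho> ` X) R = [map_ptree \<rho> u]"
  then obtain u' where u': "keep X S = [u']" "map_ptree \<rho> u' = map_ptree \<rho> u"
    using is_subst_keep[OF assms(1)] by auto
  moreover have "set_ptree u' \<subseteq> set_ptree S"
    using set_keep_single[OF u'(1)] by auto
  ultimately show "keep X S = [u]"
    using map_ptree_inject_on[of \<rho> u' u] assms(2) is_subst_inj inj_on_subset[of \<rho> "set_ptree S"] by auto
qed (simp add: is_subst_keep[OF assms(1)])

lemma is_subst_anc_iff:
  assumes "a \<in> set_ptree S" "b \<in> set_ptree S"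
  shows "(a, b) \<in> anc S \<longleftrightarrow> (\<rho> a, \<rho> b) \<in> anc R"
proof -
  have "keep (\<rho> ` set_ptree S) R = [map_ptree \<rho> S]"
    using is_subst_keep[of "set_ptree S"] keep_all[of S "set_ptree S"] by simp
  then have "map_prod \<rho> \<rho> ` anc S = anc R \<inter> \<rho> ` set_ptree S \<times> \<rho> ` set_ptree S"
    using anc_keep_single anc_map_ptree by metis
  moreover have "(a, b) \<in> anc S \<longleftrightarrow> (\<rho> a, \<rho> b) \<in> map_prod \<rho> \<rho> ` anc S"
  proof
    assume "(\<rho> a, \<rho> b) \<in> map_prod \<rho> \<rho> ` anc S"
    then obtain a' b' where *: "(a', b') \<in> anc S" "\<rho> a = \<rho> a'" "\<rho> b = \<rho> b'"
      by auto
    then have "a = a'" "b = b'"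
      using is_subst_inj assms ancD[OF *(1)] by (auto dest: inj_onD)
    then show "(a, b) \<in> anc S"
      using *(1) by simp
  qed force
  ultimately show ?thesis
    using assms by auto
qed

lemma is_subst_conn:
  "(a, b) \<in> anc R \<Longrightarrow> b \<in> set_ptree T \<Longrightarrow> a \<notin> set_ptree T \<Longrightarrow> (a, root T) \<in> anc R"
  using R by (simp add: is_subst_def)

lemma is_subst_set: "set_ptree R = (set_ptree S - {v}) \<union> set_ptree T"
  using R by (simp add: is_subst_def subst_set_def)

lemma is_subst_distinct: "distinct (vertices R)"
  using R by (simp add: is_subst_def)

lemma is_subst_keep_right: "keep (set_ptree T) R = [T]"
  using R by (simp add: is_subst_def)

end

lemma is_subst_unique:
  assumes "is_subst v S T R" "is_subst v S' T R" "set_ptree S = set_ptree S'"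
    "composable (set_ptree S) v (set_ptree T)"
  shows "S = S'"
proof (rule map_ptree_inject_on)
  show "map_ptree (id(v := root T)) S = map_ptree (id(v := root T)) S'"
    using assms(1-3) by (simp add: is_subst_def)
  show "inj_on (id(v := root T)) (set_ptree S \<union> set_ptree S')"
    using is_subst_inj[OF assms(1,4)] assms(3) by simp
qed

text \<open>The tree S is what remains of \<open>R\<close> when T is contracted, with
  \<open>root T\<close> renamed to \<open>v\<close>. The vertex \<open>x\<close> is its root; being
  above all that is kept, it ensures that a tree remains and not a forest.\<close>

lemma is_subst_exists:
  assumes "distinct (vertices R)" "set_ptree R = subst_set V v (set_ptree T)" "v \<in> V"
    "(V - {v}) \<inter> set_ptree T = {}" "keep (set_ptree T) R = [T]"
    "\<And>a b. (a, b) \<in> anc R \<Longrightarrow> b \<in> set_ptree T \<Longrightarrow> a \<notin> set_ptree T \<Longrightarrow> (a, root T) \<in> anc R"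
    and x: "x \<in> insert (root T) (V - {v})"
      "\<And>y. y \<in> insert (root T) (V - {v}) \<Longrightarrow> y \<noteq> x \<Longrightarrow> (x, y) \<in> anc R"
  shows "\<exists>S. set_ptree S = V \<and> is_subst v S T R \<and> distinct (vertices S)"
proof -
  let ?Y = "insert (root T) (V - {v})"
  have Y: "?Y \<inter> set_ptree R = ?Y"
    using assms(2) by (auto simp: subst_set_def)
  obtain P where P: "keep ?Y R = [P]"
    using keep_single[OF assms(1), of x ?Y] x unfolding Y by auto
  have setP: "set_ptree P = ?Y"
    using set_keep_single[OF P] Y by simp
  define S where "S = map_ptree (id(root T := v)) P"
  have rT: "root T \<notin> V - {v}"
    using assms(4) root_in_set_ptree[of T] by blast
  have setS: "set_ptree S = V"
    using rT assms(3) by (auto simp: S_def ptree.set_map setP)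
  have "map_ptree (id(v := root T)) S = map_ptree id P"
    unfolding S_def ptree.map_comp by (rule ptree.map_cong) (auto simp: setP)
  then have "map_ptree (id(v := root T)) S = P"
    by (simp add: ptree.map_id)
  moreover have "distinct (vertices S)"
    unfolding S_def vertices_map_ptree distinct_map
    using distinct_keep_single[OF P assms(1)] rT by (auto simp: setP inj_on_def)
  ultimately show ?thesis
    using assms(1,2,5,6) P setS by (intro exI[of _ S]) (auto simp: is_subst_def)
qed


text \<open>The analogue of \<open>is_subst\<close> for three nested trees, referring to no
  intermediate tree. Here \<open>r\<close> is the root of the composite of T and U: it is
  \<open>s\<close> if \<open>w\<close> is the root of T, and \<open>root T\<close>
  otherwise.\<close>

definition nested :: "'a \<Rightarrow> 'a \<Rightarrow> 'a ptree \<Rightarrow> 'a ptree \<Rightarrow> 'a ptree \<Rightarrow> 'a ptree \<Rightarrow> bool" where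
  "nested v w S T U R \<longleftrightarrow>
     (let A = set_ptree S - {v}; B = set_ptree T - {w}; C = set_ptree U; s = root U;
          r = (id(w := s)) (root T)
      in distinct (vertices R) \<and> set_ptree R = A \<union> B \<union> C \<and>
         keep (insert r A) R = [map_ptree (id(v := r)) S] \<and>
         keep (insert s B) R = [map_ptree (id(w := s)) T] \<and> keep C R = [U] \<and>
         (\<forall>a b. (a, b) \<in> anc R \<longrightarrow> a \<in> A \<longrightarrow> b \<in> B \<union> C \<longrightarrow> (a, r) \<in> anc R) \<and>
         (\<forall>a c. (a, c) \<in> anc R \<longrightarrow> a \<in> A \<union> B \<longrightarrow> c \<in> C \<longrightarrow> (a, s) \<in> anc R))"

context
  fixes S T U :: "'a ptree" and v w :: 'a
  assumes vT: "composable (set_ptree S) v (set_ptree T)" and w: "w \<in> set_ptree T"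
    and wU: "composable (subst_set (set_ptree S) v (set_ptree T)) w (set_ptree U)"
begin

lemma nested_left_imp:
  assumes Q: "is_subst v S T Q" and R: "is_subst w Q U R"
  shows "nested v w S T U R"
proof -
  define A where "A = set_ptree S - {v}"
  define B where "B = set_ptree T - {w}"
  define C where "C = set_ptree U"
  define s where "s = root U"
  define \<rho> where "\<rho> = id(w := s)"
  define r where "r = root T"
  have setQ: "set_ptree Q = A \<union> set_ptree T"
    using is_subst_set[OF Q vT] by (simp add: A_def)
  have cQ: "composable (set_ptree Q) w (set_ptree U)"
    using wU by (simp add: setQ subst_set_def A_def)
  have w_A: "w \<notin> A"
    using vT w by (auto simp: composable_def A_def)
  have r_T: "r \<in> set_ptree T"
    by (simp add: r_def)
  note keepR = is_subst_keep_single_iff[OF R cQ, folded s_def, folded \<rho>_def]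
  note ancR = is_subst_anc_iff[OF R cQ, folded s_def, folded \<rho>_def]
  have map_S: "map_ptree \<rho> (map_ptree (id(v := r)) S) = map_ptree (id(v := \<rho> r)) S"
    unfolding ptree.map_comp using w_A by (intro ptree.map_cong) (auto simp: \<rho>_def A_def)
  have "keep (\<rho> ` insert r A) R = [map_ptree \<rho> (map_ptree (id(v := r)) S)]"
  proof (subst keepR[symmetric])
    show "insert r A \<subseteq> set_ptree Q"
      using r_T by (auto simp: setQ)
    show "set_ptree (map_ptree (id(v := r)) S) \<subseteq> set_ptree Q"
      using r_T by (auto simp: setQ ptree.set_map A_def)
  qed (use Q in \<open>simp add: is_subst_def A_def r_def\<close>)
  moreover have "\<rho> ` insert r A = insert (\<rho> r) A"
    using w_A by (auto simp: \<rho>_def)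
  ultimately have 1: "keep (insert (\<rho> r) A) R = [map_ptree (id(v := \<rho> r)) S]"
    by (simp only: map_S)
  have "keep (\<rho> ` set_ptree T) R = [map_ptree \<rho> T]"
    using Q by (subst keepR[symmetric]) (auto simp: setQ is_subst_def)
  moreover have "\<rho> ` set_ptree T = insert s B"
    using w by (auto simp: \<rho>_def B_def)
  ultimately have 2: "keep (insert s B) R = [map_ptree \<rho> T]"
    by simp
  have 3: "keep C R = [U]"
    using is_subst_keep_right[OF R cQ] by (simp add: C_def)
  have set: "set_ptree R = A \<union> B \<union> C"
    using is_subst_set[OF R cQ] w_A by (auto simp: setQ B_def C_def)
  have disj: "(A \<union> B) \<inter> C = {}"
    using cQ w_A by (auto simp: composable_def setQ B_def C_def)
  have 5: "(a, s) \<in> anc R" if "(a, c) \<in> anc R" "a \<in> A \<union> B" "c \<in> C" for a c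
    using is_subst_conn[OF R cQ that(1)] that(2,3) disj by (auto simp: s_def C_def)
  \<comment> \<open>Stated for the image of any vertex of T so that it covers \<open>w\<close> too:
    its image is \<open>s\<close>, and a vertex above U is above \<open>s\<close>.\<close>
  have conn: "(a, \<rho> r) \<in> anc R" if "(a, \<rho> b) \<in> anc R" "a \<in> A" "b \<in> set_ptree T" for a b
  proof -
    have "\<rho> a = a"
      using that(2) w_A by (auto simp: \<rho>_def)
    then have "(a, b) \<in> anc Q"
      using that ancR[of a b] by (auto simp: setQ)
    moreover have "a \<notin> set_ptree T"
      using that(2) vT by (auto simp: A_def composable_def)
    ultimately have "(a, r) \<in> anc Q"
      using is_subst_conn[OF Q vT, of a b] that(3) by (simp add: r_def)
    then show ?thesis
      using that(2) r_T \<open>\<rho> a = a\<close> ancR[of a r] by (auto simp: setQ)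
  qed
  have "(a, \<rho> r) \<in> anc R" if ab: "(a, b) \<in> anc R" "a \<in> A" "b \<in> B \<union> C" for a b
  proof (cases "b \<in> B")
    case True
    then show ?thesis
      using conn[of a b] ab by (auto simp: \<rho>_def B_def)
  next
    case False
    then have "(a, s) \<in> anc R"
      using 5[of a b] ab by auto
    then show ?thesis
      using conn[of a w] ab w by (auto simp: \<rho>_def)
  qed
  then show ?thesis
    unfolding nested_def Let_def A_def[symmetric] B_def[symmetric] C_def[symmetric] s_def[symmetric]
      \<rho>_def[symmetric] r_def[symmetric]
    using is_subst_distinct[OF R cQ] set 1 2 3 5 by blast
qed

lemma nested_imp_left:
  assumes R: "nested v w S T U R"
  shows "\<exists>Q. is_subst v S T Q \<and> is_subst w Q U R"
proof -
  define A where "A = set_ptree S - {v}"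
  define B where "B = set_ptree T - {w}"
  define C where "C = set_ptree U"
  define s where "s = root U"
  define \<rho> where "\<rho> = id(w := s)"
  define r where "r = root T"
  have R: "distinct (vertices R)" "set_ptree R = A \<union> B \<union> C"
    "keep (insert (\<rho> r) A) R = [map_ptree (id(v := \<rho> r)) S]"
    "keep (insert s B) R = [map_ptree \<rho> T]" "keep C R = [U]"
    "\<And>a b. (a, b) \<in> anc R \<Longrightarrow> a \<in> A \<Longrightarrow> b \<in> B \<union> C \<Longrightarrow> (a, \<rho> r) \<in> anc R"
    "\<And>a c. (a, c) \<in> anc R \<Longrightarrow> a \<in> A \<union> B \<Longrightarrow> c \<in> C \<Longrightarrow> (a, s) \<in> anc R"
    using R unfolding nested_def Let_def A_def[symmetric] B_def[symmetric] C_def[symmetric] s_def[symmetric]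
      \<rho>_def[symmetric] r_def[symmetric] by blast+
  define V where "V = A \<union> set_ptree T"
  have w_A: "w \<notin> A"
    using vT w by (auto simp: composable_def A_def)
  have Vw: "V - {w} = A \<union> B"
    using w_A by (auto simp: V_def B_def)
  have disj: "(A \<union> B) \<inter> C = {}"
    using wU Vw by (simp add: composable_def subst_set_def V_def A_def C_def)
  have disjA: "A \<inter> set_ptree T = {}"
    using vT by (auto simp: composable_def A_def)
  have r_T: "r \<in> set_ptree T" and s_C: "s \<in> C"
    by (simp_all add: r_def s_def C_def)
  have \<rho>r: "\<rho> r \<in> insert s B"
    using r_T by (auto simp: \<rho>_def B_def)
  have anc_S: "anc (map_ptree (id(v := \<rho> r)) S) = anc R \<inter> insert (\<rho> r) A \<times> insert (\<rho> r) A"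
    by (rule anc_keep_single) fact
  have anc_T: "anc (map_ptree \<rho> T) = anc R \<inter> insert s B \<times> insert s B"
    by (rule anc_keep_single) fact
  \<comment> \<open>The root of the copy of S in \<open>R\<close>. It is above
    \<open>\<rho> r\<close> or equal to it, and \<open>\<rho> r\<close> is the top of the copy of T,
    so \<open>x\<close> dominates all that has to survive in the intermediate tree.\<close>
  define x where "x = root (map_ptree (id(v := \<rho> r)) S)"
  have set_S: "set_ptree (map_ptree (id(v := \<rho> r)) S) = insert (\<rho> r) A"
    using vT by (auto simp: ptree.set_map A_def composable_def)
  have set_T: "set_ptree (map_ptree \<rho> T) = insert s B"
    using w by (auto simp: ptree.set_map \<rho>_def B_def)
  have x_A: "(x, y) \<in> anc R" if "y \<in> insert (\<rho> r) A" "y \<noteq> x" for y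
    using anc_root[of y "map_ptree (id(v := \<rho> r)) S"] that anc_S set_S by (auto simp: x_def simp del: root_map_ptree)
  have r_B: "(\<rho> r, y) \<in> anc R" if "y \<in> insert s B" "y \<noteq> \<rho> r" for y
    using anc_root[of y "map_ptree \<rho> T"] that anc_T set_T by (auto simp: r_def)
  have x: "x \<in> insert (\<rho> r) A"
    using root_in_set_ptree[of "map_ptree (id(v := \<rho> r)) S"] unfolding set_S x_def .
  have "\<exists>Q. set_ptree Q = V \<and> is_subst w Q U R \<and> distinct (vertices Q)"
  proof (rule is_subst_exists[where x = x])
    show "set_ptree R = subst_set V w (set_ptree U)"
      using R(2) by (simp add: subst_set_def Vw C_def)
    show "(V - {w}) \<inter> set_ptree U = {}"
      using disj by (simp add: Vw C_def)
    show "x \<in> insert (root U) (V - {w})"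
      using x \<rho>r unfolding Vw by (auto simp: s_def)
    show "(x, y) \<in> anc R" if "y \<in> insert (root U) (V - {w})" "y \<noteq> x" for y
    proof (cases "y \<in> insert s B \<and> y \<noteq> \<rho> r")
      case True
      then show ?thesis
        using r_B[of y] x_A[of "\<rho> r"] anc_trans[OF R(1)] by (cases "x = \<rho> r") auto
    next
      case False
      then show ?thesis
        using that x_A[of y] unfolding Vw by (auto simp: s_def)
    qed
    show "(a, root U) \<in> anc R" if "(a, b) \<in> anc R" "b \<in> set_ptree U" "a \<notin> set_ptree U" for a b
      using R(7)[of a b] that ancD[OF that(1)] by (auto simp: R(2) C_def s_def)
  qed (use R(1,5) w in \<open>auto simp: V_def C_def\<close>)
  then obtain Q where Q: "set_ptree Q = V" "is_subst w Q U R" "distinct (vertices Q)"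
    by blast
  have cQ: "composable (set_ptree Q) w (set_ptree U)"
    using wU by (simp add: Q(1) V_def subst_set_def A_def)
  note keepR = is_subst_keep_single_iff[OF Q(2) cQ, folded s_def, folded \<rho>_def]
  note ancR = is_subst_anc_iff[OF Q(2) cQ, folded s_def, folded \<rho>_def]
  have "is_subst v S T Q"
    unfolding is_subst_def r_def[symmetric] A_def[symmetric]
  proof (intro conjI allI impI)
    show "set_ptree Q = subst_set (set_ptree S) v (set_ptree T)"
      by (simp add: Q(1) V_def subst_set_def A_def)
    have "map_ptree \<rho> (map_ptree (id(v := r)) S) = map_ptree (id(v := \<rho> r)) S"
      unfolding ptree.map_comp using w_A by (intro ptree.map_cong) (auto simp: \<rho>_def A_def)
    moreover have "\<rho> ` insert r A = insert (\<rho> r) A"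
      using w_A by (auto simp: \<rho>_def)
    ultimately show "keep (insert r A) Q = [map_ptree (id(v := r)) S]"
      using R(3) r_T by (subst keepR) (auto simp: Q(1) V_def A_def ptree.set_map)
    have "\<rho> ` set_ptree T = insert s B"
      using w by (auto simp: \<rho>_def B_def)
    then show "keep (set_ptree T) Q = [T]"
      using R(4) by (subst keepR) (auto simp: Q(1) V_def)
    fix a b assume ab: "(a, b) \<in> anc Q" "b \<in> set_ptree T" "a \<notin> set_ptree T"
    then have a: "a \<in> A"
      using ancD[OF ab(1)] by (auto simp: Q(1) V_def)
    then have \<rho>a: "\<rho> a = a"
      using w_A by (auto simp: \<rho>_def)
    have "\<rho> b \<in> B \<union> C"
      using ab(2) s_C by (auto simp: \<rho>_def B_def)
    then have "(a, \<rho> r) \<in> anc R"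
      using R(6)[OF _ a, of "\<rho> b"] ancR[of a b] ancD[OF ab(1)] ab(1) by (simp add: \<rho>a)
    then show "(a, r) \<in> anc Q"
      using ancR[of a r] a r_T by (simp add: Q(1) V_def \<rho>a)
  qed fact
  then show ?thesis
    using Q(2) by blast
qed

lemma nested_iff_left: "nested v w S T U R \<longleftrightarrow> (\<exists>Q. is_subst v S T Q \<and> is_subst w Q U R)"
  using nested_left_imp nested_imp_left by blast

text \<open>When T and U are composed first, the intermediate tree is a restriction of
  \<open>R\<close> to the vertices from T and U instead of a contraction.\<close>

lemma nested_iff_right: "nested v w S T U R \<longleftrightarrow> (\<exists>Q. is_subst w T U Q \<and> is_subst v S Q R)"
proof -
  define A where "A = set_ptree S - {v}"
  define B where "B = set_ptree T - {w}"
  define C where "C = set_ptree U"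
  define s where "s = root U"
  define r where "r = (id(w := s)) (root T)"
  have w_A: "w \<notin> A"
    using vT w by (auto simp: composable_def A_def)
  have cTU: "composable (set_ptree T) w (set_ptree U)"
    using wU vT w by (auto simp: composable_def subst_set_def)
  have disj: "(A \<union> B) \<inter> C = {}"
    using wU w_A by (auto simp: composable_def subst_set_def A_def B_def C_def)
  have disjA: "A \<inter> set_ptree T = {}"
    using vT by (auto simp: composable_def A_def)
  have s_C: "s \<in> C"
    by (simp add: s_def C_def)
  have r_B: "r \<in> insert s B"
    by (auto simp: r_def B_def)
  have set_T: "set_ptree (map_ptree (id(w := s)) T) = insert s B"
    using w by (auto simp: ptree.set_map B_def)
  show ?thesis
  proof
    assume "nested v w S T U R"
    then have R: "distinct (vertices R)" "set_ptree R = A \<union> B \<union> C"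
      "keep (insert r A) R = [map_ptree (id(v := r)) S]"
      "keep (insert s B) R = [map_ptree (id(w := s)) T]" "keep C R = [U]"
      "\<And>a b. (a, b) \<in> anc R \<Longrightarrow> a \<in> A \<Longrightarrow> b \<in> B \<union> C \<Longrightarrow> (a, r) \<in> anc R"
      "\<And>a c. (a, c) \<in> anc R \<Longrightarrow> a \<in> A \<union> B \<Longrightarrow> c \<in> C \<Longrightarrow> (a, s) \<in> anc R"
      unfolding nested_def Let_def A_def[symmetric] B_def[symmetric] C_def[symmetric] s_def[symmetric]
        r_def[symmetric] by blast+
    have anc_T: "anc (map_ptree (id(w := s)) T) = anc R \<inter> insert s B \<times> insert s B"
      by (rule anc_keep_single) fact
    have anc_U: "anc U = anc R \<inter> C \<times> C"
      by (rule anc_keep_single) fact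
    have rB: "(r, y) \<in> anc R" if "y \<in> insert s B" "y \<noteq> r" for y
      using anc_root[of y "map_ptree (id(w := s)) T"] that anc_T set_T by (auto simp: r_def)
    have sC: "(s, y) \<in> anc R" if "y \<in> C" "y \<noteq> s" for y
      using anc_root[of y U] that anc_U by (auto simp: s_def C_def)
    \<comment> \<open>One tree remains since \<open>r\<close> is above the copy of T, which contains
      \<open>s\<close>, and \<open>s\<close> is above U.\<close>
    obtain Q where Q: "keep (B \<union> C) R = [Q]" "root Q = r"
    proof -
      have "\<exists>Q. keep (B \<union> C) R = [Q] \<and> root Q = r"
      proof (rule keep_single[OF R(1)])
        show "r \<in> (B \<union> C) \<inter> set_ptree R"
          using r_B s_C by (auto simp: R(2))
        fix y assume y: "y \<in> (B \<union> C) \<inter> set_ptree R" "y \<noteq> r"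
        show "(r, y) \<in> anc R"
        proof (cases "y \<in> insert s B")
          case False
          then have "(s, y) \<in> anc R"
            using y sC by auto
          then show ?thesis
            using rB[of s] anc_trans[OF R(1)] by (cases "s = r") auto
        qed (use rB y in auto)
      qed
      then show thesis
        using that by blast
    qed
    have setQ: "set_ptree Q = B \<union> C"
      using set_keep_single[OF Q(1)] R(2) by auto
    have ancQ: "anc Q = anc R \<inter> (B \<union> C) \<times> (B \<union> C)"
      by (rule anc_keep_single) fact
    have "is_subst w T U Q"
      unfolding is_subst_def s_def[symmetric] B_def[symmetric] C_def[symmetric]
    proof (intro conjI allI impI)
      show "distinct (vertices Q)"
        by (rule distinct_keep_single[OF Q(1) R(1)])
      show "set_ptree Q = subst_set (set_ptree T) w C"
        by (simp add: setQ subst_set_def B_def)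
      have "insert s B \<inter> (B \<union> C) = insert s B" "C \<inter> (B \<union> C) = C"
        using s_C by auto
      then show "keep (insert s B) Q = [map_ptree (id(w := s)) T]" "keep C Q = [U]"
        using R(4,5) by (simp_all add: keep_keep[OF Q(1)])
      fix a b assume "(a, b) \<in> anc Q" "b \<in> C" "a \<notin> C"
      then show "(a, s) \<in> anc Q"
        using R(7)[of a b] s_C by (auto simp: ancQ)
    qed
    moreover have "is_subst v S Q R"
      unfolding is_subst_def Q(2) A_def[symmetric] setQ
    proof (intro conjI allI impI)
      show "set_ptree R = subst_set (set_ptree S) v (B \<union> C)"
        by (simp add: R(2) subst_set_def A_def Un_assoc)
      fix a b assume ab: "(a, b) \<in> anc R" "b \<in> B \<union> C" "a \<notin> B \<union> C"
      then show "(a, r) \<in> anc R"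
        using R(6)[of a b] ancD[OF ab(1)] by (auto simp: R(2))
    qed (fact R Q)+
    ultimately show "\<exists>Q. is_subst w T U Q \<and> is_subst v S Q R"
      by blast
  next
    assume "\<exists>Q. is_subst w T U Q \<and> is_subst v S Q R"
    then obtain Q where Q: "is_subst w T U Q" and R: "is_subst v S Q R"
      by blast
    have setQ: "set_ptree Q = B \<union> C"
      using is_subst_set[OF Q cTU] by (simp add: B_def C_def)
    have disjQ: "A \<inter> (B \<union> C) = {}"
      using disj disjA by (auto simp: B_def)
    have cQ: "composable (set_ptree S) v (set_ptree Q)"
      using vT disjQ s_C by (auto simp: composable_def setQ A_def C_def B_def)
    have root: "root Q = r"
      using root_is_subst[OF Q cTU] by (simp add: r_def s_def)
    have kQ: "keep (B \<union> C) R = [Q]"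
      using is_subst_keep_right[OF R cQ] by (simp add: setQ)
    have ancQ: "anc Q = anc R \<inter> (B \<union> C) \<times> (B \<union> C)"
      by (rule anc_keep_single) fact
    have 6: "(a, r) \<in> anc R" if "(a, b) \<in> anc R" "a \<in> A" "b \<in> B \<union> C" for a b
      using is_subst_conn[OF R cQ that(1)] that(2,3) disjQ by (auto simp: setQ root)
    have dR: "distinct (vertices R)"
      by (rule is_subst_distinct[OF R cQ])
    have anc_T: "anc (map_ptree (id(w := s)) T) = anc Q \<inter> insert s B \<times> insert s B"
      using Q by (intro anc_keep_single) (simp add: is_subst_def s_def B_def)
    \<comment> \<open>A vertex of S above U is first seen to be above \<open>r\<close>; this carries
      it on to \<open>s\<close>.\<close>
    have rs: "r = s \<or> (r, s) \<in> anc R"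
      using anc_root[of s Q] by (auto simp: setQ s_C root ancQ)
    show "nested v w S T U R"
      unfolding nested_def Let_def A_def[symmetric] B_def[symmetric] C_def[symmetric] s_def[symmetric]
        r_def[symmetric]
    proof (intro conjI allI impI)
      show "distinct (vertices R)"
        by fact
      show "set_ptree R = A \<union> B \<union> C"
        using is_subst_set[OF R cQ] by (auto simp: setQ A_def)
      show "keep (insert r A) R = [map_ptree (id(v := r)) S]"
        using R by (simp add: is_subst_def root A_def)
      have "insert s B \<inter> (B \<union> C) = insert s B" "C \<inter> (B \<union> C) = C"
        using s_C by auto
      then have "keep (insert s B) R = keep (insert s B) Q" "keep C R = keep C Q"
        by (simp_all add: keep_keep[OF kQ])
      then show "keep (insert s B) R = [map_ptree (id(w := s)) T]" "keep C R = [U]"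
        using Q by (simp_all add: is_subst_def s_def B_def C_def)
    next
      fix a c assume ac: "(a, c) \<in> anc R" "a \<in> A \<union> B" "c \<in> C"
      show "(a, s) \<in> anc R"
      proof (cases "a \<in> A")
        case True
        then show ?thesis
          using 6[OF ac(1)] ac(3) rs anc_trans[OF dR] by blast
      next
        case False
        then have "(a, c) \<in> anc Q"
          using ac by (auto simp: ancQ)
        moreover have "a \<notin> C"
          using ac(2) disj by auto
        ultimately have "(a, s) \<in> anc Q"
          using is_subst_conn[OF Q cTU] ac(3) by (simp add: C_def s_def)
        then show ?thesis
          by (simp add: ancQ)
      qed
    qed (rule 6)
  qed
qed

end

text \<open>Symmetric in the two insertions, so it suffices to compare one order with it. The
  conditions on ancestors also concern vertices of the other inserted tree, since T may end up below
  U or the reverse.\<close>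

definition disjoint_subst :: "'a \<Rightarrow> 'a \<Rightarrow> 'a ptree \<Rightarrow> 'a ptree \<Rightarrow> 'a ptree \<Rightarrow> 'a ptree \<Rightarrow> bool" where
  "disjoint_subst v w S T U R \<longleftrightarrow>
     (let A = set_ptree S - {v, w}; B = set_ptree T; C = set_ptree U; r = root T; s = root U
      in distinct (vertices R) \<and> set_ptree R = A \<union> B \<union> C \<and>
         keep (insert r (insert s A)) R = [map_ptree (id(v := r, w := s)) S] \<and>
         keep B R = [T] \<and> keep C R = [U] \<and>
         (\<forall>a b. (a, b) \<in> anc R \<longrightarrow> a \<notin> B \<longrightarrow> b \<in> B \<longrightarrow> (a, r) \<in> anc R) \<and>
         (\<forall>a c. (a, c) \<in> anc R \<longrightarrow> a \<notin> C \<longrightarrow> c \<in> C \<longrightarrow> (a, s) \<in> anc R))"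

lemma disjoint_subst_commute:
  assumes "v \<noteq> w"
  shows "disjoint_subst v w S T U R \<longleftrightarrow> disjoint_subst w v S U T R"
  using assms unfolding disjoint_subst_def Let_def
  by (simp add: insert_commute Un_ac fun_upd_twist conj_ac)

context
  fixes S T U :: "'a ptree" and v w :: 'a
  assumes vT: "composable (set_ptree S) v (set_ptree T)"
    and wU: "composable (set_ptree S) w (set_ptree U)"
    and vw: "v \<noteq> w" and TU: "set_ptree T \<inter> set_ptree U = {}"
begin

lemma disjoint_subst_iff: "disjoint_subst v w S T U R \<longleftrightarrow> (\<exists>Q. is_subst v S T Q \<and> is_subst w Q U R)"
proof -
  define A where "A = set_ptree S - {v, w}"
  define B where "B = set_ptree T"
  define C where "C = set_ptree U"
  define s where "s = root U"
  define \<rho> where "\<rho> = id(w := s)"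
  define r where "r = root T"
  define V where "V = insert w A \<union> B"
  have Sv: "set_ptree S - {v} = insert w A" "set_ptree S - {w} = insert v A"
    using vT wU vw by (auto simp: A_def composable_def)
  have r: "r \<in> B" and s: "s \<in> C"
    by (simp_all add: r_def s_def B_def C_def)
  have wB: "w \<notin> B" and vC: "v \<notin> C" and AB: "A \<inter> B = {}" and AC: "A \<inter> C = {}"
    using vT wU Sv by (auto simp: composable_def B_def C_def)
  have BC: "B \<inter> C = {}"
    using TU by (simp add: B_def C_def)
  have wA: "w \<notin> A"
    by (simp add: A_def)
  have sV: "s \<notin> A \<union> B"
    using s AC BC by auto
  have Vw: "V - {w} = A \<union> B"
    using wB wA by (auto simp: V_def)
  have V: "V = subst_set (set_ptree S) v (set_ptree T)"
    by (simp add: V_def subst_set_def Sv B_def)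
  have cV: "composable V w (set_ptree U)"
    using vT wU AC BC unfolding composable_def Vw by (auto simp: V_def C_def B_def A_def)
  have \<rho>A: "\<rho> ` insert r (insert w A) = insert r (insert s A)" and \<rho>B: "\<rho> ` B = B"
    using wB wA r by (auto simp: \<rho>_def image_iff)
  have map_S: "map_ptree \<rho> (map_ptree (id(v := r)) S) = map_ptree (id(v := r, w := s)) S"
    unfolding ptree.map_comp using wB r vw by (intro ptree.map_cong) (auto simp: \<rho>_def)
  have map_T: "map_ptree \<rho> T = T"
    unfolding \<rho>_def using wB by (intro map_ptree_upd_notin) (simp add: B_def)
  have subs: "insert r (insert w A) \<subseteq> V" "B \<subseteq> V" "set_ptree (map_ptree (id(v := r)) S) \<subseteq> V"
    "set_ptree T \<subseteq> V"
    using r by (auto simp: V_def B_def A_def ptree.set_map)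
  show ?thesis
  proof
    assume "\<exists>Q. is_subst v S T Q \<and> is_subst w Q U R"
    then obtain Q where Q: "is_subst v S T Q" and R: "is_subst w Q U R"
      by blast
    have setQ: "set_ptree Q = V"
      using Q by (simp add: is_subst_def V)
    have cQ: "composable (set_ptree Q) w (set_ptree U)"
      using cV by (simp add: setQ)
    note keepR = is_subst_keep_single_iff[OF R cQ, folded s_def, folded \<rho>_def, unfolded setQ]
    note ancR = is_subst_anc_iff[OF R cQ, folded s_def, folded \<rho>_def, unfolded setQ]
    have dR: "distinct (vertices R)"
      by (rule is_subst_distinct[OF R cQ])
    have setR: "set_ptree R = A \<union> B \<union> C"
      using is_subst_set[OF R cQ] by (simp add: setQ Vw C_def)
    have 1: "keep (insert r (insert s A)) R = [map_ptree (id(v := r, w := s)) S]"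
      using Q keepR[OF subs(1,3)] unfolding \<rho>A map_S by (simp add: is_subst_def r_def Sv)
    have 2: "keep B R = [T]"
      using Q keepR[OF subs(2,4)] unfolding \<rho>B map_T by (simp add: is_subst_def B_def)
    have 3: "keep C R = [U]"
      using is_subst_keep_right[OF R cQ] by (simp add: C_def)
    have 5: "(a, s) \<in> anc R" if "(a, c) \<in> anc R" "a \<notin> C" "c \<in> C" for a c
      using is_subst_conn[OF R cQ that(1)] that(2,3) by (simp add: C_def s_def)
    have conn: "(\<rho> a, r) \<in> anc R" if "(\<rho> a, b) \<in> anc R" "a \<in> insert w A" "b \<in> B" for a b
    proof -
      have "\<rho> b = b" "\<rho> r = r"
        using that(3) wB r by (auto simp: \<rho>_def)
      then have "(a, b) \<in> anc Q"
        using that ancR[of a b] by (auto simp: V_def)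
      moreover have "a \<notin> set_ptree T"
        using that(2) wB AB by (auto simp: B_def)
      ultimately have "(a, r) \<in> anc Q"
        using is_subst_conn[OF Q vT, of a b] that(3) by (simp add: r_def B_def)
      then show ?thesis
        using ancR[of a r] that(2) r \<open>\<rho> r = r\<close> by (auto simp: V_def)
    qed
    have root_B: "b = r \<or> (r, b) \<in> anc R" if "b \<in> B" for b
      using anc_root[of b T] anc_keep_single[OF 2] that by (auto simp: r_def B_def)
    have root_C: "c = s \<or> (s, c) \<in> anc R" if "c \<in> C" for c
      using anc_root[of c U] anc_keep_single[OF 3] that by (auto simp: s_def C_def)
    have "(a, r) \<in> anc R" if ab: "(a, b) \<in> anc R" "a \<notin> B" "b \<in> B" for a b
    proof (cases "a \<in> A")
      case True
      then have "\<rho> a = a"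
        using wA by (auto simp: \<rho>_def)
      then show ?thesis
        using conn[of a b] ab True by simp
    next
      case False
      \<comment> \<open>Here \<open>a\<close> in U is above \<open>b\<close> in T. Then
        \<open>s\<close> is above \<open>b\<close>, so \<open>w\<close> is above \<open>b\<close> in
        the intermediate tree and hence above \<open>r\<close>; in \<open>R\<close> therefore
        \<open>s\<close> is above \<open>r\<close>. Both \<open>a\<close> and \<open>r\<close> lie
        on the path to \<open>b\<close> (or \<open>r\<close> is \<open>b\<close>); were
        \<open>r\<close> above \<open>a\<close>, it would be above \<open>s\<close>, a
        contradiction.\<close>
      then have a: "a \<in> C"
        using ab ancD[OF ab(1)] by (auto simp: setR)
      then have "(s, b) \<in> anc R"
        using root_C[OF a] ab(1) anc_trans[OF dR] by blast
      then have sr: "(s, r) \<in> anc R"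
        using conn[of w b] ab(3) by (simp add: \<rho>_def)
      have "(r, a) \<notin> anc R"
      proof
        assume "(r, a) \<in> anc R"
        then have "(r, s) \<in> anc R"
          using a r BC by (intro 5) auto
        then show False
          using sr anc_trans[OF dR] anc_irrefl[OF dR] by blast
      qed
      moreover have "a \<noteq> r"
        using ab(2) r by auto
      ultimately show ?thesis
        using root_B[OF ab(3)] ab(1) anc_chain[OF dR, of a b r] by blast
    qed
    then show "disjoint_subst v w S T U R"
      unfolding disjoint_subst_def Let_def A_def[symmetric] B_def[symmetric] C_def[symmetric]
        s_def[symmetric] r_def[symmetric]
      using dR setR 1 2 3 5 by blast
  next
    assume "disjoint_subst v w S T U R"
    then have R: "distinct (vertices R)" "set_ptree R = A \<union> B \<union> C"
      "keep (insert r (insert s A)) R = [map_ptree (id(v := r, w := s)) S]"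
      "keep B R = [T]" "keep C R = [U]"
      "\<And>a b. (a, b) \<in> anc R \<Longrightarrow> a \<notin> B \<Longrightarrow> b \<in> B \<Longrightarrow> (a, r) \<in> anc R"
      "\<And>a c. (a, c) \<in> anc R \<Longrightarrow> a \<notin> C \<Longrightarrow> c \<in> C \<Longrightarrow> (a, s) \<in> anc R"
      unfolding disjoint_subst_def Let_def A_def[symmetric] B_def[symmetric] C_def[symmetric]
        s_def[symmetric] r_def[symmetric] by blast+
    define S' where "S' = map_ptree (id(v := r, w := s)) S"
    define x where "x = root S'"
    have set_S': "set_ptree S' = insert r (insert s A)"
      using vT wU vw by (auto simp: S'_def ptree.set_map A_def composable_def)
    have x: "x \<in> insert r (insert s A)"
      unfolding set_S'[symmetric] x_def by simp
    have x_A: "(x, y) \<in> anc R" if "y \<in> insert r (insert s A)" "y \<noteq> x" for y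
      using anc_root[of y S'] that anc_keep_single[OF R(3)] set_S' by (auto simp: x_def S'_def[symmetric])
    have r_B: "(r, y) \<in> anc R" if "y \<in> B" "y \<noteq> r" for y
      using anc_root[of y T] that anc_keep_single[OF R(4)] by (auto simp: r_def B_def)
    have "\<exists>Q. set_ptree Q = V \<and> is_subst w Q U R \<and> distinct (vertices Q)"
    proof (rule is_subst_exists[where x = x])
      show "set_ptree R = subst_set V w (set_ptree U)"
        using R(2) by (simp add: subst_set_def Vw C_def)
      show "(V - {w}) \<inter> set_ptree U = {}"
        using cV by (simp add: composable_def)
      show "x \<in> insert (root U) (V - {w})"
        using x r unfolding Vw by (auto simp: s_def)
      show "(x, y) \<in> anc R" if "y \<in> insert (root U) (V - {w})" "y \<noteq> x" for y
      proof (cases "y \<in> B \<and> y \<noteq> r")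
        case True
        then show ?thesis
          using r_B[of y] x_A[of r] anc_trans[OF R(1)] by (cases "x = r") auto
      next
        case False
        then show ?thesis
          using that x_A[of y] unfolding Vw by (auto simp: s_def)
      qed
      show "(a, root U) \<in> anc R" if "(a, b) \<in> anc R" "b \<in> set_ptree U" "a \<notin> set_ptree U" for a b
        using R(7)[of a b] that by (auto simp: C_def s_def)
    qed (use R(1,5) in \<open>auto simp: V_def C_def\<close>)
    then obtain Q where Q: "set_ptree Q = V" "is_subst w Q U R" "distinct (vertices Q)"
      by blast
    have cQ: "composable (set_ptree Q) w (set_ptree U)"
      using cV by (simp add: Q(1))
    note keepR = is_subst_keep_single_iff[OF Q(2) cQ, folded s_def, folded \<rho>_def, unfolded Q(1)]
    note ancR = is_subst_anc_iff[OF Q(2) cQ, folded s_def, folded \<rho>_def, unfolded Q(1)]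
    have "is_subst v S T Q"
      unfolding is_subst_def r_def[symmetric] Sv
    proof (intro conjI allI impI)
      show "set_ptree Q = subst_set (set_ptree S) v (set_ptree T)"
        by (simp add: Q(1) V)
      show "keep (insert r (insert w A)) Q = [map_ptree (id(v := r)) S]"
        using R(3) keepR[OF subs(1,3)] unfolding \<rho>A map_S by blast
      show "keep (set_ptree T) Q = [T]"
        using R(4) keepR[OF subs(2,4)] unfolding \<rho>B map_T by (simp add: B_def)
      fix a b assume ab: "(a, b) \<in> anc Q" "b \<in> set_ptree T" "a \<notin> set_ptree T"
      have mem: "a \<in> V" "b \<in> V"
        using ancD[OF ab(1)] by (simp_all add: Q(1))
      have "\<rho> b = b" "\<rho> r = r"
        using ab(2) wB r by (auto simp: \<rho>_def B_def)
      moreover have "\<rho> a \<notin> B"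
        using ab(3) s BC by (auto simp: \<rho>_def B_def)
      ultimately have "(\<rho> a, r) \<in> anc R"
        using R(6)[of "\<rho> a" b] ancR[OF mem] ab by (auto simp: B_def)
      then show "(a, r) \<in> anc Q"
        using ancR[of a r] mem r \<open>\<rho> r = r\<close> by (auto simp: V_def)
    qed fact
    then show "\<exists>Q. is_subst v S T Q \<and> is_subst w Q U R"
      using Q(2) by blast
  qed
qed

end

text \<open>The relabelling of the result is \<open>\<sigma>\<close> on what remains of S and
  \<open>\<tau>\<close> on T. Being injective on \<open>R\<close>, it carries deletions and
  ancestors along unchanged.\<close>

lemma is_subst_relabel:
  assumes R: "is_subst v S T R" and comp: "composable (set_ptree S) v (set_ptree T)"
    and \<rho>: "inj_on \<rho> (set_ptree R)" "\<And>x. x \<in> set_ptree S - {v} \<Longrightarrow> \<rho> x = \<sigma> x"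
      "\<And>x. x \<in> set_ptree T \<Longrightarrow> \<rho> x = \<tau> x" and \<sigma>: "inj_on \<sigma> (set_ptree S)"
  shows "is_subst (\<sigma> v) (map_ptree \<sigma> S) (map_ptree \<tau> T) (map_ptree \<rho> R)"
proof -
  let ?A = "set_ptree S - {v}" and ?B = "set_ptree T"
  note setR = is_subst_set[OF R comp]
  have v: "v \<in> set_ptree S"
    using comp by (simp add: composable_def)
  have A: "set_ptree (map_ptree \<sigma> S) - {\<sigma> v} = \<rho> ` ?A"
    using \<sigma> v \<rho>(2) by (auto simp: ptree.set_map dest: inj_onD intro: rev_image_eqI)
  have B: "set_ptree (map_ptree \<tau> T) = \<rho> ` ?B"
    using \<rho>(3) by (auto simp: ptree.set_map)
  have T: "map_ptree \<tau> T = map_ptree \<rho> T"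
    using \<rho>(3) by (intro ptree.map_cong) auto
  have anc: "anc (map_ptree \<rho> R) = map_prod \<rho> \<rho> ` anc R"
    by (rule anc_map_ptree)
  show ?thesis
    unfolding is_subst_def subst_set_def A B root_map_ptree
  proof (intro conjI allI impI)
    show "distinct (vertices (map_ptree \<rho> R))"
      using is_subst_distinct[OF R comp] \<rho>(1) by (simp add: vertices_map_ptree distinct_map)
    show "set_ptree (map_ptree \<rho> R) = \<rho> ` ?A \<union> \<rho> ` ?B"
      by (simp add: ptree.set_map setR image_Un)
    have "insert (\<tau> (root T)) (\<rho> ` ?A) = \<rho> ` insert (root T) ?A"
      by (simp add: \<rho>(3))
    moreover have "keep (\<rho> ` insert (root T) ?A) (map_ptree \<rho> R) = [map_ptree \<rho> (map_ptree (id(v := root T)) S)]"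
      using R by (subst keep_image_map_ptree[OF \<rho>(1)]) (auto simp: setR is_subst_def)
    moreover have "map_ptree \<rho> (map_ptree (id(v := root T)) S) =
        map_ptree (id(\<sigma> v := \<tau> (root T))) (map_ptree \<sigma> S)"
      unfolding ptree.map_comp using \<rho>(2,3) \<sigma> v by (intro ptree.map_cong) (auto dest: inj_onD)
    ultimately show "keep (insert (\<tau> (root T)) (\<rho> ` ?A)) (map_ptree \<rho> R) =
        [map_ptree (id(\<sigma> v := \<tau> (root T))) (map_ptree \<sigma> S)]"
      by simp
    show "keep (\<rho> ` ?B) (map_ptree \<rho> R) = [map_ptree \<tau> T]"
      using is_subst_keep_right[OF R comp] by (subst keep_image_map_ptree[OF \<rho>(1)]) (auto simp: setR T)
    fix a b assume ab: "(a, b) \<in> anc (map_ptree \<rho> R)" "b \<in> \<rho> ` ?B" "a \<notin> \<rho> ` ?B"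
    then obtain a' b' where *: "(a', b') \<in> anc R" "a = \<rho> a'" "b = \<rho> b'"
      unfolding anc by auto
    obtain b'' where "b'' \<in> ?B" "b = \<rho> b''"
      using ab(2) by blast
    then have "b' \<in> ?B"
      using \<rho>(1) * ancD[OF *(1)] setR by (metis UnI2 inj_onD)
    moreover have "a' \<notin> ?B"
      using ab(3) * by auto
    ultimately have "(a', root T) \<in> anc R"
      using is_subst_conn[OF R comp *(1)] by simp
    then have "(\<rho> a', \<rho> (root T)) \<in> anc (map_ptree \<rho> R)"
      unfolding anc by force
    then show "(a, \<tau> (root T)) \<in> anc (map_ptree \<rho> R)"
      using * \<rho>(3) by simp
  qed
qed

lemma energy_map_ptree:
  assumes "distinct (vertices t)" "inj_on \<rho> (set_ptree t)"
  shows "energy W (map_ptree \<rho> t) = energy (W \<circ> \<rho>) t"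
proof -
  have "distinct (vertices (map_ptree \<rho> t))"
    using assms by (simp add: vertices_map_ptree distinct_map)
  then have "energy W (map_ptree \<rho> t) = (\<Sum>(x, y)\<in>map_prod \<rho> \<rho> ` anc t. W y)"
    by (simp add: energy_eq_sum_anc anc_map_ptree)
  also have "\<dots> = (\<Sum>(x, y)\<in>anc t. (W \<circ> \<rho>) y)"
  proof (subst sum.reindex)
    show "inj_on (map_prod \<rho> \<rho>) (anc t)"
      using assms(2) anc_subset[of t] by (blast intro: inj_on_subset map_prod_inj_on)
  qed (auto intro!: sum.cong)
  finally show ?thesis
    using assms(1) by (simp add: energy_eq_sum_anc)
qed

lemma energy_cong: "(\<And>x. x \<in> set_ptree t \<Longrightarrow> W x = X x) \<Longrightarrow> energy W t = energy X t"
  by (simp add: energy_def)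


section \<open>Linear extension\<close>

lemma lookup_scale_pm [simp]: "Poly_Mapping.lookup (scale_pm c p) x = c * Poly_Mapping.lookup p x"
  by (simp add: scale_pm_def Poly_Mapping.map.rep_eq when_def)

lemma scale_pm_single [simp]: "scale_pm c (Poly_Mapping.single x d) = Poly_Mapping.single x (c * d)"
  by (rule poly_mapping_eqI) (simp add: lookup_single when_def)

interpretation pm: vector_space scale_pm
  by unfold_locales (auto intro!: poly_mapping_eqI simp: lookup_add algebra_simps)

text \<open>Linear extension from the basis. Compositions become nested \<open>lin\<close> terms
  that \<open>lin_lin\<close> and \<open>lin_swap\<close> rearrange without looking at supports, so
  an identity need only be shown on basis trees.\<close>

definition lin :: "('b \<Rightarrow> 'c \<Rightarrow>\<^sub>0 'k) \<Rightarrow> ('b \<Rightarrow>\<^sub>0 'k) \<Rightarrow> ('c \<Rightarrow>\<^sub>0 'k::field)" where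
  "lin h p = (\<Sum>x\<in>Poly_Mapping.keys p. scale_pm (Poly_Mapping.lookup p x) (h x))"

lemma lin_superset:
  assumes "finite X" "Poly_Mapping.keys p \<subseteq> X"
  shows "lin h p = (\<Sum>x\<in>X. scale_pm (Poly_Mapping.lookup p x) (h x))"
  unfolding lin_def using assms by (intro sum.mono_neutral_left) (auto simp: in_keys_iff)

lemma lin_zero [simp]: "lin h 0 = 0"
  by (simp add: lin_def)

lemma lin_add: "lin h (p + q) = lin h p + lin h q"
proof -
  let ?X = "Poly_Mapping.keys p \<union> Poly_Mapping.keys q"
  have "finite ?X" "Poly_Mapping.keys (p + q) \<subseteq> ?X"
    using Poly_Mapping.keys_add[of p q] by auto
  then show ?thesis
    by (simp add: lin_superset[of ?X] lookup_add pm.scale_left_distrib sum.distrib)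
qed

lemma lin_scale: "lin h (scale_pm c p) = scale_pm c (lin h p)"
proof -
  have "Poly_Mapping.keys (scale_pm c p) \<subseteq> Poly_Mapping.keys p"
    by (auto simp: in_keys_iff)
  then have "lin h (scale_pm c p) =
      (\<Sum>x\<in>Poly_Mapping.keys p. scale_pm (Poly_Mapping.lookup (scale_pm c p) x) (h x))"
    by (intro lin_superset) auto
  also have "\<dots> = scale_pm c (lin h p)"
    by (simp add: lin_def pm.scale_sum_right)
  finally show ?thesis .
qed

lemma lin_sum: "lin h (sum f I) = (\<Sum>i\<in>I. lin h (f i))"
  by (induction I rule: infinite_finite_induct) (auto simp: lin_add)

lemma lin_single [simp]: "lin h (Poly_Mapping.single x c) = scale_pm c (h x)"
  using lin_superset[of "{x}" "Poly_Mapping.single x c" h] by simp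

lemma lin_cong: "(\<And>x. x \<in> Poly_Mapping.keys p \<Longrightarrow> h x = k x) \<Longrightarrow> lin h p = lin k p"
  by (auto simp: lin_def intro!: sum.cong)

lemma lin_lin: "lin h (lin k p) = lin (\<lambda>x. lin h (k x)) p"
  unfolding lin_def[of k p] lin_sum lin_scale by (simp add: lin_def)

lemma lin_swap: "lin (\<lambda>x. lin (\<lambda>y. h x y) q) p = lin (\<lambda>y. lin (\<lambda>x. h x y) p) q"
  unfolding lin_def pm.scale_sum_right
  by (subst sum.swap) (auto intro!: sum.cong simp: pm.scale_scale mult.commute)

lemma lin_fun_add: "lin (\<lambda>x. h x + k x) p = lin h p + lin k p"
  by (simp add: lin_def pm.scale_right_distrib sum.distrib)

lemma lin_fun_scale: "lin (\<lambda>x. scale_pm c (h x)) p = scale_pm c (lin h p)"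
  by (simp add: lin_def pm.scale_sum_right mult.commute)

lemma lin_single_id [simp]: "lin (\<lambda>x. Poly_Mapping.single x 1) p = p"
proof -
  have "(\<Sum>x\<in>Poly_Mapping.keys p. Poly_Mapping.lookup (Poly_Mapping.single x (Poly_Mapping.lookup p x)) y) =
      Poly_Mapping.lookup p y" for y
    by (simp add: lookup_single when_def in_keys_iff)
  then show ?thesis
    by (intro poly_mapping_eqI) (simp add: lin_def lookup_sum)
qed

section \<open>Linear extension of \<open>diamond\<close> and iterated compositions\<close>

lemma mem_tree_piece: "p \<in> tree_piece A W \<longleftrightarrow> Poly_Mapping.keys p \<subseteq> {T. labelled_by A T}"
  by (auto simp: tree_piece_def)

lemma tree_piece_subspace: "pm.subspace (tree_piece A W)"
proof (rule pm.subspaceI)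
  show "p + q \<in> tree_piece A W" if "p \<in> tree_piece A W" "q \<in> tree_piece A W" for p q
    using that Poly_Mapping.keys_add[of p q] by (auto simp: mem_tree_piece)
  show "scale_pm c p \<in> tree_piece A W" if "p \<in> tree_piece A W" for p c
    using that by (auto simp: mem_tree_piece in_keys_iff)
qed (simp add: mem_tree_piece)

lemma lin_mem_tree_piece:
  assumes "\<And>x. x \<in> Poly_Mapping.keys p \<Longrightarrow> h x \<in> tree_piece A W"
  shows "lin h p \<in> tree_piece A W"
  unfolding lin_def using assms tree_piece_subspace
  by (intro pm.subspace_sum) (auto intro: pm.subspace_scale)

lemma single_mem_tree_piece: "labelled_by A T \<Longrightarrow> Poly_Mapping.single T c \<in> tree_piece A W"
  by (auto simp: mem_tree_piece)

lemma tree_pcomp_piece_eq_lin: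
  "tree_pcomp_piece l v W X p q = lin (\<lambda>S. lin (\<lambda>T. diamond l W S v X T) q) p"
  by (simp add: tree_pcomp_piece_def lin_def pm.scale_sum_right)

lemma diamond_eq_0: "labelled_by B T \<Longrightarrow> sum X B \<noteq> W v \<Longrightarrow> diamond l W S v X T = 0"
  by (auto simp: diamond_def weight_def labelled_by_def)

lemma diamond_mem_tree_piece:
  assumes "labelled_by A S" "labelled_by B T" "composable A v B"
  shows "diamond l W S v X T \<in> tree_piece (subst_set A v B) Z"
proof (cases "sum X B = W v")
  case True
  then show ?thesis
    unfolding diamond_eq_sum_is_subst[where W = W and X = X, OF assms True]
    using tree_piece_subspace assms
    by (intro pm.subspace_sum) (auto intro!: single_mem_tree_piece is_subst_labelled)
next
  case False
  then show ?thesis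
    using diamond_eq_0[OF assms(2)] pm.subspace_0[OF tree_piece_subspace] by metis
qed

text \<open>The double sum over the intermediate tree and the final tree collapses to one over final
  trees, because contracting U in \<open>R\<close> recovers the intermediate tree
  (\<open>is_subst_unique\<close>).\<close>

lemma lin_diamond_left:
  assumes S: "labelled_by A S" and T: "labelled_by B T" and U: "labelled_by C U"
    and AB: "composable A v B" and DC: "composable (subst_set A v B) w C"
    and "sum X1 B = W1 v" and "sum X C = W w" and W: "W = glue A v B W1 X1"
    and Z: "Z = glue (subst_set A v B) w C W X"
  shows "lin (\<lambda>Q. diamond l W Q w X U) (diamond l W1 S v X1 T) =
    (\<Sum>R | \<exists>Q. is_subst v S T Q \<and> is_subst w Q U R.
      Poly_Mapping.single R (l ^ (energy Z R - (energy W1 S + energy X1 T + energy X U))))"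
proof -
  let ?D = "subst_set A v B"
  let ?F = "\<lambda>R. Poly_Mapping.single R (l ^ (energy Z R - (energy W1 S + energy X1 T + energy X U)))"
  have Q: "labelled_by ?D Q" if "is_subst v S T Q" for Q
    using S T that by (rule is_subst_labelled)
  have "lin (\<lambda>Q. diamond l W Q w X U) (diamond l W1 S v X1 T) =
      (\<Sum>Q | is_subst v S T Q.
        scale_pm (l ^ (energy W Q - (energy W1 S + energy X1 T))) (diamond l W Q w X U))"
    unfolding diamond_eq_sum_is_subst[where W = W1 and X = X1, OF S T AB assms(6)] W lin_sum lin_single ..
  also have "\<dots> = (\<Sum>Q | is_subst v S T Q. \<Sum>R | is_subst w Q U R. ?F R)"
  proof (intro sum.cong refl)
    fix Q assume "Q \<in> {Q. is_subst v S T Q}"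
    then have Q': "is_subst v S T Q"
      by simp
    note LQ = Q[OF Q']
    have le1: "energy W1 S + energy X1 T \<le> energy W Q"
      unfolding W by (rule energy_is_subst_ge[where W = W1 and X = X1, OF S T AB assms(6) Q'])
    have le2: "energy W Q + energy X U \<le> energy Z R" if "is_subst w Q U R" for R
      unfolding Z by (rule energy_is_subst_ge[where W = W and X = X, OF LQ U DC assms(7) that])
    have "scale_pm (l ^ (energy W Q - (energy W1 S + energy X1 T)))
        (Poly_Mapping.single R (l ^ (energy Z R - (energy W Q + energy X U)))) = ?F R"
      if "is_subst w Q U R" for R
    proof -
      \<comment> \<open>The energy of the intermediate tree cancels; on natural numbers this
        requires both \<open>le1\<close> and \<open>le2\<close>.\<close>
      have "energy W Q - (energy W1 S + energy X1 T) + (energy Z R - (energy W Q + energy X U)) =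
          energy Z R - (energy W1 S + energy X1 T + energy X U)"
        using le1 le2[OF that] by linarith
      then show ?thesis
        by (simp flip: power_add)
    qed
    then show "scale_pm (l ^ (energy W Q - (energy W1 S + energy X1 T))) (diamond l W Q w X U) =
        (\<Sum>R | is_subst w Q U R. ?F R)"
      unfolding diamond_eq_sum_is_subst[where W = W and X = X, OF LQ U DC assms(7), folded Z] pm.scale_sum_right
      by (intro sum.cong) auto
  qed
  also have "\<dots> = sum ?F (\<Union>Q\<in>{Q. is_subst v S T Q}. {R. is_subst w Q U R})"
  proof (rule sum.UNION_disjoint[symmetric])
    show "finite {Q. is_subst v S T Q}"
      using S T AB by (rule finite_is_subst)
    show "\<forall>Q\<in>{Q. is_subst v S T Q}. finite {R. is_subst w Q U R}"
      using Q finite_is_subst[OF _ U DC] by blast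
    show "\<forall>Q\<in>{Q. is_subst v S T Q}. \<forall>Q'\<in>{Q. is_subst v S T Q}. Q \<noteq> Q' \<longrightarrow>
        {R. is_subst w Q U R} \<inter> {R. is_subst w Q' U R} = {}"
    proof (intro ballI impI, rule ccontr)
      fix Q Q' assume *: "Q \<in> {Q. is_subst v S T Q}" "Q' \<in> {Q. is_subst v S T Q}" "Q \<noteq> Q'"
        "{R. is_subst w Q U R} \<inter> {R. is_subst w Q' U R} \<noteq> {}"
      then obtain R where R: "is_subst w Q U R" "is_subst w Q' U R"
        by blast
      have "set_ptree Q = ?D" "set_ptree Q' = ?D" "set_ptree U = C"
        using Q * U by (auto simp: labelled_by_def)
      then have "Q = Q'"
        using DC by (intro is_subst_unique[OF R]) auto
      with * show False
        by simp
    qed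
  qed
  also have "(\<Union>Q\<in>{Q. is_subst v S T Q}. {R. is_subst w Q U R}) = {R. \<exists>Q. is_subst v S T Q \<and> is_subst w Q U R}"
    by auto
  finally show ?thesis .
qed

lemma lin_diamond_right:
  assumes S: "labelled_by A S" and T: "labelled_by B T" and U: "labelled_by C U"
    and BC: "composable B w C" and AD: "composable A v (subst_set B w C)"
    and "sum X C = X1 w" and "sum X' (subst_set B w C) = W v" and X': "X' = glue B w C X1 X"
    and Z: "Z = glue A v (subst_set B w C) W X'"
  shows "lin (\<lambda>Q. diamond l W S v X' Q) (diamond l X1 T w X U) =
    (\<Sum>R | \<exists>Q. is_subst w T U Q \<and> is_subst v S Q R.
      Poly_Mapping.single R (l ^ (energy Z R - (energy W S + energy X1 T + energy X U))))"
proof -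
  let ?D = "subst_set B w C"
  let ?F = "\<lambda>R. Poly_Mapping.single R (l ^ (energy Z R - (energy W S + energy X1 T + energy X U)))"
  have Q: "labelled_by ?D Q" if "is_subst w T U Q" for Q
    using T U that by (rule is_subst_labelled)
  have "lin (\<lambda>Q. diamond l W S v X' Q) (diamond l X1 T w X U) =
      (\<Sum>Q | is_subst w T U Q.
        scale_pm (l ^ (energy X' Q - (energy X1 T + energy X U))) (diamond l W S v X' Q))"
    unfolding diamond_eq_sum_is_subst[where W = X1 and X = X, OF T U BC assms(6)] X' lin_sum lin_single ..
  also have "\<dots> = (\<Sum>Q | is_subst w T U Q. \<Sum>R | is_subst v S Q R. ?F R)"
  proof (intro sum.cong refl)
    fix Q assume "Q \<in> {Q. is_subst w T U Q}"
    then have Q': "is_subst w T U Q"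
      by simp
    note LQ = Q[OF Q']
    have le1: "energy X1 T + energy X U \<le> energy X' Q"
      unfolding X' by (rule energy_is_subst_ge[where W = X1 and X = X, OF T U BC assms(6) Q'])
    have le2: "energy W S + energy X' Q \<le> energy Z R" if "is_subst v S Q R" for R
      unfolding Z by (rule energy_is_subst_ge[where W = W and X = X', OF S LQ AD assms(7) that])
    have "scale_pm (l ^ (energy X' Q - (energy X1 T + energy X U)))
        (Poly_Mapping.single R (l ^ (energy Z R - (energy W S + energy X' Q)))) = ?F R"
      if "is_subst v S Q R" for R
    proof -
      have "energy X' Q - (energy X1 T + energy X U) + (energy Z R - (energy W S + energy X' Q)) =
          energy Z R - (energy W S + energy X1 T + energy X U)"
        using le1 le2[OF that] by linarith
      then show ?thesis
        by (simp flip: power_add)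
    qed
    then show "scale_pm (l ^ (energy X' Q - (energy X1 T + energy X U))) (diamond l W S v X' Q) =
        (\<Sum>R | is_subst v S Q R. ?F R)"
      unfolding diamond_eq_sum_is_subst[where W = W and X = X', OF S LQ AD assms(7), folded Z] pm.scale_sum_right
      by (intro sum.cong) auto
  qed
  also have "\<dots> = sum ?F (\<Union>Q\<in>{Q. is_subst w T U Q}. {R. is_subst v S Q R})"
  proof (rule sum.UNION_disjoint[symmetric])
    show "finite {Q. is_subst w T U Q}"
      using T U BC by (rule finite_is_subst)
    show "\<forall>Q\<in>{Q. is_subst w T U Q}. finite {R. is_subst v S Q R}"
      using Q finite_is_subst[OF S _ AD] by blast
    show "\<forall>Q\<in>{Q. is_subst w T U Q}. \<forall>Q'\<in>{Q. is_subst w T U Q}. Q \<noteq> Q' \<longrightarrow>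
        {R. is_subst v S Q R} \<inter> {R. is_subst v S Q' R} = {}"
    proof (intro ballI impI, rule ccontr)
      fix Q Q' assume *: "Q \<in> {Q. is_subst w T U Q}" "Q' \<in> {Q. is_subst w T U Q}" "Q \<noteq> Q'"
        "{R. is_subst v S Q R} \<inter> {R. is_subst v S Q' R} \<noteq> {}"
      then obtain R where R: "is_subst v S Q R" "is_subst v S Q' R"
        by blast
      have "set_ptree Q = ?D" "set_ptree Q' = ?D"
        using Q * by (auto simp: labelled_by_def)
      \<comment> \<open>Here the intermediate tree is the restriction of \<open>R\<close> to
        \<open>?D\<close>, so it is determined directly by the deletion in
        \<open>is_subst\<close>.\<close>
      then have "[Q] = [Q']"
        using R by (simp add: is_subst_def)
      with * show False
        by simp
    qed
  qed
  also have "(\<Union>Q\<in>{Q. is_subst w T U Q}. {R. is_subst v S Q R}) = {R. \<exists>Q. is_subst w T U Q \<and> is_subst v S Q R}"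
    by auto
  finally show ?thesis .
qed

text \<open>A weight function on the result determines those of both factors: on \<open>B\<close> it
  is restricted, and \<open>v\<close> must carry the total weight of \<open>B\<close>. This is the
  weight used inside \<open>tree_pcomp\<close>.\<close>

definition contract_weight :: "'a set \<Rightarrow> 'a \<Rightarrow> 'a set \<Rightarrow> ('a \<Rightarrow> nat) \<Rightarrow> 'a \<Rightarrow> nat" where
  "contract_weight A v B Z = restrict (Z(v := sum Z B)) A"

lemma contract_weight_PiE:
  assumes "Z \<in> subst_set A v B \<rightarrow>\<^sub>E {1..}" "composable A v B"
  shows "contract_weight A v B Z \<in> A \<rightarrow>\<^sub>E {1..}" "restrict Z B \<in> B \<rightarrow>\<^sub>E {1..}"
proof -
  \<comment> \<open>The new weight at \<open>v\<close> must be positive again, which holds as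
    \<open>B\<close> is nonempty and its weights are positive.\<close>
  have "1 \<le> sum Z B"
  proof -
    obtain b where "b \<in> B" "finite B"
      using assms(2) by (auto simp: composable_def)
    moreover from this have "1 \<le> Z b"
      using assms(1) by (auto simp: subst_set_def PiE_iff)
    ultimately show ?thesis
      using member_le_sum[of b B Z] by simp
  qed
  then show "contract_weight A v B Z \<in> A \<rightarrow>\<^sub>E {1..}" "restrict Z B \<in> B \<rightarrow>\<^sub>E {1..}"
    using assms by (auto simp: contract_weight_def subst_set_def PiE_iff)
qed

lemma glue_contract_weight:
  assumes "Z \<in> extensional (subst_set A v B)" "composable A v B"
  shows "glue A v B (contract_weight A v B Z) (restrict Z B) = Z"
proof (rule ext)
  fix z show "glue A v B (contract_weight A v B Z) (restrict Z B) z = Z z"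
    using assms by (auto simp: glue_def subst_set_def contract_weight_def extensional_def composable_def)
qed

lemma glue_PiE:
  assumes "composable A v B" "W \<in> A \<rightarrow>\<^sub>E G" "X \<in> B \<rightarrow>\<^sub>E G"
  shows "glue A v B W X \<in> subst_set A v B \<rightarrow>\<^sub>E G"
  using assms by (auto simp: glue_def subst_set_def PiE_iff)

lemma restrict_glue:
  assumes "X \<in> B \<rightarrow>\<^sub>E G"
  shows "restrict (glue A v B W X) B = X"
proof (rule ext)
  fix z show "restrict (glue A v B W X) B z = X z"
    using assms by (auto simp: glue_def subst_set_def PiE_iff extensional_def)
qed

lemma contract_weight_glue:
  assumes "composable A v B" "W \<in> A \<rightarrow>\<^sub>E G" "sum X B = W v"
  shows "contract_weight A v B (glue A v B W X) = W"
proof (rule ext)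
  have "sum (glue A v B W X) B = sum X B"
    by (intro sum.cong) (auto simp: glue_def subst_set_def)
  then show "contract_weight A v B (glue A v B W X) z = W z" for z
    using assms by (auto simp: contract_weight_def glue_def subst_set_def PiE_iff extensional_def composable_def)
qed

lemma sum_contract_weight: "v \<in> A \<Longrightarrow> sum (restrict Z B) B = contract_weight A v B Z v"
  by (simp add: contract_weight_def)

lemma tree_pcomp_apply:
  assumes "Z \<in> subst_set A v B \<rightarrow>\<^sub>E {1..}"
  shows "tree_pcomp l A v B x y Z =
    lin (\<lambda>S. lin (\<lambda>T. diamond l (contract_weight A v B Z) S v (restrict Z B) T) (y (restrict Z B)))
      (x (contract_weight A v B Z))"
  using assms by (simp add: tree_pcomp_def tree_pcomp_piece_eq_lin Let_def contract_weight_def)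

lemma tree_pcomp_outside:
  assumes "Z \<notin> subst_set A v B \<rightarrow>\<^sub>E {1..}"
  shows "tree_pcomp l A v B x y Z = 0"
  using assms by (simp add: tree_pcomp_def)

definition relabel_pm :: "('a \<Rightarrow> 'b) \<Rightarrow> ('a ptree \<Rightarrow>\<^sub>0 'k) \<Rightarrow> ('b ptree \<Rightarrow>\<^sub>0 'k::field)" where
  "relabel_pm \<sigma> = lin (\<lambda>T. Poly_Mapping.single (map_ptree \<sigma> T) 1)"

lemma tree_relabel_eq:
  "tree_relabel A \<sigma> x W =
     (if W \<in> \<sigma> ` A \<rightarrow>\<^sub>E {1..} then relabel_pm \<sigma> (x (restrict (W \<circ> \<sigma>) A)) else 0)"
  by (simp add: tree_relabel_def relabel_pm_def lin_def Let_def)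

lemma relabel_pm_cong:
  assumes "p \<in> tree_piece A W" "\<And>a. a \<in> A \<Longrightarrow> \<sigma> a = \<tau> a"
  shows "relabel_pm \<sigma> p = relabel_pm \<tau> p"
  unfolding relabel_pm_def
proof (rule lin_cong)
  fix T assume "T \<in> Poly_Mapping.keys p"
  then have "set_ptree T = A"
    using assms(1) by (auto simp: mem_tree_piece labelled_by_def)
  then have "map_ptree \<sigma> T = map_ptree \<tau> T"
    using assms(2) by (intro ptree.map_cong) auto
  then show "Poly_Mapping.single (map_ptree \<sigma> T) 1 = Poly_Mapping.single (map_ptree \<tau> T) (1 :: 'b)"
    by simp
qed

lemma relabel_pm_id [simp]: "relabel_pm id p = p"
  by (simp add: relabel_pm_def ptree.map_id)

lemma relabel_pm_comp: "relabel_pm \<tau> (relabel_pm \<sigma> p) = relabel_pm (\<tau> \<circ> \<sigma>) p"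
  by (simp add: relabel_pm_def lin_lin ptree.map_comp)

lemma labelled_by_map_ptree:
  "labelled_by A T \<Longrightarrow> inj_on \<sigma> A \<Longrightarrow> labelled_by (\<sigma> ` A) (map_ptree \<sigma> T)"
  by (auto simp: labelled_by_def vertices_map_ptree distinct_map ptree.set_map)

lemma relabel_pm_mem_tree_piece:
  assumes "p \<in> tree_piece A W" "inj_on \<sigma> A"
  shows "relabel_pm \<sigma> p \<in> tree_piece (\<sigma> ` A) X"
  unfolding relabel_pm_def using assms
  by (intro lin_mem_tree_piece single_mem_tree_piece labelled_by_map_ptree) (auto simp: mem_tree_piece)

lemma restrict_comp_PiE: "W \<in> \<sigma> ` A \<rightarrow>\<^sub>E G \<Longrightarrow> restrict (W \<circ> \<sigma>) A \<in> A \<rightarrow>\<^sub>E G"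
  by auto

text \<open>Relabelling is a bijection between the two sets of resulting trees, and it preserves the
  three energies in the exponent.\<close>

lemma diamond_relabel:
  assumes S: "labelled_by A S" and T: "labelled_by B T" and AB: "composable A v B"
    and \<sigma>: "inj_on \<sigma> A" and \<tau>: "inj_on \<tau> B" and AB': "composable (\<sigma> ` A) (\<sigma> v) (\<tau> ` B)"
    and \<rho>: "\<rho> = (\<lambda>z. if z \<in> B then \<tau> z else \<sigma> z)"
    and W: "\<And>x. x \<in> A \<Longrightarrow> W' x = W (\<sigma> x)" and X: "\<And>x. x \<in> B \<Longrightarrow> X' x = X (\<tau> x)"
  shows "diamond l W (map_ptree \<sigma> S) (\<sigma> v) X (map_ptree \<tau> T) = relabel_pm \<rho> (diamond l W' S v X' T)"
proof -
  let ?D = "subst_set A v B"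
  let ?D' = "subst_set (\<sigma> ` A) (\<sigma> v) (\<tau> ` B)"
  have v: "v \<in> A" and disj: "(A - {v}) \<inter> B = {}"
    using AB by (auto simp: composable_def)
  have A: "set_ptree S = A" and B: "set_ptree T = B"
    using S T by (auto simp: labelled_by_def)
  have sumX: "sum X (\<tau> ` B) = sum X' B"
    using \<tau> X by (simp add: sum.reindex)
  have S': "labelled_by (\<sigma> ` A) (map_ptree \<sigma> S)" and T': "labelled_by (\<tau> ` B) (map_ptree \<tau> T)"
    using S T \<sigma> \<tau> by (auto intro: labelled_by_map_ptree)
  show ?thesis
  proof (cases "sum X' B = W' v")
    case False
    then show ?thesis
      using W[OF v] diamond_eq_0[OF T, of X' W' v l S] diamond_eq_0[OF T', of X W "\<sigma> v" l "map_ptree \<sigma> S"]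
      by (simp add: sumX relabel_pm_def)
  next
    case True
    then have True': "sum X (\<tau> ` B) = W (\<sigma> v)"
      using W[OF v] by (simp add: sumX)
    have \<sigma>A: "\<sigma> ` A - {\<sigma> v} = \<sigma> ` (A - {v})"
      using \<sigma> v by (auto dest: inj_onD)
    \<comment> \<open>The two parts have disjoint images because the relabelled sets are
      composable.\<close>
    have inj: "inj_on \<rho> ?D"
    proof (rule inj_onI)
      fix x y assume "x \<in> ?D" "y \<in> ?D" "\<rho> x = \<rho> y"
      moreover have "\<sigma> x \<noteq> \<tau> y" if "x \<in> A - {v}" "y \<in> B" for x y
        using that AB' \<sigma>A by (auto simp: composable_def)
      ultimately show "x = y"
        using inj_onD[OF \<sigma>, of x y] inj_onD[OF \<tau>, of x y] by (auto simp: \<rho> subst_set_def split: if_splits) metis+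
    qed
    have \<rho>D: "\<rho> ` ?D = ?D'"
      using disj unfolding subst_set_def \<sigma>A by (auto simp: \<rho> image_iff)
    have setR: "set_ptree R = ?D" if "is_subst v S T R" for R
      using that by (simp add: is_subst_def A B)
    have bij: "bij_betw (map_ptree \<rho>) {R. is_subst v S T R} {R. is_subst (\<sigma> v) (map_ptree \<sigma> S) (map_ptree \<tau> T) R}"
      unfolding bij_betw_def
    proof (intro conjI set_eqI iffI inj_onI)
      fix R R' assume "R \<in> {R. is_subst v S T R}" "R' \<in> {R. is_subst v S T R}" "map_ptree \<rho> R = map_ptree \<rho> R'"
      then show "R = R'"
        using setR inj by (intro map_ptree_inject_on[of \<rho> R R']) auto
    next
      fix R' assume "R' \<in> map_ptree \<rho> ` {R. is_subst v S T R}"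
      then obtain R where R: "is_subst v S T R" "R' = map_ptree \<rho> R"
        by blast
      have "is_subst (\<sigma> v) (map_ptree \<sigma> S) (map_ptree \<tau> T) (map_ptree \<rho> R)"
        using R(1) AB inj \<sigma> disj by (intro is_subst_relabel) (auto simp: A B setR[OF R(1)] \<rho>)
      then show "R' \<in> {R. is_subst (\<sigma> v) (map_ptree \<sigma> S) (map_ptree \<tau> T) R}"
        using R(2) by simp
    next
      fix R' assume "R' \<in> {R. is_subst (\<sigma> v) (map_ptree \<sigma> S) (map_ptree \<tau> T) R}"
      then have R': "is_subst (\<sigma> v) (map_ptree \<sigma> S) (map_ptree \<tau> T) R'"
        by simp
      \<comment> \<open>Surjectivity is \<open>is_subst_relabel\<close> for the inverse
        relabellings.\<close>
      define \<rho>' where "\<rho>' = inv_into ?D \<rho>"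
      define \<sigma>' where "\<sigma>' = inv_into A \<sigma>"
      define \<tau>' where "\<tau>' = inv_into B \<tau>"
      have setR': "set_ptree R' = ?D'"
        using R' by (simp add: is_subst_def A B ptree.set_map)
      have "is_subst (\<sigma>' (\<sigma> v)) (map_ptree \<sigma>' (map_ptree \<sigma> S)) (map_ptree \<tau>' (map_ptree \<tau> T)) (map_ptree \<rho>' R')"
      proof (rule is_subst_relabel[OF R'])
        show "composable (set_ptree (map_ptree \<sigma> S)) (\<sigma> v) (set_ptree (map_ptree \<tau> T))"
          using AB' by (simp add: ptree.set_map A B)
        show "inj_on \<rho>' (set_ptree R')"
          unfolding \<rho>'_def setR' \<rho>D[symmetric] by (rule inj_on_inv_into) simp
        show "inj_on \<sigma>' (set_ptree (map_ptree \<sigma> S))"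
          unfolding \<sigma>'_def by (rule inj_on_inv_into) (simp add: ptree.set_map A)
        fix x
        show "\<rho>' x = \<sigma>' x" if x: "x \<in> set_ptree (map_ptree \<sigma> S) - {\<sigma> v}"
        proof -
          obtain a where a: "a \<in> A - {v}" "x = \<sigma> a"
            using x by (auto simp: ptree.set_map A)
          then have "x = \<rho> a" "a \<in> ?D"
            using disj by (auto simp: \<rho> subst_set_def)
          then have "\<rho>' x = a"
            unfolding \<rho>'_def using inj by (simp add: inv_into_f_f)
          then show ?thesis
            using a \<sigma> by (simp add: \<sigma>'_def inv_into_f_f)
        qed
        show "\<rho>' x = \<tau>' x" if x: "x \<in> set_ptree (map_ptree \<tau> T)"
        proof -
          obtain a where a: "a \<in> B" "x = \<tau> a"
            using x by (auto simp: ptree.set_map B)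
          then have "x = \<rho> a" "a \<in> ?D"
            by (auto simp: \<rho> subst_set_def)
          then have "\<rho>' x = a"
            unfolding \<rho>'_def using inj by (simp add: inv_into_f_f)
          then show ?thesis
            using a \<tau> by (simp add: \<tau>'_def inv_into_f_f)
        qed
      qed
      moreover have "\<sigma>' (\<sigma> v) = v"
        using v \<sigma> by (simp add: \<sigma>'_def inv_into_f_f)
      moreover have "map_ptree \<sigma>' (map_ptree \<sigma> S) = map_ptree id S"
        unfolding ptree.map_comp using \<sigma> by (intro ptree.map_cong) (auto simp: \<sigma>'_def A inv_into_f_f)
      moreover have "map_ptree \<tau>' (map_ptree \<tau> T) = map_ptree id T"
        unfolding ptree.map_comp using \<tau> by (intro ptree.map_cong) (auto simp: \<tau>'_def B inv_into_f_f)
      ultimately have "is_subst v S T (map_ptree \<rho>' R')"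
        by (simp add: ptree.map_id)
      moreover have "map_ptree \<rho> (map_ptree \<rho>' R') = map_ptree id R'"
        unfolding ptree.map_comp
        by (intro ptree.map_cong) (auto simp: \<rho>'_def setR' \<rho>D[symmetric] f_inv_into_f)
      ultimately show "R' \<in> map_ptree \<rho> ` {R. is_subst v S T R}"
        by (auto simp: ptree.map_id image_iff intro!: exI[of _ "map_ptree \<rho>' R'"])
    qed
    have "energy W (map_ptree \<sigma> S) = energy W' S" "energy X (map_ptree \<tau> T) = energy X' T"
      using S T \<sigma> \<tau> W X
      by (auto simp: energy_map_ptree labelled_by_def intro!: energy_cong)
    moreover have "energy (glue (\<sigma> ` A) (\<sigma> v) (\<tau> ` B) W X) (map_ptree \<rho> R) = energy (glue A v B W' X') R"
      if "is_subst v S T R" for R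
    proof -
      have "energy (glue (\<sigma> ` A) (\<sigma> v) (\<tau> ` B) W X) (map_ptree \<rho> R) =
          energy (glue (\<sigma> ` A) (\<sigma> v) (\<tau> ` B) W X \<circ> \<rho>) R"
        using that inj by (intro energy_map_ptree) (auto simp: is_subst_def A B)
      also have "\<dots> = energy (glue A v B W' X') R"
      proof (rule energy_cong)
        fix x assume "x \<in> set_ptree R"
        then have x: "x \<in> ?D"
          using setR[OF that] by simp
        then have "\<rho> x \<in> ?D'"
          using \<rho>D by blast
        moreover have "\<rho> x \<in> \<tau> ` B \<longleftrightarrow> x \<in> B"
          using x AB' by (auto simp: \<rho> subst_set_def composable_def \<sigma>A)
        ultimately show "(glue (\<sigma> ` A) (\<sigma> v) (\<tau> ` B) W X \<circ> \<rho>) x = glue A v B W' X' x"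
          using x W X by (auto simp: glue_def subst_set_def \<rho>)
      qed
      finally show ?thesis .
    qed
    ultimately show ?thesis
      unfolding diamond_eq_sum_is_subst[where W = W' and X = X', OF S T AB True]
        diamond_eq_sum_is_subst[where W = W and X = X, OF S' T' AB' True']
      by (subst sum.reindex_bij_betw[OF bij, symmetric])
        (auto simp: relabel_pm_def lin_sum intro!: sum.cong)
  qed
qed

section \<open>Composition with one-vertex trees\<close>

lemma is_subst_nonempty:
  assumes "labelled_by A S" "labelled_by B T" "composable A v B"
  shows "\<exists>R. is_subst v S T R"
proof -
  have "restrict (\<lambda>_. (root T, 0)) (edges S v) \<in> increasing_maps S v T (set (angles T))"
    using const_in_increasing_maps[of T S v] increasing_maps_mono[OF root_angles_subset[of T], of S v T]
    by blast
  then show ?thesis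
    using bij_betw_substitute[of S T v] assms unfolding labelled_by_def bij_betw_def by auto
qed

text \<open>All vertices of a result are in T, so deletion to T changes nothing and the only
  candidate is \<open>T\<close>; \<open>is_subst_nonempty\<close> shows that it occurs. A single
  vertex has energy 0, so the exponent vanishes.\<close>

lemma diamond_Node_left:
  assumes T: "labelled_by B T" and "finite B" "B \<noteq> {}" and wt: "sum X B = W u"
  shows "diamond l W (Node u []) u X T = Poly_Mapping.single T 1"
proof -
  have S: "labelled_by {u} (Node u [])" and comp: "composable {u} u B"
    using assms by (auto simp: labelled_by_def composable_def)
  have "R = T" if "is_subst u (Node u []) T R" for R
    using that keep_all[of R "set_ptree T"] by (simp add: is_subst_def subst_set_def)
  then have *: "{R. is_subst u (Node u []) T R} = {T}"
    using is_subst_nonempty[OF S T comp] by blast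
  then have "is_subst u (Node u []) T T"
    by blast
  then have "energy (glue {u} u B W X) T = energy W (Node u []) + energy X T"
    using energy_is_subst[of u "Node u []" T T X W "glue {u} u B W X"] assms comp
    by (simp add: labelled_by_def)
  then show ?thesis
    unfolding diamond_eq_sum_is_subst[where W = W and X = X, OF S T comp wt] * by simp
qed

text \<open>Contracting a one-vertex tree deletes nothing, so the only candidate is S with
  \<open>v\<close> renamed. No non-root vertex of T exists, so the exponent is 0.\<close>

lemma diamond_Node_right:
  assumes S: "labelled_by A S" and comp: "composable A v {u}" and wt: "X u = W v"
  shows "diamond l W S v X (Node u []) = Poly_Mapping.single (map_ptree (id(v := u)) S) 1"
proof -
  let ?R = "map_ptree (id(v := u)) S"
  have T: "labelled_by {u} (Node u [])"
    by (auto simp: labelled_by_def)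
  have wt': "sum X {u} = W v"
    using wt by simp
  have "R = ?R" if "is_subst v S (Node u []) R" for R
  proof -
    have "set_ptree R = insert u (set_ptree S - {v})"
      using that by (auto simp: is_subst_def subst_set_def)
    then show ?thesis
      using that keep_all[of R "insert u (set_ptree S - {v})"] by (simp add: is_subst_def)
  qed
  then have *: "{R. is_subst v S (Node u []) R} = {?R}"
    using is_subst_nonempty[OF S T comp] by blast
  then have "is_subst v S (Node u []) ?R"
    by blast
  then have "energy (glue A v {u} W X) ?R = energy W S + energy X (Node u [])"
    using energy_is_subst[of v S "Node u []" ?R X W "glue A v {u} W X"] assms
    by (simp add: labelled_by_def)
  then show ?thesis
    unfolding diamond_eq_sum_is_subst[where W = W and X = X, OF S T comp wt'] * by simp
qed


section \<open>The operad of trees\<close>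

lemma total_space_PiE:
  "x \<in> total_space G tree_piece A \<Longrightarrow> W \<in> A \<rightarrow>\<^sub>E G \<Longrightarrow> T \<in> Poly_Mapping.keys (x W) \<Longrightarrow> labelled_by A T"
  by (auto simp: total_space_def tree_piece_def)

lemma vector_space_fun: "vector_space (\<lambda>c x W. scale_pm c (x W :: 'b \<Rightarrow>\<^sub>0 'k::field))"
  by unfold_locales
    (auto simp: fun_eq_iff pm.scale_right_distrib pm.scale_left_distrib)

text \<open>Compared at one weight function \<open>Z\<close> of the final tree, from which all other
  weights are obtained by contraction and restriction. Once both sides are seen to use the same
  weights on A, B and C, the claim is about basis trees.\<close>

lemma tree_nested_assoc:
  assumes AB: "composable A v B" and w: "w \<in> B" and DC: "composable (subst_set A v B) w C"
    and a: "a \<in> total_space {1..} tree_piece A" and b: "b \<in> total_space {1..} tree_piece B"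
    and c: "c \<in> total_space {1..} tree_piece C"
  shows "tree_pcomp l (subst_set A v B) w C (tree_pcomp l A v B a b) c =
    tree_pcomp l A v (subst_set B w C) a (tree_pcomp l B w C b c)"
proof (rule ext)
  fix Z
  let ?D = "subst_set A v B" and ?E = "subst_set B w C"
  have v: "v \<in> A" and disj: "(A - {v}) \<inter> B = {}" and fin: "finite B" "finite C"
    using AB DC by (auto simp: composable_def)
  have wA: "w \<notin> A - {v}" and wD: "w \<in> ?D"
    using w disj by (auto simp: subst_set_def)
  have disj': "(A - {v}) \<inter> C = {}" "(B - {w}) \<inter> C = {}"
    using DC wA by (auto simp: composable_def subst_set_def)
  have BC: "composable B w C"
    using AB DC w disj' by (auto simp: composable_def)
  have AE: "composable A v ?E"
    using AB DC disj disj' by (auto simp: composable_def subst_set_def)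
  have sets: "subst_set ?D w C = subst_set A v ?E"
    using wA by (auto simp: subst_set_def)
  show "tree_pcomp l ?D w C (tree_pcomp l A v B a b) c Z =
      tree_pcomp l A v ?E a (tree_pcomp l B w C b c) Z"
  proof (cases "Z \<in> subst_set ?D w C \<rightarrow>\<^sub>E {1..}")
    case False
    then show ?thesis
      using False by (simp add: tree_pcomp_outside sets)
  next
    case Z: True
    then have Z': "Z \<in> subst_set A v ?E \<rightarrow>\<^sub>E {1..}"
      by (simp add: sets)
    define W where "W = contract_weight ?D w C Z"
    define X where "X = restrict Z C"
    define W1 where "W1 = contract_weight A v B W"
    define X1 where "X1 = restrict W B"
    define X' where "X' = restrict Z ?E"
    note PiE = contract_weight_PiE[OF Z DC, folded W_def X_def]
    note PiE1 = contract_weight_PiE[OF PiE(1) AB, folded W1_def X1_def]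
    note PiE' = contract_weight_PiE[OF Z' AE, folded X'_def]
    \<comment> \<open>Contracting C to \<open>w\<close> first does not alter the weight that
      \<open>v\<close> receives, because \<open>w\<close> carries the total weight of C.\<close>
    have sumE: "sum Z ?E = sum W B"
    proof -
      have "sum Z ?E = sum Z (B - {w}) + sum Z C"
        using fin disj' unfolding subst_set_def by (intro sum.union_disjoint) auto
      moreover have "sum W B = W w + sum W (B - {w})"
        using fin w by (simp add: sum.remove)
      moreover have "sum W (B - {w}) = sum Z (B - {w})"
        by (intro sum.cong) (auto simp: W_def contract_weight_def subst_set_def)
      moreover have "W w = sum Z C"
        using w by (simp add: W_def contract_weight_def subst_set_def)
      ultimately show ?thesis
        by simp
    qed
    have W1': "contract_weight A v ?E Z = W1"
      unfolding W1_def contract_weight_def[of A v] sumE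
      using wA by (auto simp: restrict_def W_def contract_weight_def subst_set_def fun_eq_iff)
    have "sum X' C = sum Z C"
      by (intro sum.cong) (auto simp: X'_def subst_set_def)
    then have X1': "contract_weight B w C X' = X1"
      by (auto simp: contract_weight_def X'_def X1_def W_def restrict_def subst_set_def fun_eq_iff)
    have X'': "restrict X' C = X"
      by (auto simp: X'_def X_def restrict_def subst_set_def fun_eq_iff)
    have glue: "Z = glue ?D w C W X" "W = glue A v B W1 X1" "X' = glue B w C X1 X" "Z = glue A v ?E W1 X'"
      using glue_contract_weight[of Z ?D w C] glue_contract_weight[of W A v B]
        glue_contract_weight[of X' B w C] glue_contract_weight[of Z A v ?E] PiE PiE1 PiE' Z Z' AB DC BC AE
      by (simp_all add: PiE_iff W1' X1' X'' flip: W_def X_def W1_def X1_def X'_def)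
    have wt: "sum X1 B = W1 v" "sum X C = W w" "sum X C = X1 w" "sum X' ?E = W1 v"
      using sum_contract_weight[OF v, where Z = W and B = B] sum_contract_weight[OF wD, where Z = Z and B = C]
        sum_contract_weight[OF w, where Z = X' and B = C] sum_contract_weight[OF v, where Z = Z and B = ?E]
      by (simp_all only: W1' X1' X'' flip: W_def X_def W1_def X1_def X'_def)
    have basis: "lin (\<lambda>Q. diamond l W Q w X U) (diamond l W1 S v X1 T) =
        lin (\<lambda>Q. diamond l W1 S v X' Q) (diamond l X1 T w X U)"
      if S: "labelled_by A S" and T: "labelled_by B T" and U: "labelled_by C U" for S T U
    proof -
      have "set_ptree S = A" "set_ptree T = B" "set_ptree U = C"
        using S T U by (auto simp: labelled_by_def)
      then have "(\<exists>Q. is_subst v S T Q \<and> is_subst w Q U R) \<longleftrightarrow> (\<exists>Q. is_subst w T U Q \<and> is_subst v S Q R)" for R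
        using nested_iff_left[of S v T w U R] nested_iff_right[of S v T w U R] AB w DC by simp
      then show ?thesis
        unfolding lin_diamond_left[where ?W1.0 = W1 and ?X1.0 = X1 and W = W and X = X,
            OF S T U AB DC wt(1,2) glue(2,1)]
          lin_diamond_right[where W = W1 and ?X1.0 = X1 and X' = X' and X = X,
            OF S T U BC AE wt(3,4) glue(3,4)]
        by simp
    qed
    \<comment> \<open>The swap moves the sum over \<open>U\<close> outside the sum over the
      intermediate tree, so that the inner term depends only on basis trees \<open>S\<close>,
      \<open>T\<close>, \<open>U\<close>.\<close>
    have "tree_pcomp l ?D w C (tree_pcomp l A v B a b) c Z =
        lin (\<lambda>S. lin (\<lambda>T. lin (\<lambda>U. lin (\<lambda>Q. diamond l W Q w X U) (diamond l W1 S v X1 T)) (c X)) (b X1)) (a W1)"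
      unfolding tree_pcomp_apply[OF Z] W_def[symmetric] X_def[symmetric]
        tree_pcomp_apply[OF PiE(1)] W1_def[symmetric] X1_def[symmetric] lin_lin
      by (subst lin_swap) (rule refl)
    also have "\<dots> = lin (\<lambda>S. lin (\<lambda>T. lin (\<lambda>U. lin (\<lambda>Q. diamond l W1 S v X' Q) (diamond l X1 T w X U)) (c X)) (b X1)) (a W1)"
      using total_space_PiE[OF a PiE1(1)] total_space_PiE[OF b PiE1(2)] total_space_PiE[OF c PiE(2)]
      by (intro lin_cong basis) auto
    also have "\<dots> = tree_pcomp l A v ?E a (tree_pcomp l B w C b c) Z"
      unfolding tree_pcomp_apply[OF Z'] X'_def[symmetric] W1' tree_pcomp_apply[OF PiE'(2)] X1' X'' lin_lin ..
    finally show ?thesis .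
  qed
qed

lemma tree_disjoint_assoc:
  assumes AB: "composable A v B" and AC: "composable A w C" and vw: "v \<noteq> w" and BC: "B \<inter> C = {}"
    and a: "a \<in> total_space {1..} tree_piece A" and b: "b \<in> total_space {1..} tree_piece B"
    and c: "c \<in> total_space {1..} tree_piece C"
  shows "tree_pcomp l (subst_set A v B) w C (tree_pcomp l A v B a b) c =
    tree_pcomp l (subst_set A w C) v B (tree_pcomp l A w C a c) b"
proof (rule ext)
  fix Z
  let ?D = "subst_set A v B" and ?E = "subst_set A w C"
  have v: "v \<in> A" "v \<in> ?E" and w: "w \<in> A" "w \<in> ?D" and disj: "(A - {v}) \<inter> B = {}" "(A - {w}) \<inter> C = {}"
    using AB AC vw by (auto simp: composable_def subst_set_def)
  have wB: "w \<notin> B" and vC: "v \<notin> C"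
    using disj v w vw by auto
  have DC: "composable ?D w C" and EB: "composable ?E v B"
    using AB AC vw BC by (auto simp: composable_def subst_set_def)
  have sets: "subst_set ?D w C = subst_set ?E v B"
    using wB vC vw by (auto simp: subst_set_def)
  show "tree_pcomp l ?D w C (tree_pcomp l A v B a b) c Z =
      tree_pcomp l ?E v B (tree_pcomp l A w C a c) b Z"
  proof (cases "Z \<in> subst_set ?D w C \<rightarrow>\<^sub>E {1..}")
    case False
    then show ?thesis
      using False by (simp add: tree_pcomp_outside sets)
  next
    case Z: True
    then have Z': "Z \<in> subst_set ?E v B \<rightarrow>\<^sub>E {1..}"
      by (simp add: sets)
    define W where "W = contract_weight ?D w C Z"
    define W' where "W' = contract_weight ?E v B Z"
    define X where "X = restrict Z C"
    define Y where "Y = restrict Z B"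
    define W1 where "W1 = contract_weight A v B W"
    have Y: "restrict W B = Y" and X: "restrict W' C = X"
      using wB vC by (auto simp: Y_def X_def W_def W'_def contract_weight_def restrict_def subst_set_def fun_eq_iff)
    \<comment> \<open>Neither insertion point lies in the other inserted set, so neither contraction
      changes the weights used by the other; both orders reach the same weights on A.\<close>
    have "sum W B = sum Z B" "sum W' C = sum Z C"
      using wB vC by (auto intro!: sum.cong simp: W_def W'_def contract_weight_def subst_set_def)
    then have W1': "contract_weight A w C W' = W1"
      using vw wB vC v(1) w(1) disj
      by (auto simp: W1_def W_def W'_def contract_weight_def restrict_def subst_set_def fun_eq_iff)
    note PiE = contract_weight_PiE[OF Z DC, folded W_def X_def]
    note PiE' = contract_weight_PiE[OF Z' EB, folded W'_def Y_def]
    note PiE1 = contract_weight_PiE[OF PiE(1) AB, folded W1_def]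
    have glue: "Z = glue ?D w C W X" "W = glue A v B W1 Y" "Z = glue ?E v B W' Y" "W' = glue A w C W1 X"
      using glue_contract_weight[of Z ?D w C] glue_contract_weight[of W A v B]
        glue_contract_weight[of W' A w C] glue_contract_weight[of Z ?E v B] PiE PiE1 PiE' Z Z' AB AC DC EB
      by (simp_all add: PiE_iff W1' X Y flip: W_def X_def W1_def W'_def Y_def)
    have wt: "sum Y B = W1 v" "sum X C = W w" "sum X C = W1 w" "sum Y B = W' v"
      using sum_contract_weight[OF v(1), where Z = W and B = B] sum_contract_weight[OF w(2), of Z C]
        sum_contract_weight[OF w(1), where Z = W' and B = C] sum_contract_weight[OF v(2), where Z = Z and B = B]
      by (simp_all only: W1' X Y flip: W_def X_def W1_def W'_def Y_def)
    have basis: "lin (\<lambda>Q. diamond l W Q w X U) (diamond l W1 S v Y T) =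
        lin (\<lambda>Q. diamond l W' Q v Y T) (diamond l W1 S w X U)"
      if S: "labelled_by A S" and T: "labelled_by B T" and U: "labelled_by C U" for S T U
    proof -
      have "set_ptree S = A" "set_ptree T = B" "set_ptree U = C"
        using S T U by (auto simp: labelled_by_def)
      then have "(\<exists>Q. is_subst v S T Q \<and> is_subst w Q U R) \<longleftrightarrow> (\<exists>Q. is_subst w S U Q \<and> is_subst v Q T R)" for R
        using disjoint_subst_iff[of S v T w U R] disjoint_subst_iff[of S w U v T R]
          disjoint_subst_commute[OF vw, of S T U R] AB AC BC vw by (simp add: Int_commute)
      then show ?thesis
        unfolding lin_diamond_left[where ?W1.0 = W1 and ?X1.0 = Y and W = W and X = X,
            OF S T U AB DC wt(1,2) glue(2,1)]
          lin_diamond_left[where ?W1.0 = W1 and ?X1.0 = X and W = W' and X = Y,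
            OF S U T AC EB wt(3,4) glue(4,3)]
        by (simp add: add_ac)
    qed
    have "tree_pcomp l ?D w C (tree_pcomp l A v B a b) c Z =
        lin (\<lambda>S. lin (\<lambda>T. lin (\<lambda>U. lin (\<lambda>Q. diamond l W Q w X U) (diamond l W1 S v Y T)) (c X)) (b Y)) (a W1)"
      unfolding tree_pcomp_apply[OF Z] W_def[symmetric] X_def[symmetric]
        tree_pcomp_apply[OF PiE(1)] W1_def[symmetric] Y lin_lin
      by (subst lin_swap) (rule refl)
    also have "\<dots> = lin (\<lambda>S. lin (\<lambda>T. lin (\<lambda>U. lin (\<lambda>Q. diamond l W' Q v Y T) (diamond l W1 S w X U)) (c X)) (b Y)) (a W1)"
      using total_space_PiE[OF a PiE1(1)] total_space_PiE[OF b PiE'(2)] total_space_PiE[OF c PiE(2)]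
      by (intro lin_cong basis) auto
    \<comment> \<open>The sum over \<open>T\<close> is moved first past the one over
      \<open>U\<close>, then past the intermediate tree, since now \<open>T\<close> is inserted
      last.\<close>
    also have "\<dots> = lin (\<lambda>S. lin (\<lambda>U. lin (\<lambda>Q. lin (\<lambda>T. diamond l W' Q v Y T) (b Y)) (diamond l W1 S w X U)) (c X)) (a W1)"
      by (subst (2) lin_swap, subst (3) lin_swap) (rule refl)
    also have "\<dots> = tree_pcomp l ?E v B (tree_pcomp l A w C a c) b Z"
      unfolding tree_pcomp_apply[OF Z'] W'_def[symmetric] Y_def[symmetric]
        tree_pcomp_apply[OF PiE'(1)] W1' X lin_lin ..
    finally show ?thesis .
  qed
qed

lemma tree_pcomp_closed:
  assumes AB: "composable A v B"
    and a: "a \<in> total_space {1..} tree_piece A" and b: "b \<in> total_space {1..} tree_piece B"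
  shows "tree_pcomp l A v B a b \<in> total_space {1..} tree_piece (subst_set A v B)"
proof -
  have "tree_pcomp l A v B a b Z \<in> tree_piece (subst_set A v B) Z" if Z: "Z \<in> subst_set A v B \<rightarrow>\<^sub>E {1..}" for Z
    unfolding tree_pcomp_apply[OF Z]
    using total_space_PiE[OF a contract_weight_PiE(1)[OF Z AB]]
      total_space_PiE[OF b contract_weight_PiE(2)[OF Z AB]] AB
    by (intro lin_mem_tree_piece diamond_mem_tree_piece) auto
  then show ?thesis
    by (simp add: total_space_def tree_pcomp_outside)
qed

text \<open>At a fixed \<open>Z\<close> only one summand of the infinite sum
  \<open>tree_unit u\<close> contributes: the vertex of weight \<open>sum Z B\<close>.\<close>

lemma tree_unit_left:
  assumes "finite B" "B \<noteq> {}" and b: "b \<in> total_space {1..} tree_piece B"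
  shows "tree_pcomp l {u} u B (tree_unit u) b = b"
proof (rule ext)
  fix Z
  have comp: "composable {u} u B" and set: "subst_set {u} u B = B"
    using assms by (auto simp: composable_def subst_set_def)
  show "tree_pcomp l {u} u B (tree_unit u) b Z = b Z"
  proof (cases "Z \<in> B \<rightarrow>\<^sub>E {1..}")
    case True
    then have Z: "Z \<in> subst_set {u} u B \<rightarrow>\<^sub>E {1..}"
      by (simp add: set)
    note PiE = contract_weight_PiE[OF Z comp]
    have res: "restrict Z B = Z"
      using True by (auto simp: PiE_iff extensional_restrict)
    have "tree_pcomp l {u} u B (tree_unit u) b Z =
        lin (\<lambda>T. diamond l (contract_weight {u} u B Z) (Node u []) u Z T) (b Z)"
      unfolding tree_pcomp_apply[OF Z] res using PiE(1) by (simp add: tree_unit_def)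
    also have "\<dots> = lin (\<lambda>T. Poly_Mapping.single T 1) (b Z)"
      using total_space_PiE[OF b True] assms(1,2)
      by (intro lin_cong diamond_Node_left) (auto simp: contract_weight_def)
    finally show ?thesis
      by simp
  next
    case False
    then show ?thesis
      using b by (simp add: tree_pcomp_outside set total_space_def)
  qed
qed

lemma tree_unit_right:
  assumes comp: "composable A v {u}" and a: "a \<in> total_space {1..} tree_piece A"
  shows "tree_pcomp l A v {u} a (tree_unit u) = tree_relabel A (id(v := u)) a"
proof (rule ext)
  fix Z
  have set: "id(v := u) ` A = subst_set A v {u}"
    using comp by (auto simp: composable_def subst_set_def)
  show "tree_pcomp l A v {u} a (tree_unit u) Z = tree_relabel A (id(v := u)) a Z"
  proof (cases "Z \<in> subst_set A v {u} \<rightarrow>\<^sub>E {1..}")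
    case Z: True
    note PiE = contract_weight_PiE[OF Z comp]
    \<comment> \<open>Contracting along a single vertex is a mere pullback along the renaming of
      \<open>v\<close> to \<open>u\<close>.\<close>
    have W: "contract_weight A v {u} Z = restrict (Z \<circ> id(v := u)) A"
      by (auto simp: contract_weight_def restrict_def fun_eq_iff)
    have "tree_pcomp l A v {u} a (tree_unit u) Z =
        lin (\<lambda>S. diamond l (contract_weight A v {u} Z) S v (restrict Z {u}) (Node u []))
          (a (contract_weight A v {u} Z))"
      unfolding tree_pcomp_apply[OF Z] using PiE(2) by (simp add: tree_unit_def)
    also have "\<dots> = relabel_pm (id(v := u)) (a (contract_weight A v {u} Z))"
      unfolding relabel_pm_def using total_space_PiE[OF a PiE(1)] comp
      by (intro lin_cong diamond_Node_right) (auto simp: contract_weight_def composable_def)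
    finally show ?thesis
      using Z unfolding tree_relabel_eq set by (simp add: W)
  next
    case False
    then show ?thesis
      unfolding tree_relabel_eq set by (simp add: tree_pcomp_outside)
  qed
qed

text \<open>Pulling a weight function back along the relabelling commutes with contraction and
  restriction; on basis trees the claim is then \<open>diamond_relabel\<close>.\<close>

lemma tree_equivariance:
  assumes AB: "composable A v B" and \<sigma>: "inj_on \<sigma> A" and \<tau>: "inj_on \<tau> B"
    and AB': "composable (\<sigma> ` A) (\<sigma> v) (\<tau> ` B)"
    and a: "a \<in> total_space {1..} tree_piece A" and b: "b \<in> total_space {1..} tree_piece B"
  shows "tree_pcomp l (\<sigma> ` A) (\<sigma> v) (\<tau> ` B) (tree_relabel A \<sigma> a) (tree_relabel B \<tau> b) =
    tree_relabel (subst_set A v B) (\<lambda>z. if z \<in> B then \<tau> z else \<sigma> z) (tree_pcomp l A v B a b)"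
proof (rule ext)
  fix Z
  define \<rho> where "\<rho> = (\<lambda>z. if z \<in> B then \<tau> z else \<sigma> z)"
  let ?D = "subst_set A v B" and ?D' = "subst_set (\<sigma> ` A) (\<sigma> v) (\<tau> ` B)"
  have v: "v \<in> A" and disj: "(A - {v}) \<inter> B = {}"
    using AB by (auto simp: composable_def)
  have \<sigma>A: "\<sigma> ` A - {\<sigma> v} = \<sigma> ` (A - {v})"
    using \<sigma> v by (auto dest: inj_onD)
  have \<rho>D: "\<rho> ` ?D = ?D'"
    using disj unfolding subst_set_def \<sigma>A by (auto simp: \<rho>_def image_iff)
  show "tree_pcomp l (\<sigma> ` A) (\<sigma> v) (\<tau> ` B) (tree_relabel A \<sigma> a) (tree_relabel B \<tau> b) Z =
      tree_relabel ?D \<rho> (tree_pcomp l A v B a b) Z"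
  proof (cases "Z \<in> ?D' \<rightarrow>\<^sub>E {1..}")
    case Z: True
    define W where "W = contract_weight (\<sigma> ` A) (\<sigma> v) (\<tau> ` B) Z"
    define X where "X = restrict Z (\<tau> ` B)"
    define Y where "Y = restrict (Z \<circ> \<rho>) ?D"
    define W' where "W' = contract_weight A v B Y"
    define X' where "X' = restrict Y B"
    have Y: "Y \<in> ?D \<rightarrow>\<^sub>E {1..}"
      unfolding Y_def using Z by (intro restrict_comp_PiE) (simp add: \<rho>D)
    note PiE = contract_weight_PiE[OF Z AB', folded W_def X_def]
    note PiE' = contract_weight_PiE[OF Y AB, folded W'_def X'_def]
    have X': "restrict (X \<circ> \<tau>) B = X'"
      by (auto simp: X_def X'_def Y_def \<rho>_def subst_set_def restrict_def fun_eq_iff)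
    have "sum Y B = sum Z (\<tau> ` B)"
      using \<tau> by (auto simp: sum.reindex Y_def \<rho>_def subst_set_def intro!: sum.cong)
    \<comment> \<open>Injectivity ensures that the new weight at \<open>\<sigma> v\<close> is pulled
      back to \<open>v\<close> only.\<close>
    moreover have "\<sigma> z \<noteq> \<sigma> v" if "z \<in> A" "z \<noteq> v" for z
      using that \<sigma> v by (auto dest: inj_onD)
    ultimately have W': "restrict (W \<circ> \<sigma>) A = W'"
      using disj by (auto simp: W_def W'_def contract_weight_def Y_def \<rho>_def subst_set_def restrict_def fun_eq_iff)
    have "tree_pcomp l (\<sigma> ` A) (\<sigma> v) (\<tau> ` B) (tree_relabel A \<sigma> a) (tree_relabel B \<tau> b) Z =
        lin (\<lambda>S. lin (\<lambda>T. diamond l W (map_ptree \<sigma> S) (\<sigma> v) X (map_ptree \<tau> T)) (b X')) (a W')"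
      unfolding tree_pcomp_apply[OF Z] W_def[symmetric] X_def[symmetric]
      using PiE by (simp add: tree_relabel_eq X' W' relabel_pm_def lin_lin)
    also have "\<dots> = lin (\<lambda>S. lin (\<lambda>T. relabel_pm \<rho> (diamond l W' S v X' T)) (b X')) (a W')"
      using total_space_PiE[OF a PiE'(1)] total_space_PiE[OF b PiE'(2)]
      by (intro lin_cong diamond_relabel[OF _ _ AB \<sigma> \<tau> AB' \<rho>_def]) (auto simp flip: W' X')
    also have "\<dots> = tree_relabel ?D \<rho> (tree_pcomp l A v B a b) Z"
      unfolding tree_relabel_eq \<rho>D Y_def[symmetric] tree_pcomp_apply[OF Y] W'_def[symmetric] X'_def[symmetric]
      using Z by (simp add: relabel_pm_def lin_lin)
    finally show ?thesis .
  next
    case False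
    then show ?thesis
      by (simp add: tree_pcomp_outside tree_relabel_eq \<rho>D)
  qed
qed

lemma homog_apply [simp]: "homog W p W = p"
  by (simp add: homog_def)

lemma homog_mem_total_space:
  "W \<in> A \<rightarrow>\<^sub>E G \<Longrightarrow> p \<in> tree_piece A W \<Longrightarrow> homog W p \<in> total_space G tree_piece A"
  by (auto simp: homog_def total_space_def tree_piece_def)

lemma tree_relabel_comp:
  fixes \<sigma> :: "'a \<Rightarrow> 'a"
  assumes "inj_on \<sigma> A"
  shows "tree_relabel (\<sigma> ` A) \<tau> (tree_relabel A \<sigma> x) = tree_relabel A (\<tau> \<circ> \<sigma>) x"
proof (rule ext)
  fix W :: "'a \<Rightarrow> nat"
  have "restrict (restrict (W \<circ> \<tau>) (\<sigma> ` A) \<circ> \<sigma>) A = restrict (W \<circ> (\<tau> \<circ> \<sigma>)) A"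
    by (auto simp: restrict_def fun_eq_iff)
  moreover have "restrict (W \<circ> \<tau>) (\<sigma> ` A) \<in> \<sigma> ` A \<rightarrow>\<^sub>E {1..}" if "W \<in> \<tau> ` \<sigma> ` A \<rightarrow>\<^sub>E {1..}"
    using that by (rule restrict_comp_PiE)
  ultimately show "tree_relabel (\<sigma> ` A) \<tau> (tree_relabel A \<sigma> x) W = tree_relabel A (\<tau> \<circ> \<sigma>) x W"
    by (simp add: tree_relabel_eq relabel_pm_comp image_comp)
qed

lemma tree_relabel_homog:
  assumes "W \<in> \<sigma> ` A \<rightarrow>\<^sub>E {1..}"
  shows "tree_relabel A \<sigma> (homog (restrict (W \<circ> \<sigma>) A) p) = homog W (relabel_pm \<sigma> p)"
proof (rule ext)
  fix W'
  have "W' = W" if "W' \<in> \<sigma> ` A \<rightarrow>\<^sub>E {1..}" "restrict (W' \<circ> \<sigma>) A = restrict (W \<circ> \<sigma>) A"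
  proof (rule PiE_ext[OF that(1) assms])
    fix x assume "x \<in> \<sigma> ` A"
    then obtain a where a: "a \<in> A" "x = \<sigma> a"
      by blast
    then show "W' x = W x"
      using fun_cong[OF that(2), of a] by simp
  qed
  then show "tree_relabel A \<sigma> (homog (restrict (W \<circ> \<sigma>) A) p) W' = homog W (relabel_pm \<sigma> p) W'"
    using assms by (auto simp: tree_relabel_eq homog_def relabel_pm_def)
qed

lemma tree_operad:
  "operad (\<lambda>c x W. scale_pm c (x W))
     (total_space {1..} (tree_piece :: 'a set \<Rightarrow> ('a \<Rightarrow> nat) \<Rightarrow> ('a ptree \<Rightarrow>\<^sub>0 'k::field) set))
     tree_relabel (tree_pcomp l) tree_unit"
proof (intro operad.intro operad_axioms.intro)
  interpret fs: vector_space "\<lambda>c (x :: ('a \<Rightarrow> nat) \<Rightarrow> 'a ptree \<Rightarrow>\<^sub>0 'k) W. scale_pm c (x W)"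
    by (rule vector_space_fun)
  let ?Ob = "total_space {1..} (tree_piece :: 'a set \<Rightarrow> ('a \<Rightarrow> nat) \<Rightarrow> ('a ptree \<Rightarrow>\<^sub>0 'k) set)"
  show "vector_space (\<lambda>c (x :: ('a \<Rightarrow> nat) \<Rightarrow> 'a ptree \<Rightarrow>\<^sub>0 'k) W. scale_pm c (x W))"
    by (rule vector_space_fun)
  show "fs.subspace (?Ob A)" for A
    using tree_piece_subspace
    by (intro fs.subspaceI)
      (auto simp: total_space_def intro: pm.subspace_0 pm.subspace_add pm.subspace_scale)
  show "tree_relabel A \<sigma> x \<in> ?Ob (\<sigma> ` A)" if "inj_on \<sigma> A" "x \<in> ?Ob A" for A \<sigma> x
    using that
    by (auto simp: total_space_def tree_relabel_eq intro!: relabel_pm_mem_tree_piece restrict_comp_PiE)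
  show "tree_relabel A \<sigma> (x + y) = tree_relabel A \<sigma> x + tree_relabel A \<sigma> y" for A \<sigma>
    and x y :: "('a \<Rightarrow> nat) \<Rightarrow> 'a ptree \<Rightarrow>\<^sub>0 'k"
    by (auto simp: tree_relabel_eq relabel_pm_def lin_add)
  show "tree_relabel A \<sigma> (\<lambda>W. scale_pm k (x W)) = (\<lambda>W. scale_pm k (tree_relabel A \<sigma> x W))" for A \<sigma> k
    and x :: "('a \<Rightarrow> nat) \<Rightarrow> 'a ptree \<Rightarrow>\<^sub>0 'k"
    by (auto simp: tree_relabel_eq relabel_pm_def lin_scale)
  show "tree_relabel A \<sigma> x = tree_relabel A \<tau> x"
    if "\<And>a. a \<in> A \<Longrightarrow> \<sigma> a = \<tau> a" "x \<in> ?Ob A" for A \<sigma> \<tau> x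
  proof (rule ext)
    fix W :: "'a \<Rightarrow> nat"
    have "\<sigma> ` A = \<tau> ` A" "restrict (W \<circ> \<sigma>) A = restrict (W \<circ> \<tau>) A"
      using that(1) by (auto simp: restrict_def fun_eq_iff)
    moreover have "relabel_pm \<sigma> (x (restrict (W \<circ> \<tau>) A)) = relabel_pm \<tau> (x (restrict (W \<circ> \<tau>) A))"
      if "W \<in> \<tau> ` A \<rightarrow>\<^sub>E {1..}"
    proof (rule relabel_pm_cong)
      show "x (restrict (W \<circ> \<tau>) A) \<in> tree_piece A (restrict (W \<circ> \<tau>) A)"
        using restrict_comp_PiE[OF that] \<open>x \<in> ?Ob A\<close> by (simp add: total_space_def)
    qed fact
    ultimately show "tree_relabel A \<sigma> x W = tree_relabel A \<tau> x W"
      by (simp add: tree_relabel_eq)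
  qed
  show "tree_relabel A id x = x" if "x \<in> ?Ob A" for A x
    using that by (auto simp: tree_relabel_eq fun_eq_iff total_space_def PiE_iff extensional_restrict)
  show "tree_relabel (\<sigma> ` A) \<tau> (tree_relabel A \<sigma> x) = tree_relabel A (\<tau> \<circ> \<sigma>) x" if "inj_on \<sigma> A" for A \<sigma> \<tau>
    and x :: "('a \<Rightarrow> nat) \<Rightarrow> 'a ptree \<Rightarrow>\<^sub>0 'k"
    using that by (rule tree_relabel_comp)
  show "tree_pcomp l A v B x y \<in> ?Ob (subst_set A v B)"
    if "composable A v B" "x \<in> ?Ob A" "y \<in> ?Ob B" for A v B x y
    using that by (rule tree_pcomp_closed)
  show "tree_pcomp l A v B (x + x') y = tree_pcomp l A v B x y + tree_pcomp l A v B x' y" for A v B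
    and x x' y :: "('a \<Rightarrow> nat) \<Rightarrow> 'a ptree \<Rightarrow>\<^sub>0 'k"
    by (auto simp: tree_pcomp_def tree_pcomp_piece_eq_lin Let_def lin_add)
  show "tree_pcomp l A v B x (y + y') = tree_pcomp l A v B x y + tree_pcomp l A v B x y'" for A v B
    and x y y' :: "('a \<Rightarrow> nat) \<Rightarrow> 'a ptree \<Rightarrow>\<^sub>0 'k"
    by (auto simp: tree_pcomp_def tree_pcomp_piece_eq_lin Let_def lin_add lin_fun_add)
  show "tree_pcomp l A v B (\<lambda>W. scale_pm k (x W)) y = (\<lambda>W. scale_pm k (tree_pcomp l A v B x y W))" for A v B k
    and x y :: "('a \<Rightarrow> nat) \<Rightarrow> 'a ptree \<Rightarrow>\<^sub>0 'k"
    by (auto simp: tree_pcomp_def tree_pcomp_piece_eq_lin Let_def lin_scale)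
  show "tree_pcomp l A v B x (\<lambda>W. scale_pm k (y W)) = (\<lambda>W. scale_pm k (tree_pcomp l A v B x y W))" for A v B k
    and x y :: "('a \<Rightarrow> nat) \<Rightarrow> 'a ptree \<Rightarrow>\<^sub>0 'k"
    by (auto simp: tree_pcomp_def tree_pcomp_piece_eq_lin Let_def lin_scale lin_fun_scale)
  show "tree_unit u \<in> ?Ob {u}" for u
    by (auto simp: tree_unit_def total_space_def tree_piece_def labelled_by_def)
qed (fact tree_nested_assoc tree_disjoint_assoc tree_unit_left tree_unit_right tree_equivariance)+

text \<open>A nonzero component at \<open>Z\<close> forces the contraction of \<open>Z\<close> to be
  \<open>W\<close> and its restriction to be \<open>X\<close>; then \<open>Z\<close> is their gluing
  and the weight of \<open>v\<close> is the sum of \<open>X\<close>. Both \<open>pcomp_homog\<close>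
  and \<open>pcomp_current\<close> follow.\<close>

lemma tree_pcomp_homog:
  assumes AB: "composable A v B" and W: "W \<in> A \<rightarrow>\<^sub>E {1..}" and X: "X \<in> B \<rightarrow>\<^sub>E {1..}"
    and Z: "Z \<noteq> glue A v B W X \<or> sum X B \<noteq> W v"
  shows "tree_pcomp l A v B (homog W p) (homog X q) Z = 0"
proof (cases "Z \<in> subst_set A v B \<rightarrow>\<^sub>E {1..}")
  case True
  then have ext: "Z \<in> extensional (subst_set A v B)"
    by (simp add: PiE_iff)
  have "v \<in> A"
    using AB by (simp add: composable_def)
  then have "contract_weight A v B Z \<noteq> W \<or> restrict Z B \<noteq> X"
    using Z glue_contract_weight[OF ext AB] sum_contract_weight[of v A Z B] by metis
  then show ?thesis
    unfolding tree_pcomp_apply[OF True]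
  proof
    assume "restrict Z B \<noteq> X"
    then show "lin (\<lambda>S. lin (\<lambda>T. diamond l (contract_weight A v B Z) S v (restrict Z B) T) (homog X q (restrict Z B)))
        (homog W p (contract_weight A v B Z)) = 0"
      by (simp add: homog_def) (simp add: lin_def)
  qed (simp add: homog_def)
qed (rule tree_pcomp_outside)

theorem theorem8:
  fixes l :: "'k::field_char_0"
  shows "current_preserving_operad scale_pm {1..}
           (tree_piece :: 'a set \<Rightarrow> ('a \<Rightarrow> nat) \<Rightarrow> ('a ptree \<Rightarrow>\<^sub>0 'k) set)
           tree_relabel (tree_pcomp l) tree_unit"
proof (intro current_preserving_operad.intro current_preserving_operad_axioms.intro)
  let ?P = "tree_piece :: 'a set \<Rightarrow> ('a \<Rightarrow> nat) \<Rightarrow> ('a ptree \<Rightarrow>\<^sub>0 'k) set"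
  show "vector_space (scale_pm :: 'k \<Rightarrow> ('a ptree \<Rightarrow>\<^sub>0 'k) \<Rightarrow> _)"
    by (rule pm.vector_space_axioms)
  show "operad (\<lambda>c x W. scale_pm c (x W)) (total_space {1..} ?P) tree_relabel (tree_pcomp l) tree_unit"
    by (rule tree_operad)
  show "g + h \<in> {1..}" if "g \<in> {1..}" "h \<in> {1..}" for g h :: nat
    using that by simp
  show "pm.subspace (?P A W)" for A W
    by (rule tree_piece_subspace)
  show "tree_relabel A \<sigma> ` homog (restrict (W \<circ> \<sigma>) A) ` ?P A (restrict (W \<circ> \<sigma>) A) =
      homog W ` ?P (\<sigma> ` A) W"
    if \<sigma>: "inj_on \<sigma> A" and W: "W \<in> \<sigma> ` A \<rightarrow>\<^sub>E {1..}" for A \<sigma> W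
  proof -
    have "q \<in> relabel_pm \<sigma> ` ?P A (restrict (W \<circ> \<sigma>) A)" if q: "q \<in> ?P (\<sigma> ` A) W" for q
    proof
      \<comment> \<open>The preimage of \<open>q\<close> is \<open>q\<close> relabelled by the
        inverse of \<open>\<sigma>\<close> on \<open>A\<close>.\<close>
      have "relabel_pm \<sigma> (relabel_pm (inv_into A \<sigma>) q) = relabel_pm id q"
        unfolding relabel_pm_comp using q by (rule relabel_pm_cong) (auto simp: f_inv_into_f)
      then show "q = relabel_pm \<sigma> (relabel_pm (inv_into A \<sigma>) q)"
        by simp
      have "inv_into A \<sigma> ` \<sigma> ` A = A"
        using \<sigma> by (simp add: inv_into_image_cancel)
      then show "relabel_pm (inv_into A \<sigma>) q \<in> ?P A (restrict (W \<circ> \<sigma>) A)"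
        using relabel_pm_mem_tree_piece[OF q inj_on_inv_into[OF order_refl], of "restrict (W \<circ> \<sigma>) A"] by simp
    qed
    then have "relabel_pm \<sigma> ` ?P A (restrict (W \<circ> \<sigma>) A) = ?P (\<sigma> ` A) W"
      using relabel_pm_mem_tree_piece[OF _ \<sigma>] by blast
    then show ?thesis
      unfolding image_image tree_relabel_homog[OF W] by (metis image_image)
  qed
  show "tree_relabel A \<sigma> x W =
      tree_relabel A \<sigma> (homog (restrict (W \<circ> \<sigma>) A) (x (restrict (W \<circ> \<sigma>) A))) W"
    if "W \<in> \<sigma> ` A \<rightarrow>\<^sub>E {1..}" for A \<sigma> W and x :: "('a \<Rightarrow> nat) \<Rightarrow> 'a ptree \<Rightarrow>\<^sub>0 'k"
    unfolding tree_relabel_homog[OF that] using that by (simp add: tree_relabel_eq)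
  show "tree_pcomp l A v B (homog W p) (homog X q) \<in>
      homog (glue A v B W X) ` ?P (subst_set A v B) (glue A v B W X)"
    if AB: "composable A v B" and W: "W \<in> A \<rightarrow>\<^sub>E {1..}" and X: "X \<in> B \<rightarrow>\<^sub>E {1..}"
      and p: "p \<in> ?P A W" and q: "q \<in> ?P B X" for A v B W X p q
  proof
    let ?Z = "glue A v B W X" and ?c = "tree_pcomp l A v B (homog W p) (homog X q)"
    show "?c = homog ?Z (?c ?Z)"
    proof (rule ext)
      show "?c Y = homog ?Z (?c ?Z) Y" for Y
        using tree_pcomp_homog[OF AB W X, of Y l p q] by (cases "Y = ?Z") (simp_all add: homog_def[of ?Z])
    qed
    have "?c \<in> total_space {1..} ?P (subst_set A v B)"
      using AB W X p q by (intro tree_pcomp_closed homog_mem_total_space)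
    then show "?c ?Z \<in> ?P (subst_set A v B) ?Z"
      using glue_PiE[OF AB W X] by (auto simp: total_space_def)
  qed
  show "tree_pcomp l A v B (homog W p) (homog X q) = 0"
    if "composable A v B" "W \<in> A \<rightarrow>\<^sub>E {1..}" "X \<in> B \<rightarrow>\<^sub>E {1..}" "sum X B \<noteq> W v"
    for A v B W X and p q :: "'a ptree \<Rightarrow>\<^sub>0 'k"
    using tree_pcomp_homog[OF that(1-3)] that(4) by (auto simp: fun_eq_iff)
  show "tree_pcomp l A v B x y (glue A v B W X) =
      tree_pcomp l A v B (homog W (x W)) (homog X (y X)) (glue A v B W X)"
    if "composable A v B" "W \<in> A \<rightarrow>\<^sub>E {1..}" "X \<in> B \<rightarrow>\<^sub>E {1..}" "sum X B = W v"
    for A v B W X and x y :: "('a \<Rightarrow> nat) \<Rightarrow> 'a ptree \<Rightarrow>\<^sub>0 'k"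
    unfolding tree_pcomp_apply[OF glue_PiE[OF that(1-3)]] contract_weight_glue[OF that(1,2,4)]
      restrict_glue[OF that(3)] by simp
qed

end
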